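(* The following optimization problem (the query design problem) is NP-hard. Input: positive integers $L,K$, a prior $\pi$ on $\mathcal{Y}=\{1,\dots,L\}$, finite output alphabets $\mathcal{X}_1,\dots,\mathcal{X}_K$, conditional distributions $p_m(\cdot\mid y)$ on $\mathcal{X}_m$ for all $m,y$, costs $c_1,\dots,c_K>0$, and tolerances $\alpha=(\alpha_y)_{y\in\mathcal{Y}}\in(0,1)^L$. Task: solve \[ \min_{r\in\mathbb{Z}_{\ge 0}^K}\ C(r)=\sum_{m=1}^K c_m r_m\quad\text{subject to}\quad P_e(y;r)\le\alpha_y\ \text{ for all } y\in\mathcal{Y}. \]
   Context: Setting: $\mathcal{Y}=\{1,\dots,L\}$ is a finite label set and $\pi$ is a prior on $\mathcal{Y}$ with $\pi(y)>0$ for all $y$. For each model $m\in\{1,\dots,K\}$, $\mathcal{X}_m$ is a finite output alphabet and $p_m(\cdot\mid y)$ is a probability mass function on $\mathcal{X}_m$ for each $y$ (the paper's standing assumption is $p_m(x\mid y)>0$ for all $m,x,y$, and that every pair of distinct labels $y\neq y'$ is distinguished by some model, i.e. $p_m(\cdot\mid y)\neq p_m(\cdot\mid y')$ for some $m$). A query plan is $r=(r_1,\dots,r_K)\in\mathbb{Z}_{\ge 0}^K$. The ground truth $Y\sim\pi$; conditional on $Y=y$, the outputs $X_{m,t}$, $1\le m\le K$, $1\le t\le r_m$, are mutually independent with $X_{m,t}\sim p_m(\cdot\mid y)$; $X(r)$ denotes this collection. The MAP estimator $\widehat Y_r(X(r))$ is a label in $\arg\max_{y\in\mathcal{Y}}\pi(y)\prod_{m=1}^K\prod_{t=1}^{r_m}p_m(X_{m,t}\mid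 y)$ (ties broken by a fixed rule), and the statewise error probability is $P_e(y;r):=\Pr(\widehat Y_r(X(r))\neq y\mid Y=y)$. *)

theory Defs
  imports "HOL-Probability.Probability" "HOL-Computational_Algebra.Polynomial"
begin

section \<open>Turing machines\<close>

text \<open>Deterministic multi-tape machines with two-way infinite tapes. States and tape symbols are
  initial segments of the naturals; symbol 0 is the blank, 1 and 2 are the bits 0 and 1.\<close>

datatype move = Left | Stay | Right

fun shift :: "move \<Rightarrow> int" where
  "shift Left = - 1"
| "shift Stay = 0"
| "shift Right = 1"

record tm =
  tapes :: nat
  states :: nat
  symbols :: nat
  start :: nat
  accept :: nat
  reject :: nat
  delta :: "nat \<Rightarrow> nat list \<Rightarrow> nat \<times> (nat \<times> move) list"

record config =
  state :: nat
  tape :: "nat \<Rightarrow> int \<Rightarrow> nat"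
  head :: "nat \<Rightarrow> int"

definition tm_wf :: "'a tm_scheme \<Rightarrow> bool" where
  "tm_wf M \<longleftrightarrow>
     2 \<le> tapes M \<and> 3 \<le> symbols M \<and>
     start M < states M \<and> accept M < states M \<and> reject M < states M \<and> accept M \<noteq> reject M \<and>
     (\<forall>q < states M. \<forall>ss. length ss = tapes M \<and> set ss \<subseteq> {..<symbols M} \<longrightarrow>
        fst (delta M q ss) < states M \<and>
        length (snd (delta M q ss)) = tapes M \<and>
        fst ` set (snd (delta M q ss)) \<subseteq> {..<symbols M})"

definition tm_step :: "'a tm_scheme \<Rightarrow> config \<Rightarrow> config" where
  "tm_step M c =
     (if state c \<in> {accept M, reject M} then c
      else let (q, acts) = delta M (state c) (map (\<lambda>i. tape c i (head c i)) [0..<tapes M])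
           in \<lparr>state = q,
               tape = (\<lambda>i. if i < tapes M then (tape c i)(head c i := fst (acts ! i)) else tape c i),
               head = (\<lambda>i. if i < tapes M then head c i + shift (snd (acts ! i)) else head c i)\<rparr>)"

definition bit_symbol :: "bool \<Rightarrow> nat" where
  "bit_symbol b = (if b then 2 else 1)"

definition string_tape :: "bool list \<Rightarrow> int \<Rightarrow> nat" where
  "string_tape w i = (if 0 \<le> i \<and> i < int (length w) then bit_symbol (w ! nat i) else 0)"

text \<open>The string on a tape is the maximal block of bits starting at cell 0.\<close>

definition tape_string :: "(int \<Rightarrow> nat) \<Rightarrow> bool list" where
  "tape_string t = map (\<lambda>i. t (int i) = 2) [0..<(LEAST n. t (int n) \<notin> {1, 2})]"

text \<open>The \<open>i\<close>-th input string is placed on tape \<open>i\<close>; all other tapes are blank.\<close>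

definition tm_init :: "'a tm_scheme \<Rightarrow> bool list list \<Rightarrow> config" where
  "tm_init M ws =
     \<lparr>state = start M,
      tape = (\<lambda>i. if i < length ws then string_tape (ws ! i) else (\<lambda>_. 0)),
      head = (\<lambda>_. 0)\<rparr>"


section \<open>NP\<close>

text \<open>\<open>x\<close> is on tape 0 and the certificate \<open>u\<close> on tape 1 of the verifier \<open>M\<close>. Halting
  configurations are fixed points of \<^const>\<open>tm_step\<close>, so inspecting the state after a given number
  of steps tells whether the machine has accepted or rejected within that number of steps.\<close>

definition NP :: "bool list set set" where
  "NP = {A. \<exists>(M :: tm) (p :: nat poly) (q :: nat poly).
     tm_wf M \<and>
     (\<forall>x u. state ((tm_step M ^^ poly q (length x + length u)) (tm_init M [x, u]))
              \<in> {accept M, reject M}) \<and>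
     (\<forall>x. x \<in> A \<longleftrightarrow>
        (\<exists>u. length u \<le> poly p (length x) \<and>
           state ((tm_step M ^^ poly q (length x + length u)) (tm_init M [x, u])) = accept M))}"


section \<open>Oracle machines and NP-hard minimization problems\<close>

text \<open>Tape 1 is the oracle tape: one step in the query state replaces the string on it by the
  oracle's answer.\<close>

record otm = tm +
  query :: nat
  response :: nat

definition otm_wf :: "otm \<Rightarrow> bool" where
  "otm_wf M \<longleftrightarrow> tm_wf M \<and> query M < states M \<and> response M < states M \<and>
     query M \<notin> {accept M, reject M}"

definition otm_step :: "otm \<Rightarrow> (bool list \<Rightarrow> bool list) \<Rightarrow> config \<Rightarrow> config" where
  "otm_step M S c =
     (if state c = query M
      then \<lparr>state = response M,
            tape = (tape c)(1 := string_tape (S (tape_string (tape c 1)))),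
            head = (head c)(1 := 0)\<rparr>
      else tm_step M c)"

record ('i, 's) min_problem =
  instances :: "'i set"
  feasible :: "'i \<Rightarrow> 's set"
  objective :: "'i \<Rightarrow> 's \<Rightarrow> rat"
  encode_instance :: "'i \<Rightarrow> bool list"
  encode_solution :: "'s \<Rightarrow> bool list"

definition optimal :: "('i, 's) min_problem \<Rightarrow> 'i \<Rightarrow> 's \<Rightarrow> bool" where
  "optimal P I s \<longleftrightarrow> is_arg_min (objective P I) (\<lambda>s. s \<in> feasible P I) s"

text \<open>Nothing is required of a solver on strings that do not encode an instance, nor on instances
  without an optimal solution.\<close>

definition solves :: "(bool list \<Rightarrow> bool list) \<Rightarrow> ('i, 's) min_problem \<Rightarrow> bool" where
  "solves S P \<longleftrightarrow>
     (\<forall>I \<in> instances P. (\<exists>s. optimal P I s) \<longrightarrow>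
        (\<exists>s. optimal P I s \<and> S (encode_instance P I) = encode_solution P s))"

text \<open>Polynomial-time Turing reducibility of a decision problem to a minimization problem: the
  machine and its time bound must work for every solver.\<close>

definition turing_reducible :: "bool list set \<Rightarrow> ('i, 's) min_problem \<Rightarrow> bool" where
  "turing_reducible A P \<longleftrightarrow>
     (\<exists>(M :: otm) (p :: nat poly). otm_wf M \<and>
        (\<forall>S. solves S P \<longrightarrow>
           (\<forall>x. state ((otm_step M S ^^ poly p (length x)) (tm_init M [x])) =
                  (if x \<in> A then accept M else reject M))))"

definition NP_hard :: "('i, 's) min_problem \<Rightarrow> bool" where
  "NP_hard P \<longleftrightarrow> (\<forall>A \<in> NP. turing_reducible A P)"


section \<open>The query design problem\<close>

text \<open>Labels, models and the symbols of each output alphabet are numbered from 0, and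
  \<open>models I ! m ! y ! x\<close> is the probability $p_m(x \mid y)$. All numerical data are rational, so that
  an instance is a finite object.\<close>

record query_design =
  prior :: "rat list"
  models :: "rat list list list"
  costs :: "rat list"
  tolerances :: "rat list"

definition positive_distribution :: "rat list \<Rightarrow> bool" where
  "positive_distribution ps \<longleftrightarrow> (\<forall>p \<in> set ps. 0 < p) \<and> sum_list ps = 1"

definition query_design_wf :: "query_design \<Rightarrow> bool" where
  "query_design_wf I \<longleftrightarrow>
     0 < length (prior I) \<and> 0 < length (models I) \<and>
     positive_distribution (prior I) \<and>
     (\<forall>P \<in> set (models I). length P = length (prior I) \<and>
        (\<exists>n. \<forall>ps \<in> set P. length ps = n \<and> positive_distribution ps)) \<and>
     (\<forall>y < length (prior I). \<forall>y' < length (prior I). y \<noteq> y' \<longrightarrow>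
        (\<exists>P \<in> set (models I). P ! y \<noteq> P ! y')) \<and>
     length (costs I) = length (models I) \<and> (\<forall>c \<in> set (costs I). 0 < c) \<and>
     length (tolerances I) = length (prior I) \<and> (\<forall>a \<in> set (tolerances I). 0 < a \<and> a < 1)"

definition output_pmf :: "query_design \<Rightarrow> nat \<Rightarrow> nat \<Rightarrow> nat pmf" where
  "output_pmf I m y =
     (let ps = models I ! m ! y in pmf_of_list (zip [0..<length ps] (map real_of_rat ps)))"

definition queries :: "nat list \<Rightarrow> (nat \<times> nat) set" where
  "queries r = {(m, t). m < length r \<and> t < r ! m}"

text \<open>The law of $X(r)$ conditional on $Y = y$.\<close>

definition outputs_pmf :: "query_design \<Rightarrow> nat list \<Rightarrow> nat \<Rightarrow> (nat \<times> nat \<Rightarrow> nat) pmf" where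
  "outputs_pmf I r y = Pi_pmf (queries r) 0 (\<lambda>(m, t). output_pmf I m y)"

definition posterior_weight ::
  "query_design \<Rightarrow> nat list \<Rightarrow> (nat \<times> nat \<Rightarrow> nat) \<Rightarrow> nat \<Rightarrow> rat" where
  "posterior_weight I r x y =
     prior I ! y * (\<Prod>m < length r. \<Prod>t < r ! m. models I ! m ! y ! x (m, t))"

text \<open>\<open>tie\<close> is the tie-breaking rule, choosing one label from the set of maximizers.\<close>

definition map_estimate ::
  "(nat set \<Rightarrow> nat) \<Rightarrow> query_design \<Rightarrow> nat list \<Rightarrow> (nat \<times> nat \<Rightarrow> nat) \<Rightarrow> nat" where
  "map_estimate tie I r x =
     tie {y. is_arg_max (posterior_weight I r x) (\<lambda>y. y < length (prior I)) y}"

definition error_prob :: "(nat set \<Rightarrow> nat) \<Rightarrow> query_design \<Rightarrow> nat \<Rightarrow> nat list \<Rightarrow> real" where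
  "error_prob tie I y r = measure_pmf.prob (outputs_pmf I r y) {x. map_estimate tie I r x \<noteq> y}"

definition plan_cost :: "query_design \<Rightarrow> nat list \<Rightarrow> rat" where
  "plan_cost I r = (\<Sum>m < length (models I). costs I ! m * of_nat (r ! m))"

text \<open>Prefix-free binary encodings: numbers are written in binary, rationals as numerator and
  denominator in lowest terms. Only nonnegative rationals occur in instances.\<close>

fun encode_nat :: "nat \<Rightarrow> bool list" where
  "encode_nat n = (if n = 0 then [False] else True # odd n # encode_nat (n div 2))"

declare encode_nat.simps [simp del]

definition encode_rat :: "rat \<Rightarrow> bool list" where
  "encode_rat a = (let (n, d) = quotient_of a in encode_nat (nat n) @ encode_nat (nat d))"

fun encode_list :: "('a \<Rightarrow> bool list) \<Rightarrow> 'a list \<Rightarrow> bool list" where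
  "encode_list e [] = [False]"
| "encode_list e (a # as) = True # e a @ encode_list e as"

definition encode_query_design :: "query_design \<Rightarrow> bool list" where
  "encode_query_design I =
     encode_list encode_rat (prior I) @
     encode_list (encode_list (encode_list encode_rat)) (models I) @
     encode_list encode_rat (costs I) @
     encode_list encode_rat (tolerances I)"

definition query_design_problem :: "(nat set \<Rightarrow> nat) \<Rightarrow> (query_design, nat list) min_problem" where
  "query_design_problem tie =
     \<lparr>instances = {I. query_design_wf I},
      feasible = (\<lambda>I. {r. length r = length (models I) \<and>
        (\<forall>y < length (prior I). error_prob tie I y r \<le> real_of_rat (tolerances I ! y))}),
      objective = plan_cost,
      encode_instance = encode_query_design,
      encode_solution = encode_list encode_nat\<rparr>"


section \<open>The encoding is injective on instances\<close>

lemma encode_nat_prefix_free: "encode_nat a @ u = encode_nat b @ v \<Longrightarrow> a = b \<and> u = v"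
proof (induction a arbitrary: b rule: less_induct)
  case (less a)
  show ?case
  proof (cases "a = 0 \<or> b = 0")
    case True
    then show ?thesis using less.prems
      by (auto simp: encode_nat.simps[of a] encode_nat.simps[of b] encode_nat.simps[of 0]
               split: if_splits)
  next
    case False
    then have "odd a = odd b" and *: "encode_nat (a div 2) @ u = encode_nat (b div 2) @ v"
      using less.prems by (simp_all add: encode_nat.simps[of a] encode_nat.simps[of b])
    moreover have "a div 2 = b div 2 \<and> u = v"
      using less.IH[OF _ *] False by simp
    ultimately show ?thesis
      by (metis even_two_times_div_two odd_two_times_div_two_succ)
  qed
qed

lemma encode_rat_prefix_free:
  assumes "encode_rat a @ u = encode_rat b @ v" "0 \<le> a" "0 \<le> b"
  shows "a = b \<and> u = v"
proof -
  obtain n d where a: "quotient_of a = (n, d)" by fastforce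
  obtain n' d' where b: "quotient_of b = (n', d')" by fastforce
  have pos: "0 < d" "0 < d'" using a b quotient_of_denom_pos by blast+
  have "a = of_int n / of_int d" "b = of_int n' / of_int d'"
    using a b quotient_of_div by blast+
  with assms pos have nn: "0 \<le> n" "0 \<le> n'" by (simp_all add: zero_le_divide_iff)
  have "encode_nat (nat n) @ (encode_nat (nat d) @ u) = encode_nat (nat n') @ (encode_nat (nat d') @ v)"
    using assms(1) a b by (simp add: encode_rat_def)
  then have "nat n = nat n'" "nat d = nat d'" "u = v"
    using encode_nat_prefix_free by blast+
  then have "n = n'" "d = d'" using pos nn by linarith+
  then have "quotient_of a = quotient_of b" using a b by simp
  with \<open>u = v\<close> show ?thesis using quotient_of_inject by blast
qed

lemma encode_list_prefix_free:
  assumes "\<And>a b u v. a \<in> set as \<Longrightarrow> b \<in> set bs \<Longrightarrow> e a @ u = e b @ v \<Longrightarrow> a = b \<and> u = v"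
    and "encode_list e as @ u = encode_list e bs @ v"
  shows "as = bs \<and> u = v"
  using assms
proof (induction as arbitrary: bs)
  case Nil
  then show ?case by (cases bs) auto
next
  case (Cons a as)
  then obtain b bs' where bs: "bs = b # bs'" by (cases bs) auto
  with Cons.prems(2) have "e a @ (encode_list e as @ u) = e b @ (encode_list e bs' @ v)" by simp
  then have "a = b" "encode_list e as @ u = encode_list e bs' @ v"
    using Cons.prems(1)[of a b] bs by simp_all
  moreover have "as = bs' \<and> u = v"
    by (rule Cons.IH[OF _ calculation(2)], rule Cons.prems(1)) (use bs in auto)
  ultimately show ?case using bs by simp
qed

lemma inj_on_encode_query_design: "inj_on encode_query_design {I. query_design_wf I}"
proof (rule inj_onI)
  fix I J assume "I \<in> {I. query_design_wf I}" "J \<in> {I. query_design_wf I}"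
    and eq: "encode_query_design I = encode_query_design J"
  then have wf: "query_design_wf I" "query_design_wf J" by simp_all
  have rats: "as = bs \<and> u = v"
    if "\<forall>a \<in> set as. 0 < a" "\<forall>b \<in> set bs. 0 < b"
      "encode_list encode_rat as @ u = encode_list encode_rat bs @ v" for as bs u v
    by (rule encode_list_prefix_free[OF _ that(3)], rule encode_rat_prefix_free)
      (use that in \<open>auto intro: less_imp_le\<close>)
  have rows: "as = bs \<and> u = v"
    if "\<forall>ps \<in> set as. \<forall>p \<in> set ps. 0 < p" "\<forall>ps \<in> set bs. \<forall>p \<in> set ps. 0 < p"
      "encode_list (encode_list encode_rat) as @ u = encode_list (encode_list encode_rat) bs @ v"
    for as bs u v
    by (rule encode_list_prefix_free[OF _ that(3)], rule rats) (use that in auto)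
  have mods: "as = bs \<and> u = v"
    if "\<forall>P \<in> set as. \<forall>ps \<in> set P. \<forall>p \<in> set ps. 0 < p"
      "\<forall>P \<in> set bs. \<forall>ps \<in> set P. \<forall>p \<in> set ps. 0 < p"
      "encode_list (encode_list (encode_list encode_rat)) as @ u =
       encode_list (encode_list (encode_list encode_rat)) bs @ v"
    for as bs u v
    by (rule encode_list_prefix_free[OF _ that(3)], rule rows) (use that in auto)
  have pos: "\<forall>a \<in> set (prior H). 0 < a" "\<forall>a \<in> set (costs H). 0 < a"
      "\<forall>a \<in> set (tolerances H). 0 < a"
      "\<forall>P \<in> set (models H). \<forall>ps \<in> set P. \<forall>p \<in> set ps. 0 < p"
    if "query_design_wf H" for H
    using that unfolding query_design_wf_def positive_distribution_def by blast+
  note p = pos[OF wf(1)] pos[OF wf(2)]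
  have 1: "prior I = prior J \<and>
      encode_list (encode_list (encode_list encode_rat)) (models I) @
        encode_list encode_rat (costs I) @ encode_list encode_rat (tolerances I) =
      encode_list (encode_list (encode_list encode_rat)) (models J) @
        encode_list encode_rat (costs J) @ encode_list encode_rat (tolerances J)"
    by (rule rats[OF p(1,5)]) (use eq in \<open>simp add: encode_query_design_def\<close>)
  then have 2: "models I = models J \<and>
      encode_list encode_rat (costs I) @ encode_list encode_rat (tolerances I) =
      encode_list encode_rat (costs J) @ encode_list encode_rat (tolerances J)"
    using mods[OF p(4,8)] by blast
  then have 3: "costs I = costs J \<and>
      encode_list encode_rat (tolerances I) = encode_list encode_rat (tolerances J)"
    using rats[OF p(2,6)] by blast
  then have "tolerances I = tolerances J"
    using rats[OF p(3,7), of "[]" "[]"] by simp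
  with 1 2 3 show "I = J" by simp
qed

lemma query_design_problem_solver_exists: "\<exists>S. solves S (query_design_problem tie)"
proof -
  let ?P = "query_design_problem tie"
  let ?S = "\<lambda>w. encode_solution ?P
    (SOME s. optimal ?P (inv_into (instances ?P) (encode_instance ?P) w) s)"
  have "inj_on (encode_instance ?P) (instances ?P)"
    using inj_on_encode_query_design by (simp add: query_design_problem_def)
  then have "solves ?S ?P"
    unfolding solves_def by (auto intro: someI)
  then show ?thesis by blast
qed

end

theory Submission
  imports Defs
begin

text \<open>The reduction goes from an arbitrary language in NP through a tiling problem to a separation problem.

  If every model is a slightly noisy Boolean test of the label and all tolerances equal \<open>1 / 4\<close>, then
  two labels that agree on all queried models have the same output law, so their error probabilities
  add up to at least 1. Conversely, querying once each model of a family that separates all labels is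
  feasible when the noise is far below the smallest prior. Optimal plans are thus
  minimum-cost separating families of tests.

  A tiling problem (a tile for every cell, subject to local constraints) becomes a separation problem
  by splitting every constraint into two labels, which are separated exactly by those pairs of a
  cell and a tile that satisfy the constraint. Assigning a tile costs 1. Tests
  identifying the constraint are almost free, and one generic test of cost \<open>1 / 2\<close> satisfies all
  constraints except that every cell has a tile. It is used in an optimal plan if and only if there is
  no tiling. As it is the first model, the second bit of the solver's answer decides the tiling problem.

  Accepting computations are tilings by the usual tableau argument. The instance is so
  regular that nested loops over unary rulers write it down, so the only machine programs needed are
  such loops, whose running time is polynomial by construction.\<close>


section \<open>Test cover as query design\<close>

text \<open>A solver is bound only on well-formed instances that have an optimum, so the absence of
  a tiling cannot be expressed by infeasibility or by inseparable labels. The generic test is a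
  fallback that keeps every instance solvable, and the prices turn the question into a gap: every
  feasible plan pays at least \<open>N\<close> for assignments, a tiling costs less than
  \<open>N + 1 / 2\<close> in total, and the fallback costs less than \<open>N + 1\<close>. The last
  bound also rules out a second tile in a cell when the fallback is not queried, so that uniqueness
  of tiles is enforced by the prices and needs no constraint of its own.

  The oracle returns a plan and not its cost; asking whether one particular model is queried spares
  the machine all arithmetic. For the same reason all probabilities are powers of 1/2 or their
  complements to 1: loops can write such exponents in unary, whereas a uniform prior would call for
  the number of labels in binary.\<close>

lemma outputs_pmf_cong:
  assumes "\<And>m. m < length r \<Longrightarrow> 0 < r ! m \<Longrightarrow> models I ! m ! y = models I ! m ! y'"
  shows "outputs_pmf I r y = outputs_pmf I r y'"
  unfolding outputs_pmf_def
  by (rule Pi_pmf_cong) (use assms in \<open>auto simp: queries_def output_pmf_def\<close>)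

text \<open>Every outcome is an error for at least one of the two labels, and the two conditional
  laws coincide. The bound therefore holds for every decision rule, whatever \<open>tie\<close>
  is.\<close>

lemma error_prob_indistinguishable:
  assumes "\<And>m. m < length r \<Longrightarrow> 0 < r ! m \<Longrightarrow> models I ! m ! y = models I ! m ! y'"
    and "y \<noteq> y'"
  shows "1 \<le> error_prob tie I y r + error_prob tie I y' r"
proof -
  let ?M = "outputs_pmf I r y"
  let ?A = "{x. map_estimate tie I r x \<noteq> y}" and ?B = "{x. map_estimate tie I r x \<noteq> y'}"
  have "?A \<union> ?B = UNIV" using assms(2) by auto
  then have "1 = measure_pmf.prob ?M (?A \<union> ?B)" by simp
  also have "\<dots> \<le> measure_pmf.prob ?M ?A + measure_pmf.prob ?M ?B"
    by (rule measure_Un_le) auto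
  finally show ?thesis
    using outputs_pmf_cong[OF assms(1)] by (simp add: error_prob_def)
qed

lemma finite_queries: "finite (queries r)"
proof -
  have "queries r \<subseteq> (SIGMA m : {..<length r}. {..<r ! m})" by (auto simp: queries_def)
  then show ?thesis by (rule finite_subset) auto
qed

text \<open>A single outcome suffices for an upper bound: strict domination at \<open>x\<close>
  makes \<open>{y}\<close> the set of maximizers, so \<open>x\<close> is decoded correctly by every
  admissible tie rule and only its complement contributes errors.\<close>

lemma error_prob_le_of_outcome:
  assumes tie: "\<And>S. finite S \<Longrightarrow> S \<noteq> {} \<Longrightarrow> tie S \<in> S"
    and y: "y < length (prior I)"
    and max: "\<And>y'. y' < length (prior I) \<Longrightarrow> y' \<noteq> y \<Longrightarrow>
        posterior_weight I r x y' < posterior_weight I r x y"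
  shows "error_prob tie I y r \<le> 1 - pmf (outputs_pmf I r y) x"
proof -
  have "{z. is_arg_max (posterior_weight I r x) (\<lambda>y. y < length (prior I)) z} = {y}"
    using y max unfolding is_arg_max_def by (auto dest: order.asym)
  then have "map_estimate tie I r x = y"
    using tie[of "{y}"] by (simp add: map_estimate_def)
  then have "{z. map_estimate tie I r z \<noteq> y} \<subseteq> - {x}" by auto
  then have "error_prob tie I y r \<le> measure_pmf.prob (outputs_pmf I r y) (- {x})"
    unfolding error_prob_def by (intro measure_pmf.finite_measure_mono) auto
  also have "\<dots> = 1 - measure_pmf.prob (outputs_pmf I r y) {x}"
    using measure_pmf.prob_compl[of "{x}" "outputs_pmf I r y"] by (simp add: Compl_eq_Diff_UNIV)
  finally show ?thesis by (simp add: measure_pmf_single)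
qed

section \<open>Noisy binary tests with dyadic probabilities\<close>

definition noise_row :: "nat \<Rightarrow> bool \<Rightarrow> rat list" where
  "noise_row a b = (if b then [1 / 2 ^ a, 1 - 1 / 2 ^ a] else [1 - 1 / 2 ^ a, 1 / 2 ^ a])"

text \<open>The last exponent occurs twice so that the entries sum to 1 for every
  \<open>L\<close>.\<close>

definition geometric_prior :: "nat \<Rightarrow> rat list" where
  "geometric_prior L = map (\<lambda>j. 1 / 2 ^ Suc j) [0..<L - 1] @ [1 / 2 ^ (L - 1)]"

definition test_design ::
  "'m list \<Rightarrow> 'l list \<Rightarrow> ('m \<Rightarrow> 'l \<Rightarrow> bool) \<Rightarrow> ('m \<Rightarrow> rat) \<Rightarrow> nat \<Rightarrow> query_design" where
  "test_design ms ls test cost a =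
     \<lparr>prior = geometric_prior (length ls),
      models = map (\<lambda>m. map (\<lambda>l. noise_row a (test m l)) ls) ms,
      costs = map cost ms,
      tolerances = map (\<lambda>_. 1 / 4) ls\<rparr>"

lemma length_geometric_prior: "0 < L \<Longrightarrow> length (geometric_prior L) = L"
  by (simp add: geometric_prior_def)

lemma sum_list_geometric: "(\<Sum>j\<leftarrow>[0..<n]. 1 / 2 ^ Suc j :: rat) = 1 - 1 / 2 ^ n"
  by (induction n) (auto simp: field_simps)

lemma positive_geometric_prior: "positive_distribution (geometric_prior L)"
  unfolding positive_distribution_def geometric_prior_def
  using sum_list_geometric[of "L - 1"] by auto

lemma geometric_prior_bounds:
  assumes "p \<in> set (geometric_prior L)"
  shows "1 / 2 ^ (L - 1) \<le> p" "p \<le> 1"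
proof -
  obtain i where i: "p = 1 / 2 ^ i" "i \<le> L - 1"
    using assms by (auto simp: geometric_prior_def simp del: power_Suc)
  then show "1 / 2 ^ (L - 1) \<le> p" "p \<le> 1"
    by (auto intro!: divide_left_mono power_increasing)
qed

lemma positive_noise_row: "0 < a \<Longrightarrow> positive_distribution (noise_row a b)"
  by (auto simp: positive_distribution_def noise_row_def)

lemma length_noise_row [simp]: "length (noise_row a b) = 2"
  by (simp add: noise_row_def)

lemma noise_row_nth_bool:
  "noise_row a b ! (of_bool c) = (if b = c then 1 - 1 / 2 ^ a else 1 / 2 ^ a)"
  by (auto simp: noise_row_def)

lemma noise_row_eq_iff: "1 < a \<Longrightarrow> noise_row a b = noise_row a b' \<longleftrightarrow> b = b'"
proof -
  assume a: "1 < a"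
  have "(2::rat) ^ 1 < 2 ^ a" using a by (intro power_strict_increasing) auto
  then have "(2::rat) / 2 ^ a \<noteq> 1" by simp
  then have "1 / 2 ^ a \<noteq> (1 - 1 / 2 ^ a :: rat)" by (simp add: field_simps)
  then show ?thesis by (auto simp: noise_row_def)
qed

lemma pmf_noise_row:
  assumes "0 < a"
  shows "pmf (pmf_of_list (zip [0..<2] (map real_of_rat (noise_row a b)))) (of_bool b) =
    1 - 1 / 2 ^ a"
proof -
  have e: "[0..<2] = [0, 1::nat]" by (simp add: upt_rec)
  let ?xs = "zip [0..<2] (map real_of_rat (noise_row a b))"
  have "pmf_of_list_wf ?xs"
    by (auto simp: pmf_of_list_wf_def noise_row_def e of_rat_diff of_rat_divide of_rat_power)
  then show ?thesis
    by (subst pmf_pmf_of_list)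
      (auto simp: noise_row_def e of_rat_diff of_rat_divide of_rat_power)
qed

text \<open>\<open>sep\<close> makes the instance well formed and the plan that queries everything
  feasible. The bound on \<open>a\<close> puts the noise below the smallest prior
  \<open>1 / 2 ^ (length ls - 1)\<close> and keeps \<open>length ms\<close> times the noise below
  1/4.\<close>

locale test_cover =
  fixes ms :: "'m list" and ls :: "'l list" and test :: "'m \<Rightarrow> 'l \<Rightarrow> bool"
    and cost :: "'m \<Rightarrow> rat" and a :: nat and tie :: "nat set \<Rightarrow> nat"
  assumes tie: "\<And>S. finite S \<Longrightarrow> S \<noteq> {} \<Longrightarrow> tie S \<in> S"
    and ms: "ms \<noteq> []" "distinct ms" and ls: "ls \<noteq> []" "distinct ls"
    and cost: "\<And>m. m \<in> set ms \<Longrightarrow> 0 < cost m"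
    and sep: "\<And>l l'. l \<in> set ls \<Longrightarrow> l' \<in> set ls \<Longrightarrow> l \<noteq> l' \<Longrightarrow>
        \<exists>m \<in> set ms. test m l \<noteq> test m l'"
    and a: "length ls + length ms + 2 \<le> a"
begin

abbreviation "design \<equiv> test_design ms ls test cost a"

lemma length_prior [simp]: "length (prior design) = length ls"
  using ls by (simp add: test_design_def length_geometric_prior)

lemma models_nth: "m < length ms \<Longrightarrow> y < length ls \<Longrightarrow>
    models design ! m ! y = noise_row a (test (ms ! m) (ls ! y))"
  by (simp add: test_design_def)

lemma design_wf: "query_design_wf design"
proof -
  have a1: "1 < a" using a by simp
  have "\<exists>P \<in> set (models design). P ! y \<noteq> P ! y'"
    if y: "y < length ls" "y' < length ls" "y \<noteq> y'" for y y'
  proof -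
    obtain m where "m \<in> set ms" "test m (ls ! y) \<noteq> test m (ls ! y')"
      using sep[of "ls ! y" "ls ! y'"] y ls(2) by (auto simp: nth_eq_iff_index_eq)
    then show ?thesis using y a1
      by (auto simp: test_design_def noise_row_eq_iff intro!: bexI[of _ m])
  qed
  moreover have "positive_distribution (prior design)"
    by (simp add: test_design_def positive_geometric_prior)
  moreover have "\<forall>P \<in> set (models design). length P = length ls \<and>
        (\<exists>n. \<forall>ps \<in> set P. length ps = n \<and> positive_distribution ps)"
    using a1 by (auto simp: test_design_def positive_noise_row intro!: exI[of _ 2])
  ultimately show ?thesis
    using ms ls cost unfolding query_design_wf_def length_prior
    by (simp add: test_design_def)
qed

text \<open>Two labels that no queried test separates have errors adding up to at least 1, but the
  tolerances allow only 1/4 + 1/4.\<close>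

lemma feasible_separates:
  assumes "map \<rho> ms \<in> feasible (query_design_problem tie) design"
    and "l \<in> set ls" "l' \<in> set ls" "l \<noteq> l'"
  shows "\<exists>m \<in> set ms. 0 < \<rho> m \<and> test m l \<noteq> test m l'"
proof (rule ccontr)
  assume n: "\<not> ?thesis"
  obtain y y' where y: "y < length ls" "y' < length ls" "l = ls ! y" "l' = ls ! y'"
    using assms(2,3) by (auto simp: in_set_conv_nth)
  have "1 \<le> error_prob tie design y (map \<rho> ms) + error_prob tie design y' (map \<rho> ms)"
  proof (rule error_prob_indistinguishable)
    fix m assume m: "m < length (map \<rho> ms)" "0 < map \<rho> ms ! m"
    then have "test (ms ! m) l = test (ms ! m) l'" using n by (metis length_map nth_map nth_mem)
    then show "models design ! m ! y = models design ! m ! y'"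
      using m y by (simp add: models_nth)
  qed (use y assms(4) in auto)
  then have False if "error_prob tie design y (map \<rho> ms) \<le> 1 / 4"
      "error_prob tie design y' (map \<rho> ms) \<le> 1 / 4"
    using that by linarith
  moreover have "error_prob tie design z (map \<rho> ms) \<le> 1 / 4" if "z < length ls" for z
  proof -
    have "error_prob tie design z (map \<rho> ms) \<le> real_of_rat (tolerances design ! z)"
      using assms(1) that by (simp add: query_design_problem_def)
    also have "\<dots> = 1 / 4" using that by (simp add: test_design_def of_rat_divide)
    finally show ?thesis .
  qed
  ultimately show False using y(1,2) by blast
qed

text \<open>The noise-free outcome of a label has probability at least 3/4 under it. Every other
  label contradicts this outcome in some queried test, and the resulting factor
  \<open>1 / 2 ^ a\<close> outweighs any ratio of priors.\<close>

lemma separates_feasible: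
  assumes sepR: "\<And>l l'. l \<in> set ls \<Longrightarrow> l' \<in> set ls \<Longrightarrow> l \<noteq> l' \<Longrightarrow>
        \<exists>m \<in> set ms. m \<in> R \<and> test m l \<noteq> test m l'"
  shows "map (\<lambda>m. of_bool (m \<in> R)) ms \<in> feasible (query_design_problem tie) design"
proof -
  define r :: "nat list" where "r = map (\<lambda>m. of_bool (m \<in> R)) ms"
  define K where "K = length ms"
  define \<epsilon> :: rat where "\<epsilon> = 1 / 2 ^ a"
  have a0: "0 < a" using a by simp
  have eps: "0 < \<epsilon>" "\<epsilon> \<le> 1" by (auto simp: \<epsilon>_def)
  have "of_nat K * \<epsilon> \<le> 1 / 4"
  proof -
    have "K < 2 ^ K" by (rule less_exp)
    then have "4 * K \<le> 2 ^ (K + 2)" by simp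
    also have "\<dots> \<le> 2 ^ a" using a by (intro power_increasing) (auto simp: K_def)
    finally have "of_nat (4 * K) \<le> (of_nat (2 ^ a) :: rat)" by (simp only: of_nat_le_iff)
    then show ?thesis by (simp add: \<epsilon>_def field_simps)
  qed
  then have bern: "3 / 4 \<le> (1 - \<epsilon>) ^ K"
    using Bernoulli_inequality[of "- \<epsilon>" K] eps by simp
  have rK: "length r = K" "\<And>m. m < K \<Longrightarrow> r ! m = of_bool (ms ! m \<in> R)"
    by (auto simp: r_def K_def)
  \<comment> \<open>The noise-free outcome of label \<open>y\<close>; outside the queried positions
    it has the default value 0 of \<open>Pi_pmf\<close>.\<close>
  define x where "x y = (\<lambda>(m, t). if (m, t) \<in> queries r then of_bool (test (ms ! m) (ls ! y)) else (0::nat))" for y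
  have weight: "posterior_weight design r (x y) y' =
      prior design ! y' * (\<Prod>m \<in> {m. m < K \<and> ms ! m \<in> R}.
        if test (ms ! m) (ls ! y') = test (ms ! m) (ls ! y) then 1 - \<epsilon> else \<epsilon>)"
    if "y' < length ls" for y y'
  proof -
    have "(\<Prod>m < length r. \<Prod>t < r ! m. models design ! m ! y' ! x y (m, t)) =
      (\<Prod>m < K. if ms ! m \<in> R then
         (if test (ms ! m) (ls ! y') = test (ms ! m) (ls ! y) then 1 - \<epsilon> else \<epsilon>) else 1)"
      unfolding rK(1)
    proof (rule prod.cong[OF refl])
      fix m assume "m \<in> {..<K}"
      then have m: "m < K" by simp
      show "(\<Prod>t < r ! m. models design ! m ! y' ! x y (m, t)) = (if ms ! m \<in> R then
         (if test (ms ! m) (ls ! y') = test (ms ! m) (ls ! y) then 1 - \<epsilon> else \<epsilon>) else 1)"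
        using m that by (auto simp: rK x_def queries_def models_nth K_def[symmetric]
            noise_row_nth_bool \<epsilon>_def models_nth[of m y', folded K_def])
    qed
    also have "\<dots> = (\<Prod>m \<in> {m. m < K \<and> ms ! m \<in> R}.
        if test (ms ! m) (ls ! y') = test (ms ! m) (ls ! y) then 1 - \<epsilon> else \<epsilon>)"
      by (subst prod.inter_filter[symmetric]) (auto intro!: prod.cong simp: lessThan_def)
    finally show ?thesis unfolding posterior_weight_def by simp
  qed
  have prior: "1 / 2 ^ (length ls - 1) \<le> prior design ! y" "prior design ! y \<le> 1"
    if "y < length ls" for y
  proof -
    have "prior design ! y \<in> set (geometric_prior (length ls))"
      using that ls(1) by (auto simp: test_design_def length_geometric_prior intro!: nth_mem)
    then show "1 / 2 ^ (length ls - 1) \<le> prior design ! y" "prior design ! y \<le> 1"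
      by (rule geometric_prior_bounds)+
  qed
  have lt: "posterior_weight design r (x y) y' < posterior_weight design r (x y) y"
    if y: "y < length ls" "y' < length ls" "y' \<noteq> y" for y y'
  proof -
    let ?S = "{m. m < K \<and> ms ! m \<in> R}"
    let ?f = "\<lambda>m. if test (ms ! m) (ls ! y') = test (ms ! m) (ls ! y) then 1 - \<epsilon> else \<epsilon>"
    have fin: "finite ?S" by simp
    have prior0: "0 \<le> prior design ! y"
      using prior(1)[OF y(1)] by (meson order_trans zero_le_divide_1_iff zero_le_numeral zero_le_power)
    have "ls ! y' \<noteq> ls ! y" using y ls(2) by (simp add: nth_eq_iff_index_eq)
    then obtain m where m: "m \<in> set ms" "m \<in> R" "test m (ls ! y') \<noteq> test m (ls ! y)"
      using sepR y by (meson nth_mem)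
    then obtain i where i: "i \<in> ?S" "test (ms ! i) (ls ! y') \<noteq> test (ms ! i) (ls ! y)"
      by (auto simp: in_set_conv_nth K_def)
    have "prod ?f ?S = ?f i * prod ?f (?S - {i})"
      using i(1) fin by (simp only: prod.remove)
    also have "\<dots> = \<epsilon> * prod ?f (?S - {i})" using i(2) by simp
    also have "\<dots> \<le> \<epsilon> * 1"
      by (rule mult_left_mono, rule prod_le_1) (use eps in auto)
    finally have up: "prod ?f ?S \<le> \<epsilon>" by simp
    have nn: "0 \<le> prod ?f ?S" by (rule prod_nonneg) (use eps in auto)
    have "posterior_weight design r (x y) y' = prior design ! y' * prod ?f ?S"
      using weight[of y' y] y by simp
    also have "\<dots> \<le> 1 * \<epsilon>"
      using up nn prior[OF y(2)] by (intro mult_mono) auto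
    \<comment> \<open>The noise is at most a quarter of the smallest prior. The factor 3/4 is the
      Bernoulli bound for all tests being noise-free.\<close>
    also have "\<dots> < 1 / 2 ^ (length ls - 1) * (3 / 4)"
    proof -
      have "(4::rat) * 2 ^ (length ls - 1) \<le> 2 ^ a"
      proof -
        have "(4::rat) * 2 ^ (length ls - 1) = 2 ^ (length ls - 1 + 2)" by (simp add: power_add)
        also have "\<dots> \<le> 2 ^ a" using a by (intro power_increasing) auto
        finally show ?thesis .
      qed
      then have "4 * 2 ^ (length ls - 1) < 3 * (2 ^ a :: rat)"
        using zero_less_power[of "2::rat" a] by linarith
      then show ?thesis by (simp add: \<epsilon>_def field_simps)
    qed
    also have "\<dots> \<le> prior design ! y * (1 - \<epsilon>) ^ K"
      using prior[OF y(1)] bern prior0 by (intro mult_mono) auto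
    also have "\<dots> \<le> prior design ! y * (1 - \<epsilon>) ^ card ?S"
    proof -
      have "card ?S \<le> card {..<K}" by (rule card_mono) auto
      then have "(1 - \<epsilon>) ^ K \<le> (1 - \<epsilon>) ^ card ?S"
        using eps by (intro power_decreasing) auto
      then show ?thesis using prior0 by (rule mult_left_mono)
    qed
    also have "\<dots> = posterior_weight design r (x y) y"
      using weight[of y y] y by simp
    finally show ?thesis .
  qed
  have "error_prob tie design y r \<le> 1 / 4" if y: "y < length ls" for y
  proof -
    have "error_prob tie design y r \<le> 1 - pmf (outputs_pmf design r y) (x y)"
      by (rule error_prob_le_of_outcome[OF tie]) (use lt y in auto)
    also have "pmf (outputs_pmf design r y) (x y) =
        (\<Prod>(m, t)\<in>queries r. pmf (output_pmf design m y) (x y (m, t)))"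
      unfolding outputs_pmf_def
      by (subst pmf_Pi'[OF finite_queries]) (auto simp: x_def intro!: prod.cong)
    also have "\<dots> = (\<Prod>(m, t)\<in>queries r. 1 - 1 / 2 ^ a)"
    proof (rule prod.cong[OF refl], clarify)
      fix m t assume q: "(m, t) \<in> queries r"
      then have m: "m < length ms" by (auto simp: queries_def r_def)
      then show "pmf (output_pmf design m y) (x y (m, t)) = 1 - 1 / 2 ^ a"
        using q a0 y pmf_noise_row[of a "test (ms ! m) (ls ! y)"]
        by (simp add: output_pmf_def models_nth x_def)
    qed
    also have "\<dots> = (1 - 1 / 2 ^ a) ^ card (queries r)"
      by (simp add: case_prod_beta)
    also have "card (queries r) \<le> K"
    proof -
      have "queries r \<subseteq> {..<K} \<times> {0}"
        by (auto simp: queries_def rK of_bool_def split: if_splits)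
      from card_mono[OF _ this] show ?thesis by simp
    qed
    then have "(1 - 1 / 2 ^ a :: real) ^ card (queries r) \<ge> (1 - 1 / 2 ^ a) ^ K"
      by (intro power_decreasing) auto
    moreover have "3 / 4 \<le> (1 - 1 / 2 ^ a :: real) ^ K"
    proof -
      have "real_of_rat (3 / 4) \<le> real_of_rat ((1 - \<epsilon>) ^ K)" using bern by (simp only: of_rat_less_eq)
      then show ?thesis by (simp add: \<epsilon>_def of_rat_divide of_rat_power of_rat_diff)
    qed
    ultimately show ?thesis by linarith
  qed
  then show ?thesis
    unfolding r_def[symmetric] query_design_problem_def using rK
    by (auto simp: test_design_def[of _ _ _ _ a] K_def of_rat_divide length_geometric_prior ls(1))
qed

lemma plan_cost_design: "plan_cost design (map \<rho> ms) = (\<Sum>m\<in>set ms. cost m * of_nat (\<rho> m))"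
proof -
  have "plan_cost design (map \<rho> ms) = (\<Sum>i<length ms. cost (ms ! i) * of_nat (\<rho> (ms ! i)))"
    by (simp add: plan_cost_def test_design_def)
  also have "\<dots> = sum_list (map (\<lambda>m. cost m * of_nat (\<rho> m)) ms)"
    by (simp add: sum_list_sum_nth atLeast0LessThan)
  also have "\<dots> = (\<Sum>m\<in>set ms. cost m * of_nat (\<rho> m))"
    using ms(2) by (simp add: sum_list_distinct_conv_sum_set)
  finally show ?thesis .
qed

text \<open>As the tests are distinct, a plan may be treated as a function on tests instead of a
  list indexed by positions.\<close>

lemma plan_eq_map:
  assumes "r \<in> feasible (query_design_problem tie) design"
  shows "\<exists>\<rho>. r = map \<rho> ms"
proof -
  have "length r = length ms" using assms by (simp add: query_design_problem_def test_design_def)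
  then have "r = map (\<lambda>m. the (map_of (zip ms r) m)) ms"
    using ms(2) by (intro nth_equalityI) (auto simp: map_of_zip_nth)
  then show ?thesis by blast
qed

text \<open>\<open>solves\<close> demands nothing where no optimum exists, so attainment matters.
  The feasible set is infinite, but positive costs leave only finitely many plans that are no dearer
  than querying every test once.\<close>

lemma optimal_exists: "\<exists>r. optimal (query_design_problem tie) design r"
proof -
  let ?F = "feasible (query_design_problem tie) design"
  define r0 :: "nat list" where "r0 = map (\<lambda>m. of_bool (m \<in> UNIV)) ms"
  have r0: "r0 \<in> ?F" unfolding r0_def by (rule separates_feasible) (use sep in auto)
  define C where "C = plan_cost design r0"
  define b where "b = Max (insert 0 ((\<lambda>m. nat \<lceil>C / cost m\<rceil>) ` set ms))"
  let ?S = "{r \<in> ?F. plan_cost design r \<le> C}"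
  have "?S \<subseteq> {r. set r \<subseteq> {..b} \<and> length r = length ms}"
  proof clarify
    fix r assume r: "r \<in> ?F" "plan_cost design r \<le> C"
    obtain \<rho> where \<rho>: "r = map \<rho> ms" using plan_eq_map[OF r(1)] by blast
    have "\<rho> m \<le> b" if m: "m \<in> set ms" for m
    proof -
      have "cost m * of_nat (\<rho> m) \<le> (\<Sum>m\<in>set ms. cost m * of_nat (\<rho> m))"
        by (rule member_le_sum[OF m]) (use cost in \<open>auto simp: less_imp_le\<close>)
      also have "\<dots> \<le> C" using r(2) plan_cost_design \<rho> by simp
      finally have "of_nat (\<rho> m) \<le> C / cost m" using cost[OF m] by (simp add: field_simps)
      then have "int (\<rho> m) \<le> \<lceil>C / cost m\<rceil>" by linarith
      then have "\<rho> m \<le> nat \<lceil>C / cost m\<rceil>" by linarith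
      also have "\<dots> \<le> b" unfolding b_def using m by (intro Max_ge) auto
      finally show ?thesis .
    qed
    then show "set r \<subseteq> {..b} \<and> length r = length ms" using \<rho> by auto
  qed
  then have fin: "finite ?S"
    by (rule finite_subset) (simp add: finite_lists_length_eq)
  obtain s where s: "is_arg_min (plan_cost design) (\<lambda>r. r \<in> ?S) s"
    using ex_is_arg_min_if_finite[OF fin] r0 C_def by (auto intro: exI[of _ r0])
  have "is_arg_min (plan_cost design) (\<lambda>r. r \<in> ?F) s"
    unfolding is_arg_min_linorder
  proof (intro conjI ballI allI impI)
    show "s \<in> ?F" using s by (simp add: is_arg_min_linorder)
    fix r assume "r \<in> ?F"
    moreover have "plan_cost design s \<le> C" using s by (simp add: is_arg_min_linorder)
    ultimately show "plan_cost design s \<le> plan_cost design r"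
      using s unfolding is_arg_min_linorder by (cases "plan_cost design r \<le> C") auto
  qed
  then have "optimal (query_design_problem tie) design s"
    by (simp add: optimal_def query_design_problem_def)
  then show ?thesis ..
qed

lemma optimal_iff:
  "optimal (query_design_problem tie) design r \<longleftrightarrow>
     r \<in> feasible (query_design_problem tie) design \<and>
     (\<forall>r' \<in> feasible (query_design_problem tie) design. plan_cost design r \<le> plan_cost design r')"
  unfolding optimal_def is_arg_min_linorder by (auto simp: query_design_problem_def)

end


section \<open>Constraint satisfaction as test cover\<close>

type_synonym 'd window = "'d \<times> 'd \<times> 'd \<times> 'd"

datatype 'd query_model = Generic | Assign nat 'd | Ident nat "'d window option"

type_synonym 'd query_label = "((nat \<times> 'd window option) \<times> bool) option"

lemma distinct_concat_map:
  assumes "distinct xs" "\<And>x. x \<in> set xs \<Longrightarrow> distinct (f x)"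
    and "\<And>x y. x \<in> set xs \<Longrightarrow> y \<in> set xs \<Longrightarrow> x \<noteq> y \<Longrightarrow> set (f x) \<inter> set (f y) = {}"
  shows "distinct (concat (map f xs))"
  using assms
proof (induction xs)
  case (Cons x xs)
  have "set (f x) \<inter> set (f y) = {}" if "y \<in> set xs" for y
    using Cons.prems that by (intro Cons.prems(3)) auto
  then have "set (f x) \<inter> (\<Union>y\<in>set xs. set (f y)) = {}" by blast
  with Cons show ?case by simp
qed simp

text \<open>Cells are numbered linearly. The window at \<open>e\<close> consists of three
  consecutive cells and of the cell \<open>W\<close> places after the third one, which lies below it
  when rows have length \<open>W\<close>. The value of \<open>N\<close> lets the last window end at
  the last cell.\<close>

locale window_csp =
  fixes tiles :: "'d list" and N E W :: nat and ok :: "nat \<Rightarrow> 'd window \<Rightarrow> bool"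
  assumes tiles: "distinct tiles" "tiles \<noteq> []" and N: "N = E + W + 2"
begin

definition solution :: "(nat \<Rightarrow> 'd) \<Rightarrow> bool" where
  "solution v \<longleftrightarrow> (\<forall>c < N. v c \<in> set tiles) \<and> (\<forall>e < E. ok e (v e, v (e + 1), v (e + 2), v (e + W + 2)))"

text \<open>\<open>None\<close> stands for the constraint that cell \<open>e\<close> has a tile.
  \<open>Some w\<close> stands for the constraint that the window at \<open>e\<close> is not
  \<open>w\<close>: it is covered by an assignment that deviates from \<open>w\<close> at one of the
  four cells, and by any assignment whatsoever if \<open>w\<close> is allowed or \<open>e\<close>
  has no window.\<close>

fun covers :: "nat \<Rightarrow> 'd \<Rightarrow> nat \<Rightarrow> 'd window option \<Rightarrow> bool" where
  "covers c s e None \<longleftrightarrow> c = e"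
| "covers c s e (Some (a0, a1, a2, a3)) \<longleftrightarrow> \<not> (e < E \<and> \<not> ok e (a0, a1, a2, a3)) \<or>
     c = e \<and> s \<noteq> a0 \<or> c = e + 1 \<and> s \<noteq> a1 \<or> c = e + 2 \<and> s \<noteq> a2 \<or> c = e + W + 2 \<and> s \<noteq> a3"

definition windows :: "'d window option list" where
  "windows = None # map Some (List.product tiles (List.product tiles (List.product tiles tiles)))"

text \<open>All windows occur at all \<open>N\<close> cells, forbidden or not, so that the list is a
  plain nested loop. The additional label \<open>None\<close> takes the repeated last entry of the
  prior, which leaves a regular sequence of exponents to the loop.\<close>

definition query_labels :: "'d query_label list" where
  "query_labels = concat (map (\<lambda>e. concat (map (\<lambda>f. [Some ((e, f), False), Some ((e, f), True)]) windows)) [0..<N]) @ [None]"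

definition query_models :: "'d query_model list" where
  "query_models = Generic # concat (map (\<lambda>c. map (Assign c) tiles) [0..<N]) @
     concat (map (\<lambda>c. map (Ident c) windows) [0..<N])"

text \<open>Call two labels twins if they differ only in the flag. Apart from \<open>Ident\<close>,
  every test is false on the twin with flag \<open>False\<close> and so separates twins exactly if
  it is true on the other one; \<open>Ident\<close> never separates twins.\<close>

fun test :: "'d query_model \<Rightarrow> 'd query_label \<Rightarrow> bool" where
  "test m None = False"
| "test Generic (Some ((e, f), b)) \<longleftrightarrow> b \<and> f \<noteq> None"
| "test (Assign c s) (Some ((e, f), b)) \<longleftrightarrow> b \<and> covers c s e f"
| "test (Ident c f') (Some ((e, f), b)) \<longleftrightarrow> c = e \<and> f' = f"

text \<open>A multiple of \<open>N\<close>, so that one loop over the cells writes it in unary, and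
  large enough for the bound that \<open>test_cover\<close> imposes on \<open>a\<close>.\<close>

definition precision :: nat where
  "precision = N * (3 * length windows + length tiles + 4)"

fun cost :: "'d query_model \<Rightarrow> rat" where
  "cost Generic = 1 / 2"
| "cost (Assign c s) = 1"
| "cost (Ident c f) = 1 / 2 ^ precision"

lemma distinct_windows: "distinct windows"
  using tiles by (auto simp: windows_def distinct_map distinct_product)

lemma set_windows: "set windows = insert None (Some ` (set tiles \<times> set tiles \<times> set tiles \<times> set tiles))"
  by (auto simp: windows_def)

lemma set_query_labels:
  "set query_labels = insert None {Some ((e, f), b) | e f b. e < N \<and> f \<in> set windows}"
  unfolding query_labels_def by (auto simp: image_iff)

lemma set_query_models:
  "set query_models = insert Generic ((\<lambda>(c, s). Assign c s) ` ({..<N} \<times> set tiles) \<union>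
     (\<lambda>(c, f). Ident c f) ` ({..<N} \<times> set windows))"
  unfolding query_models_def by auto

lemma distinct_query_labels: "distinct query_labels"
  unfolding query_labels_def
  by (auto intro!: distinct_concat_map distinct_windows)

lemma distinct_query_models: "distinct query_models"
proof -
  have "distinct (concat (map (\<lambda>c. map (Assign c) tiles) [0..<N]))"
    by (rule distinct_concat_map) (auto simp: distinct_map tiles inj_on_def)
  moreover have "distinct (concat (map (\<lambda>c. map (Ident c) windows) [0..<N]))"
    by (rule distinct_concat_map) (auto simp: distinct_map distinct_windows inj_on_def)
  ultimately show ?thesis unfolding query_models_def by auto
qed

lemma length_concat_const:
  "(\<And>x. x \<in> set xs \<Longrightarrow> length (f x) = n) \<Longrightarrow> length (concat (map f xs)) = length xs * n"
  by (induction xs) auto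

lemma length_query_labels: "length query_labels = N * (length windows * 2) + 1"
  unfolding query_labels_def by (simp add: length_concat_const)

lemma length_query_models: "length query_models = 1 + N * length tiles + N * length windows"
  unfolding query_models_def by (simp add: length_concat_const)

lemma precision_ge: "length query_labels + length query_models + 2 \<le> precision"
proof -
  have "4 \<le> 4 * N" using N by simp
  then show ?thesis
    unfolding precision_def length_query_labels length_query_models
    by (simp add: algebra_simps)
qed

text \<open>A case rule that reduces separation to twins: two other distinct labels differ in their
  keys or one of them is \<open>None\<close>, and then an identification test separates
  them.\<close>

lemma ident_separates:
  assumes "l \<in> set query_labels" "l' \<in> set query_labels" "l \<noteq> l'"
    and "\<And>e f. \<lbrakk>e < N; f \<in> set windows; l = Some ((e, f), False) \<and> l' = Some ((e, f), True) \<or>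
        l' = Some ((e, f), False) \<and> l = Some ((e, f), True)\<rbrakk> \<Longrightarrow> P"
    and "\<And>c f. \<lbrakk>c < N; f \<in> set windows; test (Ident c f) l \<noteq> test (Ident c f) l'\<rbrakk> \<Longrightarrow> P"
  shows P
proof (cases "\<exists>e f. l = Some ((e, f), False) \<and> l' = Some ((e, f), True) \<or>
        l' = Some ((e, f), False) \<and> l = Some ((e, f), True)")
  case True
  then show ?thesis using assms(1,4) by (auto simp: set_query_labels)
next
  case False
  show ?thesis
  proof (cases l)
    case None
    then obtain e f b where "l' = Some ((e, f), b)" "e < N" "f \<in> set windows"
      using assms(2,3) by (auto simp: set_query_labels)
    then show ?thesis using assms(5)[of e f] None by simp
  next
    case (Some k)
    then obtain e f b where l: "l = Some ((e, f), b)" "e < N" "f \<in> set windows"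
      using assms(1) by (auto simp: set_query_labels)
    have "\<not> test (Ident e f) l'"
    proof (cases l')
      case (Some k')
      then obtain e' f' b' where "l' = Some ((e', f'), b')" by (metis surj_pair)
      then show ?thesis using False l assms(3) by (cases b; cases b') auto
    qed simp
    then show ?thesis using assms(5)[of e f] l by simp
  qed
qed

text \<open>Well-formedness must not depend on the existence of a tiling. \<open>Generic\<close>
  separates the twins of every window, and the twins that demand a tile at a cell are separated by
  assigning any tile there.\<close>

lemma test_cover_csp:
  assumes "\<And>S. finite S \<Longrightarrow> S \<noteq> {} \<Longrightarrow> tie S \<in> (S :: nat set)"
  shows "test_cover query_models query_labels test cost precision tie"
proof
  fix l l' assume l: "l \<in> set query_labels" "l' \<in> set query_labels" "l \<noteq> l'"
  have *: "\<exists>m\<in>set query_models. test m (Some ((e, f), False)) \<noteq> test m (Some ((e, f), True))"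
    if "e < N" "f \<in> set windows" for e f
  proof (cases f)
    case None
    have "Assign e (hd tiles) \<in> set query_models"
      using that tiles by (auto simp: set_query_models intro!: image_eqI[of _ _ "(e, hd tiles)"])
    then show ?thesis using None by (intro bexI[of _ "Assign e (hd tiles)"]) auto
  next
    case (Some w)
    then show ?thesis by (intro bexI[of _ Generic]) (auto simp: set_query_models)
  qed
  show "\<exists>m\<in>set query_models. test m l \<noteq> test m l'"
    using l
  proof (rule ident_separates)
    fix c f assume "c < N" "f \<in> set windows" "test (Ident c f) l \<noteq> test (Ident c f) l'"
    then show ?thesis by (intro bexI[of _ "Ident c f"]) (auto simp: set_query_models)
  qed (use * in metis)
next
  fix m assume "m \<in> set query_models"
  show "0 < cost m" by (cases m) auto
qed (use assms distinct_query_labels distinct_query_models precision_ge in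
    \<open>auto simp: query_labels_def query_models_def\<close>)

text \<open>All identification tests together are cheaper than the smallest relevant difference in
  cost, so they can be queried without affecting the comparison.\<close>

lemma ident_cost_less: "of_nat (N * length windows) / 2 ^ precision < (1 / 2 :: rat)"
proof -
  have "N * length windows \<le> precision - 1"
    using precision_ge length_query_models by linarith
  also have "\<dots> < 2 ^ (precision - 1)" by (rule less_exp)
  finally have "2 * (N * length windows) < 2 * 2 ^ (precision - 1)" by simp
  also have "\<dots> = 2 ^ precision" using precision_ge by (simp flip: power_Suc)
  finally have "of_nat (2 * (N * length windows)) < (of_nat (2 ^ precision) :: rat)"
    by (simp only: of_nat_less_iff)
  then show ?thesis by (simp add: field_simps)
qed

lemma cost_sum:
  "(\<Sum>m\<in>set query_models. cost m * of_nat (\<rho> m)) =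
     of_nat (\<rho> Generic) / 2 + of_nat (\<Sum>c<N. \<Sum>s\<in>set tiles. \<rho> (Assign c s)) +
     (\<Sum>c<N. \<Sum>f\<in>set windows. of_nat (\<rho> (Ident c f))) / 2 ^ precision"
proof -
  let ?A = "(\<lambda>(c, s). Assign c s) ` ({..<N} \<times> set tiles)"
  let ?I = "(\<lambda>(c, f). Ident c f) ` ({..<N} \<times> set windows)"
  let ?g = "\<lambda>m. cost m * of_nat (\<rho> m)"
  have "sum ?g (set query_models) = ?g Generic + (sum ?g ?A + sum ?g ?I)"
    unfolding set_query_models by (subst sum.insert) (auto intro!: sum.union_disjoint)
  moreover have "sum ?g ?A = of_nat (\<Sum>c<N. \<Sum>s\<in>set tiles. \<rho> (Assign c s))"
    by (subst sum.reindex) (auto simp: inj_on_def sum.cartesian_product case_prod_beta)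
  moreover have "sum ?g ?I = (\<Sum>c<N. \<Sum>f\<in>set windows. of_nat (\<rho> (Ident c f))) / 2 ^ precision"
    by (subst sum.reindex)
      (auto simp: inj_on_def sum.cartesian_product case_prod_beta sum_divide_distrib)
  ultimately show ?thesis by simp
qed

text \<open>Only assignments to \<open>c\<close> separate the twins that demand a tile at
  \<open>c\<close>, which forces \<open>N\<close> assignments. If \<open>Generic\<close> is not
  queried, the upper bound below \<open>N + 1\<close> leaves exactly one assignment per cell, and
  the separation of the remaining twins says that these assignments form a tiling.\<close>

lemma optimal_plan_iff_solution:
  assumes tie: "\<And>S. finite S \<Longrightarrow> S \<noteq> {} \<Longrightarrow> tie S \<in> (S :: nat set)"
    and opt: "optimal (query_design_problem tie) (test_design query_models query_labels test cost precision) r"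
  shows "\<exists>r0 rs. r = r0 # rs \<and> (r0 = 0 \<longleftrightarrow> (\<exists>v. solution v))"
proof -
  interpret test_cover query_models query_labels test cost precision tie
    by (rule test_cover_csp[OF tie])
  have feas: "r \<in> feasible (query_design_problem tie) design"
    and min: "\<And>r'. r' \<in> feasible (query_design_problem tie) design \<Longrightarrow> plan_cost design r \<le> plan_cost design r'"
    using opt by (auto simp: optimal_iff)
  obtain \<rho> where \<rho>: "r = map \<rho> query_models" using plan_eq_map[OF feas] by blast
  define g where "g c = (\<Sum>s\<in>set tiles. \<rho> (Assign c s))" for c
  have cost_ge: "of_nat (\<rho> Generic) / 2 + of_nat (\<Sum>c<N. g c) \<le> plan_cost design r"
    unfolding \<rho> plan_cost_design cost_sum g_def by (auto intro!: sum_nonneg divide_nonneg_nonneg)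
  have used: "\<exists>m\<in>set query_models. 0 < \<rho> m \<and> test m (Some ((e, f), True)) \<and> (\<forall>c f'. m \<noteq> Ident c f')"
    if e: "e < N" "f \<in> set windows" for e f
  proof -
    obtain m where m: "m \<in> set query_models" "0 < \<rho> m" "test m (Some ((e, f), False)) \<noteq> test m (Some ((e, f), True))"
      using feasible_separates[of \<rho> "Some ((e, f), False)" "Some ((e, f), True)"] feas e
      by (auto simp: \<rho> set_query_labels)
    then show ?thesis by (intro bexI[of _ m]) (cases m; auto)+
  qed
  have g_ge: "1 \<le> g c" if c: "c < N" for c
  proof -
    obtain m where m: "m \<in> set query_models" "0 < \<rho> m" "test m (Some ((c, None), True))" "\<forall>c f'. m \<noteq> Ident c f'"
      using used[of c None] c by (auto simp: set_windows)
    then obtain s where s: "m = Assign c s" "s \<in> set tiles"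
      by - (cases m; auto simp: set_query_models)
    have "\<rho> (Assign c s) \<le> g c"
      unfolding g_def using s(2) by (intro member_le_sum) auto
    then show ?thesis using m(2) s(1) by simp
  qed
  then have sum_ge: "N \<le> (\<Sum>c<N. g c)"
    using sum_mono[of "{..<N}" "\<lambda>_. 1" g] by simp
  \<comment> \<open>One candidate plan serves both directions: with \<open>x\<close> false and
    \<open>v\<close> a tiling, or with \<open>x\<close> true, which queries \<open>Generic\<close>,
    and \<open>v\<close> constant.\<close>
  have plan: "plan_cost design r \<le> of_nat N + of_bool x / 2 + of_nat (N * length windows) / 2 ^ precision"
    if v: "\<And>c. c < N \<Longrightarrow> v c \<in> set tiles"
      and cov: "\<And>e w. e < N \<Longrightarrow> Some w \<in> set windows \<Longrightarrow> x \<or> (\<exists>c < N. covers c (v c) e (Some w))"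
    for v x
  proof -
    define R where "R = {m. m = Generic \<and> x \<or> (\<exists>c. m = Assign c (v c)) \<or> (\<exists>c f. m = Ident c f)}"
    have "map (\<lambda>m. of_bool (m \<in> R)) query_models \<in> feasible (query_design_problem tie) design"
    proof (rule separates_feasible)
      have *: "\<exists>m\<in>set query_models. m \<in> R \<and> test m (Some ((e, f), False)) \<noteq> test m (Some ((e, f), True))"
        if e: "e < N" "f \<in> set windows" for e f
      proof (cases "f \<noteq> None \<and> x")
        case True
        then show ?thesis by (intro bexI[of _ Generic]) (auto simp: set_query_models R_def)
      next
        case False
        have "\<exists>c < N. covers c (v c) e f"
          using False cov[of e] e by (cases f) auto
        then obtain c where "c < N" "covers c (v c) e f" by blast
        then show ?thesis using v[of c]
          by (intro bexI[of _ "Assign c (v c)"]) (auto simp: set_query_models R_def)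
      qed
      fix l l' assume l: "l \<in> set query_labels" "l' \<in> set query_labels" "l \<noteq> l'"
      then show "\<exists>m\<in>set query_models. m \<in> R \<and> test m l \<noteq> test m l'"
      proof (rule ident_separates)
        fix c f assume "c < N" "f \<in> set windows" "test (Ident c f) l \<noteq> test (Ident c f) l'"
        then show ?thesis by (intro bexI[of _ "Ident c f"]) (auto simp: set_query_models R_def)
      qed (use * in metis)
    qed
    from min[OF this] have "plan_cost design r \<le> of_nat (of_bool (Generic \<in> R)) / 2 +
        of_nat (\<Sum>c<N. \<Sum>s\<in>set tiles. of_bool (Assign c s \<in> R)) +
        (\<Sum>c<N. \<Sum>f\<in>set windows. of_nat (of_bool (Ident c f \<in> R))) / 2 ^ precision"
      unfolding plan_cost_design cost_sum .
    also have "(\<Sum>c<N. \<Sum>s\<in>set tiles. of_bool (Assign c s \<in> R)) = (\<Sum>c<N. 1::nat)"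
    proof (rule sum.cong[OF refl])
      fix c assume "c \<in> {..<N}"
      have "(\<Sum>s\<in>set tiles. of_bool (Assign c s \<in> R)) = (\<Sum>s\<in>set tiles. if s = v c then 1 else 0 :: nat)"
        by (rule sum.cong) (auto simp: R_def)
      then show "(\<Sum>s\<in>set tiles. of_bool (Assign c s \<in> R)) = (1::nat)"
        using v \<open>c \<in> {..<N}\<close> by simp
    qed
    also have "(\<Sum>c<N. \<Sum>f\<in>set windows. of_nat (of_bool (Ident c f \<in> R))) = (of_nat (N * length windows) :: rat)"
      using distinct_windows by (simp add: R_def distinct_card)
    finally show ?thesis by (simp add: R_def)
  qed
  have "\<rho> Generic = 0" if "solution v" for v
  proof (rule ccontr)
    assume "\<rho> Generic \<noteq> 0"
    then have "of_nat (\<rho> Generic) / 2 \<ge> (1 / 2 :: rat)" by simp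
    moreover have "of_nat N \<le> (of_nat (\<Sum>c<N. g c) :: rat)" using sum_ge by (simp only: of_nat_le_iff)
    moreover have "plan_cost design r \<le> of_nat N + of_bool False / 2 + of_nat (N * length windows) / 2 ^ precision"
    proof (rule plan)
      show "v c \<in> set tiles" if "c < N" for c using \<open>solution v\<close> that by (simp add: solution_def)
      fix e w assume e: "e < N" "Some w \<in> set windows"
      obtain a0 a1 a2 a3 where w: "w = (a0, a1, a2, a3)" using prod_cases4 by blast
      have "\<exists>c < N. covers c (v c) e (Some w)"
      proof (cases "e < E \<and> \<not> ok e w")
        case True
        then have "(v e, v (e + 1), v (e + 2), v (e + W + 2)) \<noteq> w" using \<open>solution v\<close> by (auto simp: solution_def)
        moreover have "e < N" "e + 1 < N" "e + 2 < N" "e + W + 2 < N" using True N by auto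
        ultimately show ?thesis unfolding w by (metis covers.simps(2))
      next
        case False
        then show ?thesis using e w by auto
      qed
      then show "False \<or> (\<exists>c < N. covers c (v c) e (Some w))" by simp
    qed
    ultimately show False using cost_ge ident_cost_less unfolding of_bool_eq by linarith
  qed
  moreover have "\<exists>v. solution v" if G: "\<rho> Generic = 0"
  proof -
    have "plan_cost design r \<le> of_nat N + of_bool True / 2 + of_nat (N * length windows) / 2 ^ precision"
      by (rule plan[where v = "\<lambda>_. hd tiles"]) (use tiles in auto)
    then have "(of_nat (\<Sum>c<N. g c) :: rat) < of_nat (N + 1)"
      using cost_ge ident_cost_less unfolding of_bool_eq G of_nat_0 of_nat_add of_nat_1 by linarith
    then have "(\<Sum>c<N. g c) < N + 1" by (simp only: of_nat_less_iff)
    with sum_ge have eq: "(\<Sum>c<N. g c) = N" by simp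
    have g1: "g c = 1" if "c < N" for c
    proof (rule ccontr)
      assume "g c \<noteq> 1"
      then have "1 < g c" using g_ge[OF that] by simp
      then have "(\<Sum>c<N. 1) < (\<Sum>c<N. g c)" using that g_ge by (intro sum_strict_mono_ex1) auto
      then show False using eq by simp
    qed
    have "\<exists>s. s \<in> set tiles \<and> (\<forall>s' \<in> set tiles. s \<noteq> s' \<longrightarrow> \<rho> (Assign c s') = 0)" if "c < N" for c
      using g1[OF that] unfolding g_def sum_eq_1_iff[OF finite_set] by blast
    then obtain v where v: "\<And>c. c < N \<Longrightarrow> v c \<in> set tiles"
      "\<And>c s. c < N \<Longrightarrow> s \<in> set tiles \<Longrightarrow> v c \<noteq> s \<Longrightarrow> \<rho> (Assign c s) = 0" by metis
    have "ok e (v e, v (e + 1), v (e + 2), v (e + W + 2))" if e: "e < E" for e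
    proof -
      \<comment> \<open>If the actual window of \<open>v\<close> were forbidden, separating its own
        twins would take an assignment that deviates from \<open>v\<close>, and no such assignment
        is queried.\<close>
      let ?w = "(v e, v (e + 1), v (e + 2), v (e + W + 2))"
      have lt: "e < N" "e + 1 < N" "e + 2 < N" "e + W + 2 < N" using e N by auto
      then have "Some ?w \<in> set windows" using v(1) by (auto simp: set_windows)
      then obtain m where m: "m \<in> set query_models" "0 < \<rho> m" "test m (Some ((e, Some ?w), True))" "\<forall>c f'. m \<noteq> Ident c f'"
        using used[of e "Some ?w"] lt(1) by blast
      then obtain c s where s: "m = Assign c s" "s \<in> set tiles" "c < N" "covers c s e (Some ?w)"
        using G by - (cases m; auto simp: set_query_models)
      then have "s = v c" using v(2)[of c s] m(2) by fastforce
      then show ?thesis using s(4) e by auto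
    qed
    then show ?thesis using v(1) unfolding solution_def by blast
  qed
  moreover have "r = \<rho> Generic # map \<rho> (tl query_models)" unfolding \<rho> by (simp add: query_models_def)
  ultimately show ?thesis by (intro exI[of _ "\<rho> Generic"] exI[of _ "map \<rho> (tl query_models)"]) auto
qed

end


section \<open>Computations as tilings\<close>

definition word_tape :: "nat list \<Rightarrow> int \<Rightarrow> nat" where
  "word_tape w i = (if 0 \<le> i \<and> i < int (length w) then w ! nat i else 0)"

lemma string_tape_eq: "string_tape u = word_tape (map bit_symbol u)"
  by (auto simp: string_tape_def word_tape_def fun_eq_iff)

text \<open>A transition depends on the symbols under all heads, but a window sees only a few cells.
  Every tile therefore carries the state and a guess of all scanned symbols for its row.
  \<open>corner\<close> marks the first cell of a row, where the comparison with the preceding tile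
  is suspended.\<close>

datatype tile = Tile (corner: bool) (ctrl: nat) (reads: "nat list") (cells: "(nat \<times> bool) list")

definition next_action :: "tm \<Rightarrow> nat \<Rightarrow> nat list \<Rightarrow> nat \<times> (nat \<times> move) list" where
  "next_action M q rs = (if q \<in> {accept M, reject M} then (q, map (\<lambda>s. (s, Stay)) rs) else delta M q rs)"

text \<open>Here \<open>a\<close>, \<open>b\<close>, \<open>c\<close> are the left neighbour, the
  cell itself and the right neighbour: a symbol changes only under the head, and the head arrives
  from the one of the three cells that held it.\<close>

definition cell_update :: "nat \<times> move \<Rightarrow> nat \<times> bool \<Rightarrow> nat \<times> bool \<Rightarrow> nat \<times> bool \<Rightarrow> nat \<times> bool" where
  "cell_update act a b c = (if snd b then fst act else fst b,
     snd a \<and> snd act = Right \<or> snd b \<and> snd act = Stay \<or> snd c \<and> snd act = Left)"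

text \<open>Each row starts one tape position further left than the previous one. The cell
  \<open>t3\<close> below \<open>t2\<close> thus describes the position of \<open>t1\<close>, and
  \<open>t0\<close> and \<open>t2\<close> are the neighbours of that position. The guess
  \<open>reads\<close> is checked only where a head stands.\<close>

fun window_ok :: "tm \<Rightarrow> tile window \<Rightarrow> bool" where
  "window_ok M (t0, t1, t2, t3) \<longleftrightarrow>
     (\<not> corner t2 \<longrightarrow> ctrl t1 = ctrl t2 \<and> reads t1 = reads t2) \<and>
     corner t3 = corner t2 \<and>
     ctrl t3 = fst (next_action M (ctrl t2) (reads t2)) \<and>
     (\<forall>j < tapes M. snd (cells t2 ! j) \<longrightarrow> fst (cells t2 ! j) = reads t2 ! j) \<and>
     (\<forall>j < tapes M. cells t3 ! j =
        cell_update (snd (next_action M (ctrl t2) (reads t2)) ! j) (cells t0 ! j) (cells t1 ! j) (cells t2 ! j))"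

text \<open>\<open>z\<close> is 0 outside the first row, 2 at its first cell and 1 elsewhere in it; \<open>s\<close> is the input symbol,
  with 3 marking the two padding cells; \<open>g = 0\<close> where no certificate symbol is allowed.\<close>

definition initial_ok :: "tm \<Rightarrow> nat \<Rightarrow> nat \<Rightarrow> nat \<Rightarrow> tile \<Rightarrow> tile \<Rightarrow> bool" where
  "initial_ok M z s g t0 t1 \<longleftrightarrow> z = 0 \<or>
     (if s = 3 then \<forall>j < tapes M. cells t0 ! j = (0, False)
      else corner t0 = (z = 2) \<and> ctrl t0 = start M \<and>
        (\<forall>j < tapes M. snd (cells t0 ! j) = (z = 2)) \<and>
        fst (cells t0 ! 0) = s \<and>
        fst (cells t0 ! 1) \<in> {0, 1, 2} \<and> (g = 0 \<longrightarrow> fst (cells t0 ! 1) = 0) \<and>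
        (fst (cells t0 ! 1) = 0 \<longrightarrow> fst (cells t1 ! 1) = 0) \<and>
        (\<forall>j < tapes M. 2 \<le> j \<longrightarrow> fst (cells t0 ! j) = 0))"

fun tile_ok :: "tm \<Rightarrow> nat \<Rightarrow> nat \<Rightarrow> nat \<Rightarrow> tile window \<Rightarrow> bool" where
  "tile_ok M z s g (t0, t1, t2, t3) \<longleftrightarrow> initial_ok M z s g t0 t1 \<and> window_ok M (t0, t1, t2, t3)"

text \<open>Leaving out the rejecting state is what expresses acceptance: the run of a halting
  verifier accepts if and only if it fits into tiles without that state for long enough.\<close>

definition tile_list :: "tm \<Rightarrow> tile list" where
  "tile_list M = remdups [Tile f q rs cs. f \<leftarrow> [False, True], q \<leftarrow> filter (\<lambda>q. q \<noteq> reject M) [0..<states M],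
     rs \<leftarrow> List.n_lists (tapes M) [0..<symbols M],
     cs \<leftarrow> List.n_lists (tapes M) (List.product [0..<symbols M] [False, True])]"

lemma set_tile_list:
  "Tile f q rs cs \<in> set (tile_list M) \<longleftrightarrow> q < states M \<and> q \<noteq> reject M \<and>
     length rs = tapes M \<and> set rs \<subseteq> {..<symbols M} \<and>
     length cs = tapes M \<and> fst ` set cs \<subseteq> {..<symbols M}"
proof -
  have "set cs \<subseteq> {0..<symbols M} \<times> {False, True} \<longleftrightarrow> fst ` set cs \<subseteq> {..<symbols M}" for cs :: "(nat \<times> bool) list"
    by force
  then show ?thesis
    unfolding tile_list_def by (cases f) (auto simp: set_n_lists lessThan_atLeast0 image_iff)
qed

lemma tile_list_nonempty:
  assumes "tm_wf M"
  shows "tile_list M \<noteq> []"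
proof -
  have "Tile False (accept M) (replicate (tapes M) 0) (replicate (tapes M) (0, False)) \<in> set (tile_list M)"
    unfolding set_tile_list using assms by (auto simp: tm_wf_def)
  then show ?thesis by auto
qed

section \<open>Locality of machine steps\<close>

definition scanned :: "tm \<Rightarrow> config \<Rightarrow> nat list" where
  "scanned M c = map (\<lambda>j. tape c j (head c j)) [0..<tapes M]"

definition cell_content :: "config \<Rightarrow> nat \<Rightarrow> int \<Rightarrow> nat \<times> bool" where
  "cell_content c j i = (tape c j i, head c j = i)"

lemma state_tm_step: "state (tm_step M c) = fst (next_action M (state c) (scanned M c))"
  by (auto simp: tm_step_def next_action_def scanned_def case_prod_beta Let_def)

lemma tape_tm_step:
  "j < tapes M \<Longrightarrow> tape (tm_step M c) j =
     (tape c j)(head c j := fst (snd (next_action M (state c) (scanned M c)) ! j))"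
  by (auto simp: tm_step_def next_action_def scanned_def case_prod_beta Let_def)

lemma head_tm_step:
  "j < tapes M \<Longrightarrow> head (tm_step M c) j =
     head c j + shift (snd (snd (next_action M (state c) (scanned M c)) ! j))"
  by (auto simp: tm_step_def next_action_def scanned_def case_prod_beta Let_def)

lemma content_tm_step:
  "j < tapes M \<Longrightarrow> cell_content (tm_step M c) j i =
     cell_update (snd (next_action M (state c) (scanned M c)) ! j)
       (cell_content c j (i - 1)) (cell_content c j i) (cell_content c j (i + 1))"
  by (cases "snd (snd (next_action M (state c) (scanned M c)) ! j)")
    (auto simp: cell_content_def cell_update_def tape_tm_step head_tm_step)

definition config_wf :: "tm \<Rightarrow> config \<Rightarrow> bool" where
  "config_wf M c \<longleftrightarrow> state c < states M \<and> (\<forall>j < tapes M. \<forall>i. tape c j i < symbols M)"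

lemma config_wf_step:
  assumes "tm_wf M" "config_wf M c"
  shows "config_wf M (tm_step M c)"
proof -
  have sc: "length (scanned M c) = tapes M" "set (scanned M c) \<subseteq> {..<symbols M}"
    using assms(2) by (auto simp: scanned_def config_wf_def)
  have "fst (next_action M (state c) (scanned M c)) < states M \<and>
    (\<forall>j < tapes M. fst (snd (next_action M (state c) (scanned M c)) ! j) < symbols M)"
  proof (cases "state c \<in> {accept M, reject M}")
    case True
    then show ?thesis using sc assms by (auto simp: next_action_def tm_wf_def config_wf_def scanned_def)
  next
    case False
    let ?d = "delta M (state c) (scanned M c)"
    have d: "fst ?d < states M" "length (snd ?d) = tapes M" "fst ` set (snd ?d) \<subseteq> {..<symbols M}"
      using assms sc unfolding tm_wf_def config_wf_def by blast+
    then have "fst (snd ?d ! j) < symbols M" if "j < tapes M" for j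
      using that by (metis image_subset_iff lessThan_iff nth_mem)
    then show ?thesis using False d by (auto simp: next_action_def)
  qed
  then show ?thesis
    using assms(2) unfolding config_wf_def by (auto simp: state_tm_step tape_tm_step)
qed

text \<open>\<open>pn\<close> bounds the certificate, and \<open>V\<close> bounds the simulated time
  as well as the lengths of both input strings.\<close>

locale tableau =
  fixes M :: tm and x :: "bool list" and pn V :: nat
  assumes wf: "tm_wf M" and len_x: "length x \<le> V" and pn: "pn \<le> V" and V: "2 \<le> V"
begin

text \<open>Up to time \<open>V\<close>, nonblank symbols lie at positions below
  \<open>2 * V\<close> and the drift adds at most \<open>V\<close> to the index, so everything
  visible ends before index \<open>3 * V\<close> and the spare cells at the end of a row are
  blank.\<close>

definition W :: nat where "W = 3 * V + 4"

definition E :: nat where "E = V * W"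

definition N :: nat where "N = E + W + 2"

definition row_word :: "nat list" where "row_word = [1, 1, 2] @ replicate (W - 1) 1"

definition input_word :: "nat list" where "input_word = [3, 3] @ map bit_symbol x"

definition guess_word :: "nat list" where "guess_word = [3, 3] @ replicate pn 1"

definition ok :: "nat \<Rightarrow> tile window \<Rightarrow> bool" where
  "ok e = tile_ok M (word_tape row_word (int e)) (word_tape input_word (int e)) (word_tape guess_word (int e))"

sublocale window_csp "tile_list M" N E W ok
  by standard (simp_all add: tile_list_nonempty[OF wf] N_def, simp add: tile_list_def)

abbreviation run :: "bool list \<Rightarrow> nat \<Rightarrow> config" where
  "run u t \<equiv> (tm_step M ^^ t) (tm_init M [x, u])"

lemma tapes: "2 \<le> tapes M" using wf by (simp add: tm_wf_def)

lemma tape_init: "tape (tm_init M [x, u]) j = (if j = 0 then string_tape x else if j = 1 then string_tape u else (\<lambda>_. 0))"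
  by (cases j) (auto simp: tm_init_def nth_Cons split: nat.splits)

lemma config_wf_run: "config_wf M (run u t)"
proof (induction t)
  case 0
  have "3 \<le> symbols M" "start M < states M" using wf by (auto simp: tm_wf_def)
  then show ?case by (auto simp: config_wf_def tape_init string_tape_def bit_symbol_def) (auto simp: tm_init_def)
qed (simp add: config_wf_step wf)

lemma head_run: "j < tapes M \<Longrightarrow> \<bar>head (run u t) j\<bar> \<le> int t"
proof (induction t)
  case (Suc t)
  let ?m = "snd (snd (next_action M (state (run u t)) (scanned M (run u t))) ! j)"
  have "\<bar>shift ?m\<bar> \<le> 1" by (cases ?m) auto
  with Suc show ?case by (simp add: head_tm_step)
qed (simp add: tm_init_def)

text \<open>The bounds are not strict, because a head that reaches position \<open>- t\<close> at
  time \<open>t\<close> writes there only in the next step. The head flag appears at once, hence the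
  strict bounds in \<open>content_run_blank\<close>. The condition \<open>i < 0\<close> spares the
  input at time 0.\<close>

lemma tape_run_blank:
  assumes "j < tapes M" "length u \<le> V" "i < 0 \<and> i \<le> - int t \<or> int V + int t \<le> i"
  shows "tape (run u t) j i = 0"
  using assms
proof (induction t)
  case 0
  then show ?case using len_x by (auto simp: tape_init string_tape_def)
next
  case (Suc t)
  have "i \<noteq> head (run u t) j" using head_run[OF Suc.prems(1), of t u] Suc.prems(3) by auto
  then show ?case using Suc by (auto simp: tape_tm_step)
qed

lemma content_run_blank:
  assumes "j < tapes M" "length u \<le> V" "i < - int t \<or> int V + int t < i"
  shows "cell_content (run u t) j i = (0, False)"
  using tape_run_blank[OF assms(1,2), of i t] head_run[OF assms(1), of t u] assms(3)
  by (auto simp: cell_content_def)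

lemma content_init:
  "cell_content (tm_init M [x, u]) j i = (if j = 0 then string_tape x i else if j = 1 then string_tape u i else 0, i = 0)"
  by (auto simp: cell_content_def tape_init) (auto simp: tm_init_def)

text \<open>The second inequality rests on \<open>2 \<le> V\<close>: the padding and the first row
  are constrained only through \<open>ok\<close>, which is imposed below \<open>E\<close>.\<close>

lemma W_gt: "3 * V + 3 < W" and W_le_E: "W + 2 \<le> E"
proof -
  show "3 * V + 3 < W" by (simp add: W_def)
  have "2 * W \<le> V * W" using V by (intro mult_right_mono) auto
  then show "W + 2 \<le> E" unfolding E_def using W_def by linarith
qed

lemma row_word_nth:
  "word_tape row_word (int e) = (if e = 2 then 2 else if e < W + 2 then 1 else 0)"
  using W_gt by (auto simp: row_word_def word_tape_def nth_Cons nth_append split: nat.splits)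

lemma input_word_nth:
  "word_tape input_word (int e) = (if e < 2 then 3 else string_tape x (int e - 2))"
  by (auto simp: input_word_def word_tape_def string_tape_def nth_Cons nth_append nat_diff_distrib
      split: nat.splits intro!: arg_cong[of _ _ "\<lambda>i. bit_symbol (x ! i)"])

lemma guess_word_nth:
  "word_tape guess_word (int e) = (if e < 2 then 3 else if e < 2 + pn then 1 else 0)"
  by (auto simp: guess_word_def word_tape_def nth_Cons nth_append split: nat.splits)

lemma string_tape_le2: "string_tape u i \<le> 2"
  by (auto simp: string_tape_def bit_symbol_def)

text \<open>Rows drift by one cell per step: cell \<open>2 + t * W + i\<close> describes position \<open>i - t\<close> of all tapes
  at time \<open>t\<close>. Nothing left of a row is ever visited, and the cells preceding it in the linear order
  (the end of the previous row, or the two padding cells) are blank.\<close>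

lemma shifted_content:
  assumes t: "t \<le> V" and i: "i < W" and d: "d \<le> 2" and j: "j < tapes M" and u: "length u \<le> V"
    and pad: "\<And>c. c < 2 \<Longrightarrow> cells (v c) ! j = (0, False)"
    and cur: "\<And>i. i < W \<Longrightarrow> cells (v (2 + t * W + i)) ! j = cell_content (run u t) j (int i - int t)"
    and prev: "\<And>i s. t = Suc s \<Longrightarrow> i < W \<Longrightarrow> cells (v (2 + s * W + i)) ! j = cell_content (run u s) j (int i - int s)"
  shows "cells (v (2 + t * W + i - d)) ! j = cell_content (run u t) j (int i - int d - int t)"
proof (cases "d \<le> i")
  case True
  then have "2 + t * W + i - d = 2 + t * W + (i - d)" by simp
  then show ?thesis using cur[of "i - d"] i True by (simp only:) (simp add: of_nat_diff)
next
  case False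
  have blank: "cell_content (run u t) j (int i - int d - int t) = (0, False)"
    using False j u by (intro content_run_blank) auto
  show ?thesis
  proof (cases t)
    case 0
    then show ?thesis using pad[of "2 + i - d"] blank False d by simp
  next
    case (Suc s)
    have "2 + t * W + i - d = 2 + s * W + (W + i - d)" using Suc d W_gt by simp
    moreover have "cells (v (2 + s * W + (W + i - d))) ! j = cell_content (run u s) j (int (W + i - d) - int s)"
      using Suc False W_gt by (intro prev) auto
    moreover have "cell_content (run u s) j (int (W + i - d) - int s) = (0, False)"
      using j u Suc t d W_gt by (intro content_run_blank) auto
    ultimately show ?thesis using blank by simp
  qed
qed

text \<open>The certificate is read off tape 1 in the first row, where bits are free up to
  \<open>pn\<close> and blanks persist after the first blank. The rows then follow the run on this
  certificate, and no tile has the rejecting state.\<close>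

lemma solution_imp_certificate:
  assumes v: "solution v"
  shows "\<exists>u. length u \<le> pn \<and> (\<forall>t \<le> V. state (run u t) \<noteq> reject M)"
proof -
  have mem: "v c \<in> set (tile_list M)" if "c < N" for c using v that by (simp add: solution_def)
  have win: "window_ok M (v e, v (e + 1), v (e + 2), v (e + W + 2))"
    and ini: "initial_ok M (word_tape row_word (int e)) (word_tape input_word (int e)) (word_tape guess_word (int e)) (v e) (v (e + 1))"
    if "e < E" for e using v that unfolding solution_def ok_def by auto
  have pad: "cells (v c) ! j = (0, False)" if "c < 2" "j < tapes M" for c j
    using ini[of c] W_le_E that by (auto simp: initial_ok_def row_word_nth input_word_nth)
  have row0: "corner (v (2 + i)) = (i = 0)" "ctrl (v (2 + i)) = start M"
    "\<And>j. j < tapes M \<Longrightarrow> snd (cells (v (2 + i)) ! j) = (i = 0)"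
    "fst (cells (v (2 + i)) ! 0) = string_tape x (int i)"
    "fst (cells (v (2 + i)) ! 1) \<in> {0, 1, 2}"
    "pn \<le> i \<Longrightarrow> fst (cells (v (2 + i)) ! 1) = 0"
    "fst (cells (v (2 + i)) ! 1) = 0 \<Longrightarrow> fst (cells (v (2 + Suc i)) ! 1) = 0"
    "\<And>j. j < tapes M \<Longrightarrow> 2 \<le> j \<Longrightarrow> fst (cells (v (2 + i)) ! j) = 0" if "i < W" for i
  proof -
    have "string_tape x (int i) \<noteq> 3" using string_tape_le2[of x "int i"] by linarith
    moreover have "2 + i < E" using that W_le_E by simp
    moreover have "word_tape row_word (int (2 + i)) = (if i = 0 then 2 else 1)"
      "word_tape input_word (int (2 + i)) = string_tape x (int i)"
      "word_tape guess_word (int (2 + i)) = (if i < pn then 1 else 0)"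
      using that by (simp_all only: row_word_nth input_word_nth guess_word_nth) auto
    ultimately have "corner (v (2 + i)) = (i = 0) \<and> ctrl (v (2 + i)) = start M \<and>
        (\<forall>j < tapes M. snd (cells (v (2 + i)) ! j) = (i = 0)) \<and>
        fst (cells (v (2 + i)) ! 0) = string_tape x (int i) \<and>
        fst (cells (v (2 + i)) ! 1) \<in> {0, 1, 2} \<and> (pn \<le> i \<longrightarrow> fst (cells (v (2 + i)) ! 1) = 0) \<and>
        (fst (cells (v (2 + i)) ! 1) = 0 \<longrightarrow> fst (cells (v (2 + i + 1)) ! 1) = 0) \<and>
        (\<forall>j < tapes M. 2 \<le> j \<longrightarrow> fst (cells (v (2 + i)) ! j) = 0)"
      using ini[of "2 + i"] unfolding initial_ok_def by (cases "i = 0"; cases "i < pn"; simp)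
    then show "corner (v (2 + i)) = (i = 0)" "ctrl (v (2 + i)) = start M"
      "\<And>j. j < tapes M \<Longrightarrow> snd (cells (v (2 + i)) ! j) = (i = 0)"
      "fst (cells (v (2 + i)) ! 0) = string_tape x (int i)"
      "fst (cells (v (2 + i)) ! 1) \<in> {0, 1, 2}"
      "pn \<le> i \<Longrightarrow> fst (cells (v (2 + i)) ! 1) = 0"
      "fst (cells (v (2 + i)) ! 1) = 0 \<Longrightarrow> fst (cells (v (2 + Suc i)) ! 1) = 0"
      "\<And>j. j < tapes M \<Longrightarrow> 2 \<le> j \<Longrightarrow> fst (cells (v (2 + i)) ! j) = 0"
      by simp_all
  qed
  define f where "f i = fst (cells (v (2 + i)) ! 1)" for i
  define len where "len = (LEAST i. f i = 0)"
  have "f pn = 0" unfolding f_def using row0(6)[of pn] pn W_gt by simp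
  then have len: "f len = 0" "len \<le> pn" unfolding len_def by (auto intro: LeastI Least_le)
  have f_pos: "f i \<noteq> 0" if "i < len" for i using that not_less_Least unfolding len_def by blast
  define u where "u = map (\<lambda>i. f i = 2) [0..<len]"
  have len_u: "length u = len" by (simp add: u_def)
  have uV: "length u \<le> V" using len_u len(2) pn by simp
  have f_u: "f i = string_tape u (int i)" if "i < W" for i
  proof (cases "i < len")
    case True
    then show ?thesis using row0(5)[OF that] f_pos[OF True] unfolding f_def[symmetric]
      by (auto simp: u_def string_tape_def bit_symbol_def)
  next
    case False
    have "len + k < W \<Longrightarrow> f (len + k) = 0" for k
      by (induction k) (use len(1) row0(7) in \<open>auto simp: f_def\<close>)
    from this[of "i - len"] show ?thesis using False that len_u by (simp add: string_tape_def)
  qed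
  define good where "good t \<longleftrightarrow> (\<forall>i < W. corner (v (2 + t * W + i)) = (i = 0) \<and>
      ctrl (v (2 + t * W + i)) = state (run u t) \<and>
      (\<forall>j < tapes M. cells (v (2 + t * W + i)) ! j = cell_content (run u t) j (int i - int t)))" for t
  have "good 0"
    unfolding good_def
  proof (intro allI impI conjI)
    fix i assume i: "i < W"
    show "corner (v (2 + 0 * W + i)) = (i = 0)" "ctrl (v (2 + 0 * W + i)) = state (run u 0)"
      using row0(1,2)[OF i] by (auto simp: tm_init_def)
    fix j assume j: "j < tapes M"
    show "cells (v (2 + 0 * W + i)) ! j = cell_content (run u 0) j (int i - int 0)"
      using row0(3)[OF i j] row0(4)[OF i] f_u[OF i] row0(8)[OF i j] tapes
      by (auto simp: content_init prod_eq_iff f_def)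
  qed
  \<comment> \<open>Row \<open>t - 1\<close> enters as well, since its last cells are the left
    neighbours of the first cells of row \<open>t\<close>.\<close>
  have step: "good (Suc t)" if t: "t < V" and g: "good t" and gp: "\<And>s. t = Suc s \<Longrightarrow> good s" for t
  proof -
    have idx: "t * W + i < E" if "i < W" for i
    proof -
      have "t * W + i < Suc t * W" using that by simp
      also have "\<dots> \<le> V * W" using t by (intro mult_right_mono) auto
      finally show ?thesis by (simp add: E_def)
    qed
    have win': "window_ok M (v (2 + t * W + i - 2), v (2 + t * W + i - 1), v (2 + t * W + i), v (2 + Suc t * W + i))"
      if "i < W" for i
      using win[OF idx[OF that]] by (simp add: algebra_simps)
    have sh: "cells (v (2 + t * W + i - d)) ! j = cell_content (run u t) j (int i - int d - int t)"
      if "i < W" "d \<le> 2" "j < tapes M" for i d j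
      by (rule shifted_content) (use that t uV pad g gp in \<open>auto simp: good_def\<close>)
    have reads_eq: "reads (v (2 + t * W + i)) = reads (v (2 + t * W))" if "i < W" for i
      using that
    proof (induction i)
      case (Suc i)
      have "\<not> corner (v (2 + t * W + Suc i))" using g Suc.prems unfolding good_def by blast
      then show ?case using win'[OF Suc.prems] Suc by auto
    qed simp
    have W0: "0 < W" using W_gt by simp
    have mem0: "v (2 + t * W) \<in> set (tile_list M)"
      using idx[OF W0] by (intro mem) (simp add: N_def)
    have reads: "reads (v (2 + t * W)) = scanned M (run u t)"
    proof (rule nth_equalityI)
      show len: "length (reads (v (2 + t * W))) = length (scanned M (run u t))"
        using mem0 by - (cases "v (2 + t * W)"; auto simp: set_tile_list scanned_def)
      fix j assume "j < length (reads (v (2 + t * W)))"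
      then have j: "j < tapes M" using len by (simp add: scanned_def)
      \<comment> \<open>The index in row \<open>t\<close> of the cell that holds head
        \<open>j\<close>. The guess is checked against the symbol there, and its constancy along the
        row transports this to the first cell.\<close>
      define i where "i = nat (head (run u t) j + int t)"
      have hi: "int i - int t = head (run u t) j" "i < W"
        using head_run[OF j, of t u] t W_gt by (auto simp: i_def)
      have "cells (v (2 + t * W + i)) ! j = cell_content (run u t) j (int i - int t)"
        using g hi(2) j unfolding good_def by blast
      then have "cells (v (2 + t * W + i)) ! j = (tape (run u t) j (head (run u t) j), True)"
        using hi(1) by (simp add: cell_content_def)
      then have "tape (run u t) j (head (run u t) j) = reads (v (2 + t * W + i)) ! j"
        using win'[OF hi(2)] j by auto
      then show "reads (v (2 + t * W)) ! j = scanned M (run u t) ! j"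
        using reads_eq[OF hi(2)] j by (simp add: scanned_def)
    qed
    show ?thesis
      unfolding good_def
    proof (intro allI impI conjI)
      fix i assume i: "i < W"
      have C: "corner (v (2 + t * W + i)) = (i = 0)" "ctrl (v (2 + t * W + i)) = state (run u t)"
        "reads (v (2 + t * W + i)) = scanned M (run u t)"
        using g i reads_eq[OF i] reads unfolding good_def by auto
      note w = win'[OF i, unfolded window_ok.simps C]
      show "corner (v (2 + Suc t * W + i)) = (i = 0)" using w by blast
      show "ctrl (v (2 + Suc t * W + i)) = state (run u (Suc t))" using w by (simp add: state_tm_step)
      fix j assume j: "j < tapes M"
      show "cells (v (2 + Suc t * W + i)) ! j = cell_content (run u (Suc t)) j (int i - int (Suc t))"
        using w j sh[OF i _ j, of 2] sh[OF i _ j, of 1] sh[OF i _ j, of 0]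
        by (simp add: content_tm_step algebra_simps)
    qed
  qed
  have good: "t \<le> V \<Longrightarrow> good t" for t
  proof (induction t rule: less_induct)
    case (less t)
    then show ?case using step[of "t - 1"] \<open>good 0\<close> by (cases t) auto
  qed
  have "state (run u t) \<noteq> reject M" if t: "t \<le> V" for t
  proof -
    have "t * W \<le> E" using t unfolding E_def by (intro mult_right_mono) auto
    then have m: "v (2 + t * W + 0) \<in> set (tile_list M)" using W_gt by (intro mem) (simp add: N_def)
    have "ctrl (v (2 + t * W + 0)) = state (run u t)" using good[OF t] W_gt unfolding good_def by (metis gr_zeroI not_less_zero)
    then show ?thesis using m by - (cases "v (2 + t * W + 0)"; auto simp: set_tile_list)
  qed
  then show ?thesis using len(2) len_u by auto
qed

lemma certificate_imp_solution:
  assumes u: "length u \<le> pn" and run: "\<And>t. t \<le> V \<Longrightarrow> state (run u t) \<noteq> reject M"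
  shows "\<exists>v. solution v"
proof -
  define v where "v c = (if c < 2 then Tile False (start M) (replicate (tapes M) 0) (replicate (tapes M) (0, False))
      else let t = (c - 2) div W; i = (c - 2) mod W in
        Tile (i = 0) (state (run u t)) (scanned M (run u t))
          (map (\<lambda>j. cell_content (run u t) j (int i - int t)) [0..<tapes M]))" for c
  have uV: "length u \<le> V" using u pn by simp
  have W0: "0 < W" using W_gt by simp
  have row: "v (2 + t * W + i) = Tile (i = 0) (state (run u t)) (scanned M (run u t))
          (map (\<lambda>j. cell_content (run u t) j (int i - int t)) [0..<tapes M])" if "i < W" for t i
    using that by (simp add: v_def)
  have row_cells: "cells (v (2 + t * W + i)) ! j = cell_content (run u t) j (int i - int t)"
    if "i < W" "j < tapes M" for t i j
    using row[OF that(1), of t] that(2) by simp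
  have pad: "cells (v c) ! j = (0, False)" if "c < 2" "j < tapes M" for c j
    using that by (simp add: v_def)
  have "v c \<in> set (tile_list M)" if c: "c < N" for c
  proof (cases "c < 2")
    case True
    have "start M \<noteq> reject M" using run[of 0] by (simp add: tm_init_def)
    then show ?thesis using True wf by (auto simp: v_def set_tile_list tm_wf_def)
  next
    case False
    \<comment> \<open>Behind the padding lie exactly the rows for the times 0 to
      \<open>V\<close>.\<close>
    have "c - 2 < (V + 1) * W" using c False by (simp add: N_def E_def)
    then have "(c - 2) div W < V + 1" by (rule less_mult_imp_div_less)
    then show ?thesis using False config_wf_run[of "(c - 2) div W" u] run[of "(c - 2) div W"]
      by (auto simp: v_def Let_def set_tile_list config_wf_def scanned_def cell_content_def)
  qed
  moreover have "ok e (v e, v (e + 1), v (e + 2), v (e + W + 2))" if e: "e < E" for e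
  proof -
    define t i where "t = e div W" and "i = e mod W"
    have ei: "e = t * W + i" by (simp add: t_def i_def)
    have i: "i < W" using W0 by (simp add: i_def)
    have t: "t < V" using e by (simp add: t_def E_def less_mult_imp_div_less)
    have sh: "cells (v (2 + t * W + i - d)) ! j = cell_content (run u t) j (int i - int d - int t)"
      if "d \<le> 2" "j < tapes M" for d j
      by (rule shifted_content) (use that t i uV pad row_cells in auto)
    have e2: "v (e + 2) = v (2 + t * W + i)" "v (e + W + 2) = v (2 + Suc t * W + i)"
      "v (e + 1) = v (2 + t * W + i - 1)" "v e = v (2 + t * W + i - 2)"
      by (simp_all add: ei algebra_simps)
    have "window_ok M (v e, v (e + 1), v (e + 2), v (e + W + 2))"
      unfolding window_ok.simps
    proof (intro conjI allI impI)
      assume "\<not> corner (v (e + 2))"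
      then have "i \<noteq> 0" using row[OF i] e2(1) by auto
      then have "v (e + 1) = v (2 + t * W + (i - 1))" by (simp add: ei)
      then show "ctrl (v (e + 1)) = ctrl (v (e + 2))" "reads (v (e + 1)) = reads (v (e + 2))"
        using row[of "i - 1" t] row[OF i] e2(1) i by auto
    next
      show "corner (v (e + W + 2)) = corner (v (e + 2))"
        unfolding e2 by (simp only: row[OF i] tile.sel)
      show "ctrl (v (e + W + 2)) = fst (next_action M (ctrl (v (e + 2))) (reads (v (e + 2))))"
        unfolding e2 by (simp only: row[OF i] tile.sel funpow.simps o_def state_tm_step)
    next
      fix j assume j: "j < tapes M" "snd (cells (v (e + 2)) ! j)"
      then show "fst (cells (v (e + 2)) ! j) = reads (v (e + 2)) ! j"
        unfolding e2 using row[OF i, of t] by (auto simp: cell_content_def scanned_def)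
    next
      fix j assume j: "j < tapes M"
      have "cells (v (e + W + 2)) ! j = cell_content (tm_step M (run u t)) j (int i - int (Suc t))"
        unfolding e2 using j by (simp only: row[OF i] tile.sel) simp
      also have "\<dots> = cell_update (snd (next_action M (ctrl (v (e + 2))) (reads (v (e + 2)))) ! j)
          (cells (v e) ! j) (cells (v (e + 1)) ! j) (cells (v (e + 2)) ! j)"
        unfolding e2 sh[OF le_refl j] using sh[of 1 j] sh[of 0 j] j row[OF i, of t]
        by (simp add: content_tm_step algebra_simps)
      finally show "cells (v (e + W + 2)) ! j = cell_update (snd (next_action M (ctrl (v (e + 2))) (reads (v (e + 2)))) ! j)
          (cells (v e) ! j) (cells (v (e + 1)) ! j) (cells (v (e + 2)) ! j)" .
    qed
    moreover have "initial_ok M (word_tape row_word (int e)) (word_tape input_word (int e)) (word_tape guess_word (int e)) (v e) (v (e + 1))"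
    proof (cases "2 \<le> e \<and> e < W + 2")
      case False
      then show ?thesis using pad W_gt by (auto simp: initial_ok_def row_word_nth input_word_nth)
    next
      case True
      define k where "k = e - 2"
      have k: "k < W" "e = 2 + k" using True by (auto simp: k_def)
      have vk: "v e = Tile (k = 0) (state (run u 0)) (scanned M (run u 0))
          (map (\<lambda>j. cell_content (run u 0) j (int k)) [0..<tapes M])"
        using row[OF k(1), of 0] k(2) by simp
      have x3: "string_tape x (int k) \<noteq> 3" using string_tape_le2[of x "int k"] by linarith
      have nxt: "fst (cells (v (e + 1)) ! 1) = 0" if z: "string_tape u (int k) = 0"
      proof (cases "Suc k < W")
        case True
        have "v (e + 1) = v (2 + 0 * W + Suc k)" using k by simp
        moreover have "string_tape u (int (Suc k)) = 0"
          using z by (auto simp: string_tape_def bit_symbol_def split: if_splits)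
        ultimately show ?thesis using True tapes row[of "Suc k" 0] by (simp add: content_init)
      next
        case False
        \<comment> \<open>The last cell of the first row is followed by the first cell of the second
          row. The latter describes position -1, which is still blank on tape 1 at time 1.\<close>
        then have "e + 1 = 2 + 1 * W + 0" using k by simp
        then have "v (e + 1) = v (2 + 1 * W + 0)" by (rule arg_cong)
        moreover have "tape (run u 1) 1 (- 1) = 0" by (rule tape_run_blank) (use tapes uV in auto)
        ultimately show ?thesis using row[OF W0, of 1] tapes by (simp add: cell_content_def)
      qed
      have "string_tape u (int k) \<in> {0, 1, 2}" "pn \<le> k \<Longrightarrow> string_tape u (int k) = 0"
        using u by (auto simp: string_tape_def bit_symbol_def)
      moreover have "word_tape row_word (int e) = (if k = 0 then 2 else 1)"
        "word_tape input_word (int e) = string_tape x (int k)"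
        "word_tape guess_word (int e) = (if k < pn then 1 else 0)"
        using k by (simp_all only: row_word_nth input_word_nth guess_word_nth) auto
      moreover have "state (run u 0) = start M" by (simp add: tm_init_def)
      ultimately show ?thesis using x3 nxt tapes
        unfolding initial_ok_def vk by (auto simp: content_init)
    qed
    ultimately show ?thesis by (simp add: ok_def)
  qed
  ultimately show ?thesis unfolding solution_def by blast
qed

end


section \<open>Programs for oracle machines\<close>

type_synonym memory = "(nat \<Rightarrow> int \<Rightarrow> nat) \<times> (nat \<Rightarrow> int)"
type_synonym action = "(nat \<times> move) list"

datatype prog =
  Act "nat list \<Rightarrow> action"
| Seq prog prog
| Cond "nat list \<Rightarrow> bool" prog prog
| While "nat list \<Rightarrow> bool" prog

definition view :: "nat \<Rightarrow> memory \<Rightarrow> nat list" where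
  "view k m = map (\<lambda>j. fst m j (snd m j)) [0..<k]"

definition act :: "nat \<Rightarrow> action \<Rightarrow> memory \<Rightarrow> memory" where
  "act k acts m =
     (\<lambda>i. if i < k then (fst m i)(snd m i := fst (acts ! i)) else fst m i,
      \<lambda>i. if i < k then snd m i + shift (snd (acts ! i)) else snd m i)"

text \<open>Big-step semantics with exact step counts: every test takes one step because it becomes
  a state of its own.\<close>

inductive exec :: "nat \<Rightarrow> prog \<Rightarrow> memory \<Rightarrow> nat \<Rightarrow> memory \<Rightarrow> bool" for k where
  exec_Act: "exec k (Act f) m 1 (act k (f (view k m)) m)"
| exec_Seq: "exec k p m s m' \<Longrightarrow> exec k q m' t m'' \<Longrightarrow> exec k (Seq p q) m (s + t) m''"
| exec_CondT: "P (view k m) \<Longrightarrow> exec k p m t m' \<Longrightarrow> exec k (Cond P p q) m (Suc t) m'"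
| exec_CondF: "\<not> P (view k m) \<Longrightarrow> exec k q m t m' \<Longrightarrow> exec k (Cond P p q) m (Suc t) m'"
| exec_WhileF: "\<not> P (view k m) \<Longrightarrow> exec k (While P p) m 1 m"
| exec_WhileT: "P (view k m) \<Longrightarrow> exec k p m s m' \<Longrightarrow> exec k (While P p) m' t m'' \<Longrightarrow>
    exec k (While P p) m (Suc (s + t)) m''"

definition stay :: "nat list \<Rightarrow> action" where
  "stay ss = map (\<lambda>s. (s, Stay)) ss"

lemma act_stay: "act k (stay (view k m)) m = m"
  by (cases m) (auto simp: act_def stay_def view_def fun_eq_iff)

fun prog_size :: "prog \<Rightarrow> nat" where
  "prog_size (Act f) = 1"
| "prog_size (Seq p q) = prog_size p + prog_size q"
| "prog_size (Cond P p q) = 1 + prog_size p + prog_size q"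
| "prog_size (While P p) = 1 + prog_size p"

text \<open>\<open>code p a e\<close> is the transition table of \<open>p\<close> with states numbered from \<open>a\<close> and exit state \<open>e\<close>.\<close>

fun code :: "prog \<Rightarrow> nat \<Rightarrow> nat \<Rightarrow> (nat list \<Rightarrow> nat \<times> action) list" where
  "code (Act f) a e = [\<lambda>ss. (e, f ss)]"
| "code (Seq p q) a e = code p a (a + prog_size p) @ code q (a + prog_size p) e"
| "code (Cond P p q) a e = (\<lambda>ss. (if P ss then a + 1 else a + 1 + prog_size p, stay ss)) #
     code p (a + 1) e @ code q (a + 1 + prog_size p) e"
| "code (While P p) a e = (\<lambda>ss. (if P ss then a + 1 else e, stay ss)) # code p (a + 1) a"

lemma length_code [simp]: "length (code p a e) = prog_size p"
  by (induction p arbitrary: a e) auto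

definition action_wf :: "nat \<Rightarrow> nat \<Rightarrow> (nat list \<Rightarrow> action) \<Rightarrow> bool" where
  "action_wf k s f \<longleftrightarrow> (\<forall>ss. length ss = k \<and> set ss \<subseteq> {..<s} \<longrightarrow>
     length (f ss) = k \<and> fst ` set (f ss) \<subseteq> {..<s})"

fun prog_wf :: "nat \<Rightarrow> nat \<Rightarrow> prog \<Rightarrow> bool" where
  "prog_wf k s (Act f) \<longleftrightarrow> action_wf k s f"
| "prog_wf k s (Seq p q) \<longleftrightarrow> prog_wf k s p \<and> prog_wf k s q"
| "prog_wf k s (Cond P p q) \<longleftrightarrow> prog_wf k s p \<and> prog_wf k s q"
| "prog_wf k s (While P p) \<longleftrightarrow> prog_wf k s p"

lemma action_wf_stay: "action_wf k s stay"
  by (auto simp: action_wf_def stay_def)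

lemma code_wf:
  assumes "prog_wf k s p" "a + prog_size p \<le> n" "e \<le> n" "c \<in> set (code p a e)"
  shows "fst (c ss) \<le> n \<and> action_wf k s (\<lambda>ss. snd (c ss))"
  using assms
proof (induction p arbitrary: a e)
  case (Seq p q)
  show ?case using Seq.IH(1)[of a "a + prog_size p"] Seq.IH(2)[of "a + prog_size p" e] Seq.prems by auto
next
  case (Cond P p q)
  show ?case
    using Cond.IH(1)[of "a + 1" e] Cond.IH(2)[of "a + 1 + prog_size p" e] Cond.prems action_wf_stay[of k s]
    by auto
next
  case (While P p)
  then show ?case
    using While.IH[of "a + 1" a] While.prems action_wf_stay[of k s] by auto
qed auto

text \<open>The states after the code of \<open>p\<close> are, in order: query, response, read, accept, reject.\<close>

definition query_machine :: "nat \<Rightarrow> nat \<Rightarrow> prog \<Rightarrow> otm" where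
  "query_machine k s p = (let n = prog_size p in
     \<lparr>tapes = k, states = n + 5, symbols = s, start = 0, accept = n + 3, reject = n + 4,
      delta = (\<lambda>q ss. if q < n then (code p 0 n ! q) ss
        else if q = n + 1 then (n + 2, map (\<lambda>j. (ss ! j, if j = 1 then Right else Stay)) [0..<k])
        else (if ss ! 1 = 1 then n + 3 else n + 4, stay ss)),
      query = n, response = n + 1\<rparr>)"

lemma query_machine_wf:
  assumes "prog_wf k s p" "2 \<le> k" "3 \<le> s"
  shows "otm_wf (query_machine k s p)"
proof -
  let ?n = "prog_size p"
  have c: "fst (c ss) < ?n + 5 \<and> length (snd (c ss)) = k \<and> fst ` set (snd (c ss)) \<subseteq> {..<s}"
    if "c \<in> set (code p 0 ?n)" "length ss = k" "set ss \<subseteq> {..<s}" for c ss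
    using code_wf[OF assms(1) _ _ that(1), of ?n ss] that(2,3) by (auto simp: action_wf_def)
  show ?thesis
    unfolding otm_wf_def tm_wf_def query_machine_def Let_def
    using assms(2,3) c[OF nth_mem] by (auto simp: stay_def subset_iff)
qed

definition conf :: "nat \<Rightarrow> memory \<Rightarrow> config" where
  "conf q m = \<lparr>state = q, tape = fst m, head = snd m\<rparr>"

text \<open>The step function is abstract and the code of \<open>p\<close> sits between
  \<open>xs\<close> and \<open>ys\<close>, so that the induction can pass to subprograms while the
  whole table stays fixed.\<close>

lemma exec_code:
  assumes step: "\<And>q m. q < length C \<Longrightarrow> F (conf q m) = conf (fst ((C ! q) (view k m))) (act k (snd ((C ! q) (view k m))) m)"
    and "exec k p m t m'" "C = xs @ code p (length xs) e @ ys"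
  shows "(F ^^ t) (conf (length xs) m) = conf e m'"
  using assms(2,3)
proof (induction arbitrary: xs ys e)
  case (exec_Act f m)
  then show ?case using step[of "length xs"] by simp
next
  case (exec_Seq p m s m' q t m'')
  let ?c = "code p (length xs) (length xs + prog_size p)"
  have "(F ^^ s) (conf (length xs) m) = conf (length xs + prog_size p) m'"
    by (rule exec_Seq.IH(1)[of _ _ "code q (length xs + prog_size p) e @ ys"]) (use exec_Seq.prems in simp)
  moreover have "(F ^^ t) (conf (length (xs @ ?c)) m') = conf e m''"
    by (rule exec_Seq.IH(2)[of _ _ ys]) (use exec_Seq.prems in simp)
  ultimately show ?case by (simp add: funpow_add add.commute[of s])
next
  case (exec_CondT P m p t m' q)
  let ?h = "\<lambda>ss. (if P ss then length xs + 1 else length xs + 1 + prog_size p, stay ss)"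
  have "(F ^^ t) (conf (length (xs @ [?h])) m) = conf e m'"
    by (rule exec_CondT.IH[of _ _ "code q (length xs + 1 + prog_size p) e @ ys"]) (use exec_CondT.prems in simp)
  moreover have "F (conf (length xs) m) = conf (length xs + 1) m"
    using step[of "length xs" m] exec_CondT by (simp add: act_stay)
  ultimately show ?case by (simp add: funpow_swap1)
next
  case (exec_CondF P m q t m' p)
  let ?h = "\<lambda>ss. (if P ss then length xs + 1 else length xs + 1 + prog_size p, stay ss)"
  have "(F ^^ t) (conf (length (xs @ [?h] @ code p (length xs + 1) e)) m) = conf e m'"
    by (rule exec_CondF.IH[of _ _ ys]) (use exec_CondF.prems in simp)
  moreover have "F (conf (length xs) m) = conf (length xs + 1 + prog_size p) m"
    using step[of "length xs" m] exec_CondF by (simp add: act_stay)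
  ultimately show ?case by (simp add: funpow_swap1)
next
  case (exec_WhileF P m p)
  then show ?case using step[of "length xs" m] by (simp add: act_stay)
next
  case (exec_WhileT P m p s m' t m'')
  let ?h = "\<lambda>ss. (if P ss then length xs + 1 else e, stay ss)"
  have "(F ^^ s) (conf (length (xs @ [?h])) m) = conf (length xs) m'"
    by (rule exec_WhileT.IH(1)[of _ _ ys]) (use exec_WhileT.prems in simp)
  moreover have "F (conf (length xs) m) = conf (length xs + 1) m"
    using step[of "length xs" m] exec_WhileT.prems exec_WhileT.hyps(1) by (simp add: act_stay)
  ultimately have "(F ^^ Suc s) (conf (length xs) m) = conf (length xs) m'" by (simp add: funpow_swap1)
  moreover have "(F ^^ t) (conf (length xs) m') = conf e m''"
    by (rule exec_WhileT.IH(2)[OF exec_WhileT.prems])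
  moreover have "Suc (s + t) = t + Suc s" by simp
  ultimately show ?case by (simp only: funpow_add o_apply)
qed

lemma funpow_fixpoint: "f y = y \<Longrightarrow> (f ^^ n) y = y"
  by (induction n) auto

lemma funpow_stable:
  assumes "(f ^^ s) x = y" "f y = y" "s \<le> t"
  shows "(f ^^ t) x = y"
proof -
  have "(f ^^ (t - s + s)) x = (f ^^ (t - s)) y" unfolding funpow_add using assms(1) by simp
  then show ?thesis using assms(3) funpow_fixpoint[of f y] assms(2) by simp
qed

lemma otm_step_conf:
  assumes "q \<noteq> query M" "q \<noteq> accept M" "q \<noteq> reject M"
  shows "otm_step M S (conf q m) =
    conf (fst (delta M q (view (tapes M) m))) (act (tapes M) (snd (delta M q (view (tapes M) m))) m)"
proof -
  have "map (\<lambda>i. tape (conf q m) i (head (conf q m) i)) [0..<tapes M] = view (tapes M) m"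
    by (simp add: view_def conf_def)
  then show ?thesis
    using assms
    by (simp add: otm_step_def tm_step_def conf_def[of q] case_prod_beta Let_def)
      (simp add: conf_def act_def fun_eq_iff)
qed

text \<open>The three additional steps are the oracle call, the move to the second cell of the
  answer and the test of that bit. The machine has then halted, so any larger \<open>T\<close> gives
  the same state.\<close>

lemma query_machine_run:
  fixes p :: prog
  assumes k: "2 \<le> k" and ex: "exec k p (tape (tm_init M [x]), \<lambda>_. 0) t m"
    and S: "S (tape_string (fst m 1)) = True # b # w" and T: "t + 3 \<le> T"
    and M: "M = query_machine k s p"
  shows "state ((otm_step M S ^^ T) (tm_init M [x])) = (if b then reject M else accept M)"
proof -
  let ?n = "prog_size p" and ?F = "otm_step M S"
  have step: "?F (conf q m) = conf (fst (delta M q (view k m))) (act k (snd (delta M q (view k m))) m)"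
    if "q < ?n + 3" "q \<noteq> ?n" for q m
    using otm_step_conf[of q M S m] that by (simp add: M query_machine_def Let_def)
  have init: "tm_init M [x] = conf 0 (tape (tm_init M [x]), \<lambda>_. 0)"
    by (simp add: M tm_init_def query_machine_def conf_def Let_def)
  have "(?F ^^ t) (conf (length ([] :: (nat list \<Rightarrow> nat \<times> action) list)) (tape (tm_init M [x]), \<lambda>_. 0)) = conf ?n m"
  proof (rule exec_code[OF _ ex, where C = "code p 0 ?n" and xs = "[]" and ys = "[]"])
    fix q m assume "q < length (code p 0 ?n)"
    then show "?F (conf q m) = conf (fst ((code p 0 ?n ! q) (view k m))) (act k (snd ((code p 0 ?n ! q) (view k m))) m)"
      using step[of q m] by (simp add: M query_machine_def Let_def)
  qed simp
  then have 1: "(?F ^^ t) (tm_init M [x]) = conf ?n m" using init by simp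
  define m1 :: memory where "m1 = ((fst m)(1 := string_tape (True # b # w)), (snd m)(1 := 0))"
  have 2: "?F (conf ?n m) = conf (?n + 1) m1"
    using S by (simp add: otm_step_def M query_machine_def conf_def Let_def m1_def)
  define m2 where "m2 = act k (snd (delta M (?n + 1) (view k m1))) m1"
  have 3: "?F (conf (?n + 1) m1) = conf (?n + 2) m2"
    using step[of "?n + 1" m1] by (simp add: M query_machine_def Let_def m2_def)
  have "fst m2 1 = fst m1 1" "snd m2 1 = 1"
    using k by (auto simp: m2_def act_def M query_machine_def Let_def view_def m1_def)
  then have "view k m2 ! 1 = bit_symbol b"
    using k by (simp add: view_def m1_def string_tape_def)
  then have "?F (conf (?n + 2) m2) = conf (if b then reject M else accept M) m2"
    using step[of "?n + 2" m2] by (simp add: M query_machine_def Let_def bit_symbol_def act_stay)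
  with 1 2 3 have "(?F ^^ (3 + t)) (tm_init M [x]) = conf (if b then reject M else accept M) m2"
    unfolding funpow_add by (simp add: numeral_3_eq_3)
  moreover have "?F (conf (if b then reject M else accept M) m2) = conf (if b then reject M else accept M) m2"
    by (auto simp: otm_step_def tm_step_def M query_machine_def conf_def Let_def)
  ultimately have "(?F ^^ T) (tm_init M [x]) = conf (if b then reject M else accept M) m2"
    by (rule funpow_stable) (use T in simp)
  then show ?thesis by (simp add: conf_def)
qed

text \<open>Generators append symbols to an output tape while all other tapes are read-only. A variable
  ranges over the cells of its ruler tape, and incrementing it moves each head by a fixed amount, so
  that every head position is a linear function of the variables.\<close>

datatype gen =
  Emit nat
| Nop
| App gen gen
| If "nat list \<Rightarrow> bool" gen gen
| For nat "nat list \<Rightarrow> bool" gen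

fun gen_vars :: "gen \<Rightarrow> nat set" where
  "gen_vars (App g h) = gen_vars g \<union> gen_vars h"
| "gen_vars (If P g h) = gen_vars g \<union> gen_vars h"
| "gen_vars (For i P g) = insert i (gen_vars g)"
| "gen_vars _ = {}"

fun gen_symbols :: "gen \<Rightarrow> nat set" where
  "gen_symbols (Emit a) = {a}"
| "gen_symbols (App g h) = gen_symbols g \<union> gen_symbols h"
| "gen_symbols (If P g h) = gen_symbols g \<union> gen_symbols h"
| "gen_symbols (For i P g) = gen_symbols g"
| "gen_symbols Nop = {}"

text \<open>A loop must not occur within a loop over the same variable: it would displace the ruler
  head that counts the outer passes.\<close>

fun gen_wf :: "gen \<Rightarrow> bool" where
  "gen_wf (App g h) \<longleftrightarrow> gen_wf g \<and> gen_wf h"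
| "gen_wf (If P g h) \<longleftrightarrow> gen_wf g \<and> gen_wf h"
| "gen_wf (For i P g) \<longleftrightarrow> i \<notin> gen_vars g \<and> gen_wf g"
| "gen_wf _ \<longleftrightarrow> True"

text \<open>Evaluated at a bound for the ruler lengths, this bounds both the running time of the
  compiled program and the length of its output. Each pass of a loop costs a test, an increment and
  two steps of the later rewinding; leaving the two inner loops and the two single moves account for
  the constant 4.\<close>

fun gen_time :: "gen \<Rightarrow> nat poly" where
  "gen_time (App g h) = gen_time g + gen_time h"
| "gen_time (If P g h) = 1 + gen_time g + gen_time h"
| "gen_time (For i P g) = [:0, 1:] * (gen_time g + 4) + 4"
| "gen_time _ = 1"

fun opposite :: "move \<Rightarrow> move" where
  "opposite Left = Right"
| "opposite Stay = Stay"
| "opposite Right = Left"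

lemma shift_opposite: "shift (opposite m) = - shift m"
  by (cases m) auto

lemma takeWhile_upt:
  "\<exists>n \<le> l. takeWhile Q [0..<l] = [0..<n] \<and> (\<forall>v < n. Q v) \<and> (n < l \<longrightarrow> \<not> Q n)"
proof -
  let ?n = "length (takeWhile Q [0..<l])"
  have le: "?n \<le> l" using length_takeWhile_le[of Q "[0..<l]"] by simp
  have eq: "takeWhile Q [0..<l] = [0..<?n]"
    using le by (subst takeWhile_eq_take) simp
  have "Q v" if "v < ?n" for v
  proof -
    have "v \<in> set (takeWhile Q [0..<l])" by (subst eq) (use that in simp)
    then show ?thesis by (rule set_takeWhileD[THEN conjunct2])
  qed
  moreover have "\<not> Q ?n" if "?n < l"
    using nth_length_takeWhile[of Q "[0..<l]"] that by simp
  ultimately show ?thesis using le eq by blast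
qed

section \<open>Compilation of generators\<close>

locale layout =
  fixes k nv :: nat and mv :: "nat \<Rightarrow> nat \<Rightarrow> move" and ruler :: "nat \<Rightarrow> nat"
  assumes ruler: "\<And>i. i < nv \<Longrightarrow> ruler i < k" "\<And>i. i < nv \<Longrightarrow> mv i (ruler i) = Right"
      "\<And>i i'. i < nv \<Longrightarrow> i' < nv \<Longrightarrow> i' \<noteq> i \<Longrightarrow> mv i' (ruler i) = Stay"
begin

definition position :: "(nat \<Rightarrow> int) \<Rightarrow> nat \<Rightarrow> int" where
  "position env j = (\<Sum>i<nv. env i * shift (mv i j))"

lemma position_upd:
  assumes "i < nv"
  shows "position (env(i := v)) j = position env j + (v - env i) * shift (mv i j)"
proof -
  have "position (env(i := v)) j - position env j = (\<Sum>i'<nv. if i' = i then (v - env i) * shift (mv i j) else 0)"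
    unfolding position_def sum_subtractf[symmetric]
    by (rule sum.cong) (auto simp: algebra_simps)
  then show ?thesis using assms by simp
qed

lemma position_ruler:
  assumes "i < nv"
  shows "position env (ruler i) = env i"
proof -
  have "position env (ruler i) = (\<Sum>i'<nv. if i' = i then env i else 0)"
    unfolding position_def using assms by (intro sum.cong) (auto simp: ruler)
  then show ?thesis using assms by simp
qed

lemma position_zero [simp]: "position (\<lambda>_. 0) j = 0"
  by (simp add: position_def)

definition mem :: "nat set \<Rightarrow> (nat \<Rightarrow> nat list) \<Rightarrow> (nat \<Rightarrow> int) \<Rightarrow> nat list \<Rightarrow> int \<Rightarrow> memory" where
  "mem J con env w p = (\<lambda>j. if j \<in> J then word_tape w else word_tape (con j),
     \<lambda>j. if j \<in> J then p else if j < k then position env j else 0)"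

text \<open>During generation the output heads stand on the blank behind the output, so conditions
  cannot depend on what has been written.\<close>

definition gview :: "nat set \<Rightarrow> (nat \<Rightarrow> nat list) \<Rightarrow> (nat \<Rightarrow> int) \<Rightarrow> nat list" where
  "gview J con env = map (\<lambda>j. if j \<in> J then 0 else word_tape (con j) (position env j)) [0..<k]"

lemma view_mem: "view k (mem J con env w (int (length w))) = gview J con env"
  by (auto simp: view_def mem_def gview_def word_tape_def)

fun emitted :: "nat set \<Rightarrow> (nat \<Rightarrow> nat list) \<Rightarrow> gen \<Rightarrow> (nat \<Rightarrow> int) \<Rightarrow> nat list" where
  "emitted J con (Emit a) env = [a]"
| "emitted J con Nop env = []"
| "emitted J con (App g h) env = emitted J con g env @ emitted J con h env"
| "emitted J con (If P g h) env = (if P (gview J con env) then emitted J con g env else emitted J con h env)"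
| "emitted J con (For i P g) env =
     concat (map (\<lambda>v. emitted J con g (env(i := int v)))
       (takeWhile (\<lambda>v. P (gview J con (env(i := int v)))) [0..<length (con (ruler i))]))"

definition move_var :: "nat set \<Rightarrow> (nat \<Rightarrow> move) \<Rightarrow> prog" where
  "move_var J d = Act (\<lambda>ss. map (\<lambda>j. (ss ! j, if j \<in> J then Stay else d j)) [0..<k])"

text \<open>After a loop the ruler head may stand on the blank behind the ruler, where the search
  for the left end would stop at once; the single decrement prevents this. The search ends at -1,
  and the final increment restores 0. Reversed moves take all heads of the variable back
  together.\<close>

fun compile :: "nat set \<Rightarrow> gen \<Rightarrow> prog" where
  "compile J (Emit a) = Act (\<lambda>ss. map (\<lambda>j. if j \<in> J then (a, Right) else (ss ! j, Stay)) [0..<k])"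
| "compile J Nop = Act stay"
| "compile J (App g h) = Seq (compile J g) (compile J h)"
| "compile J (If P g h) = Cond P (compile J g) (compile J h)"
| "compile J (For i P g) =
     Seq (While (\<lambda>ss. ss ! ruler i \<noteq> 0 \<and> P ss) (Seq (compile J g) (move_var J (mv i))))
       (Seq (move_var J (opposite \<circ> mv i))
         (Seq (While (\<lambda>ss. ss ! ruler i \<noteq> 0) (move_var J (opposite \<circ> mv i)))
           (move_var J (mv i))))"

definition store_ok :: "nat set \<Rightarrow> (nat \<Rightarrow> nat list) \<Rightarrow> nat \<Rightarrow> nat set \<Rightarrow> bool" where
  "store_ok J con B I \<longleftrightarrow> (\<forall>i \<in> I. i < nv \<and> ruler i \<notin> J \<and> 0 \<notin> set (con (ruler i)) \<and> length (con (ruler i)) \<le> B)"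

lemma exec_move_var:
  assumes "i < nv" "\<And>j. shift (d j) = s * shift (mv i j)"
  shows "exec k (move_var J d) (mem J con env w p) 1 (mem J con (env(i := env i + s)) w p)"
proof -
  have "act k (map (\<lambda>j. (view k (mem J con env w p) ! j, if j \<in> J then Stay else d j)) [0..<k]) (mem J con env w p)
      = mem J con (env(i := env i + s)) w p"
    using assms by (auto simp: act_def mem_def view_def fun_eq_iff position_upd)
  then show ?thesis
    using exec_Act[of k "\<lambda>ss. map (\<lambda>j. (ss ! j, if j \<in> J then Stay else d j)) [0..<k]" "mem J con env w p"]
    by (simp add: move_var_def)
qed

lemma exec_inc:
  "i < nv \<Longrightarrow> exec k (move_var J (mv i)) (mem J con env w p) 1 (mem J con (env(i := env i + 1)) w p)"
  by (rule exec_move_var) auto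

lemma exec_dec:
  "i < nv \<Longrightarrow> exec k (move_var J (opposite \<circ> mv i)) (mem J con env w p) 1 (mem J con (env(i := env i - 1)) w p)"
  using exec_move_var[of i "opposite \<circ> mv i" "- 1"] by (simp add: shift_opposite)

lemma gview_ruler:
  "i < nv \<Longrightarrow> ruler i \<notin> J \<Longrightarrow> gview J con env ! ruler i = word_tape (con (ruler i)) (env i)"
  using ruler(1)[of i] by (simp add: gview_def position_ruler)

lemma word_tape_nonblank: "0 \<notin> set w \<Longrightarrow> word_tape w i \<noteq> 0 \<longleftrightarrow> 0 \<le> i \<and> i < int (length w)"
  by (auto simp: word_tape_def) (metis gr0I nat_less_iff nth_mem)

lemma exec_rewind_var:
  assumes i: "i < nv" "ruler i \<notin> J" "0 \<notin> set (con (ruler i))" and v: "v \<le> length (con (ruler i))"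
    and env: "env i = int v - 1"
  shows "exec k (While (\<lambda>ss. ss ! ruler i \<noteq> 0) (move_var J (opposite \<circ> mv i)))
    (mem J con env w (int (length w))) (2 * v + 1) (mem J con (env(i := - 1)) w (int (length w)))"
  using v env
proof (induction v arbitrary: env)
  case 0
  then have "env(i := - 1) = env" by auto
  moreover have "\<not> gview J con env ! ruler i \<noteq> 0"
    using i 0 by (simp add: gview_ruler word_tape_def)
  ultimately show ?case using exec_WhileF[of _ k "mem J con env w (int (length w))"] by (simp add: view_mem)
next
  case (Suc v)
  have "gview J con env ! ruler i \<noteq> 0"
    using i Suc.prems by (simp add: gview_ruler word_tape_nonblank del: neq0_conv)
  then have c: "view k (mem J con env w (int (length w))) ! ruler i \<noteq> 0" by (simp add: view_mem)
  have "exec k (While (\<lambda>ss. ss ! ruler i \<noteq> 0) (move_var J (opposite \<circ> mv i)))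
    (mem J con (env(i := env i - 1)) w (int (length w))) (2 * v + 1)
    (mem J con ((env(i := env i - 1))(i := - 1)) w (int (length w)))"
    by (rule Suc.IH) (use Suc.prems in auto)
  from exec_WhileT[where P = "\<lambda>ss. ss ! ruler i \<noteq> 0", OF c exec_dec[OF i(1)] this]
  show ?case by (simp del: fun_upd_apply o_apply)
qed

lemma word_tape_snoc: "word_tape (w @ [a]) = (word_tape w)(int (length w) := a)"
  by (auto simp: word_tape_def fun_eq_iff nth_append)

text \<open>The environment is the same before and after, as every loop resets its variable to 0;
  this is also why loop variables have to be 0 at the start.\<close>

lemma exec_compile:
  assumes J: "J \<subseteq> {..<k}" and "gen_wf g" "store_ok J con B (gen_vars g)" "\<And>i. i \<in> gen_vars g \<Longrightarrow> env i = 0"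
  shows "\<exists>t \<le> poly (gen_time g) B. exec k (compile J g) (mem J con env w (int (length w))) t
    (mem J con env (w @ emitted J con g env) (int (length (w @ emitted J con g env))))"
  using assms(2-)
proof (induction g arbitrary: env w)
  case (Emit a)
  let ?f = "\<lambda>ss. map (\<lambda>j. if j \<in> J then (a, Right) else (ss ! j, Stay)) [0..<k]"
  have "act k (?f (view k (mem J con env w (int (length w))))) (mem J con env w (int (length w))) =
      mem J con env (w @ [a]) (int (length (w @ [a])))"
    using J by (auto simp: act_def mem_def view_def fun_eq_iff word_tape_snoc)
  then show ?case
    using exec_Act[of k ?f "mem J con env w (int (length w))"] by (auto intro!: exI[of _ 1])
next
  case Nop
  show ?case
    using exec_Act[of k stay "mem J con env w (int (length w))"] by (auto simp: act_stay)
next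
  case (App g h)
  obtain s where s: "s \<le> poly (gen_time g) B" "exec k (compile J g) (mem J con env w (int (length w))) s
    (mem J con env (w @ emitted J con g env) (int (length (w @ emitted J con g env))))"
    using App.IH(1)[of env w] App.prems by (auto simp: store_ok_def)
  obtain t where t: "t \<le> poly (gen_time h) B" "exec k (compile J h)
      (mem J con env (w @ emitted J con g env) (int (length (w @ emitted J con g env)))) t
    (mem J con env ((w @ emitted J con g env) @ emitted J con h env) (int (length ((w @ emitted J con g env) @ emitted J con h env))))"
    using App.IH(2)[of env "w @ emitted J con g env"] App.prems by (auto simp: store_ok_def)
  show ?case using exec_Seq[OF s(2) t(2)] s(1) t(1) by (intro exI[of _ "s + t"]) simp
next
  case (If P g h)
  show ?case
  proof (cases "P (gview J con env)")
    case True
    obtain s where s: "s \<le> poly (gen_time g) B" "exec k (compile J g) (mem J con env w (int (length w))) s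
      (mem J con env (w @ emitted J con g env) (int (length (w @ emitted J con g env))))"
      using If.IH(1)[of env w] If.prems by (auto simp: store_ok_def)
    show ?thesis using exec_CondT[of P k, OF _ s(2)] s(1) True by (intro exI[of _ "Suc s"]) (simp add: view_mem)
  next
    case False
    obtain s where s: "s \<le> poly (gen_time h) B" "exec k (compile J h) (mem J con env w (int (length w))) s
      (mem J con env (w @ emitted J con h env) (int (length (w @ emitted J con h env))))"
      using If.IH(2)[of env w] If.prems by (auto simp: store_ok_def)
    show ?thesis using exec_CondF[of P k, OF _ s(2)] s(1) False by (intro exI[of _ "Suc s"]) (simp add: view_mem)
  qed
next
  case (For i P g)
  let ?l = "length (con (ruler i))" and ?Q = "\<lambda>v. P (gview J con (env(i := int v)))"
  let ?b = "poly (gen_time g) B"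
  have i: "i < nv" "ruler i \<notin> J" "0 \<notin> set (con (ruler i))" "?l \<le> B" "i \<notin> gen_vars g" "gen_wf g"
    "store_ok J con B (gen_vars g)" "env i = 0"
    using For.prems by (auto simp: store_ok_def)
  obtain n where n: "n \<le> ?l" "takeWhile ?Q [0..<?l] = [0..<n]" "\<And>v. v < n \<Longrightarrow> ?Q v" "n < ?l \<Longrightarrow> \<not> ?Q n"
    using takeWhile_upt[of ?l ?Q] by blast
  let ?out = "\<lambda>v. concat (map (\<lambda>v. emitted J con g (env(i := int v))) [v..<n])"
  let ?m = "\<lambda>v w. mem J con (env(i := int v)) w (int (length w))"
  let ?W = "While (\<lambda>ss. ss ! ruler i \<noteq> 0 \<and> P ss) (Seq (compile J g) (move_var J (mv i)))"
  have loop: "\<exists>t \<le> (n - v) * (?b + 2) + 1. exec k ?W (?m v w') t (?m n (w' @ ?out v))" if "v \<le> n" for v w'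
    using that
  proof (induction "n - v" arbitrary: v w')
    case 0
    then have v: "v = n" by simp
    have "\<not> (gview J con (env(i := int n)) ! ruler i \<noteq> 0 \<and> P (gview J con (env(i := int n))))"
      using n(1,4) i(1,2,3) by (cases "n < ?l") (auto simp: gview_ruler word_tape_def)
    then have "exec k ?W (?m n w') 1 (?m n w')" by (intro exec_WhileF) (simp add: view_mem)
    then show ?case using v by (auto simp del: fun_upd_apply intro!: exI[of _ 1])
  next
    case (Suc d)
    then have v: "v < n" and d: "d = n - Suc v" by simp_all
    have c: "view k (?m v w') ! ruler i \<noteq> 0 \<and> P (view k (?m v w'))"
      using v n(1) n(3)[OF v] i(1,2,3) by (simp add: view_mem gview_ruler word_tape_nonblank del: neq0_conv)
    let ?w = "w' @ emitted J con g (env(i := int v))"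
    have zero: "(env(i := int v)) j = 0" if "j \<in> gen_vars g" for j using i(5) For.prems(3) that by auto
    obtain s where s: "s \<le> ?b" "exec k (compile J g) (?m v w') s (?m v ?w)"
      using For.IH[OF i(6,7), of "env(i := int v)" w'] zero by blast
    have "exec k (move_var J (mv i)) (?m v ?w) 1 (?m (Suc v) ?w)"
      using exec_inc[OF i(1), of J con "env(i := int v)" ?w "int (length ?w)"] by (simp add: add.commute)
    from exec_Seq[OF s(2) this] have body: "exec k (Seq (compile J g) (move_var J (mv i))) (?m v w') (s + 1) (?m (Suc v) ?w)" .
    obtain t where t: "t \<le> (n - Suc v) * (?b + 2) + 1" "exec k ?W (?m (Suc v) ?w) t (?m n (?w @ ?out (Suc v)))"
      using Suc.hyps(1)[OF _ Suc_leI[OF v], of ?w] d by blast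
    have ex: "exec k ?W (?m v w') (Suc (s + 1 + t)) (?m n (?w @ ?out (Suc v)))"
      by (rule exec_WhileT[OF _ body t(2)]) (use c in simp)
    have eq: "?w @ ?out (Suc v) = w' @ ?out v" using v by (simp add: upt_conv_Cons)
    have le: "Suc (s + 1 + t) \<le> (n - v) * (?b + 2) + 1"
    proof -
      have "n - v = Suc (n - Suc v)" using v by simp
      then show ?thesis using s(1) t(1) by simp
    qed
    show ?case using ex le unfolding eq by blast
  qed
  let ?w = "w @ ?out 0"
  obtain t where t: "t \<le> n * (?b + 2) + 1" "exec k ?W (?m 0 w) t (?m n ?w)"
    using loop[of 0 w] by auto
  have d: "exec k (move_var J (opposite \<circ> mv i)) (?m n ?w) 1 (mem J con (env(i := int n - 1)) ?w (int (length ?w)))"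
    using exec_dec[OF i(1), of J con "env(i := int n)" ?w "int (length ?w)"] by simp
  have r: "exec k (While (\<lambda>ss. ss ! ruler i \<noteq> 0) (move_var J (opposite \<circ> mv i)))
      (mem J con (env(i := int n - 1)) ?w (int (length ?w))) (2 * n + 1) (mem J con (env(i := - 1)) ?w (int (length ?w)))"
    using exec_rewind_var[of i J con n "env(i := int n - 1)" ?w] i(1,2,3) n(1) by simp
  have e: "exec k (move_var J (mv i)) (mem J con (env(i := - 1)) ?w (int (length ?w))) 1 (mem J con env ?w (int (length ?w)))"
    using exec_inc[OF i(1), of J con "env(i := - 1)" ?w "int (length ?w)"] i(8) by (simp add: fun_upd_idem)
  have "?m 0 w = mem J con env w (int (length w))" using i(8) by (simp add: fun_upd_idem)
  then have "exec k (compile J (For i P g)) (mem J con env w (int (length w))) (t + (1 + (2 * n + 1 + 1)))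
      (mem J con env ?w (int (length ?w)))"
    using exec_Seq[OF t(2) exec_Seq[OF d exec_Seq[OF r e]]] by simp
  moreover have "emitted J con (For i P g) env = ?out 0" using n(2) by simp
  moreover have "t + (1 + (2 * n + 1 + 1)) \<le> poly (gen_time (For i P g)) B"
  proof -
    have "n * (?b + 4) \<le> B * (?b + 4)" using n(1) i(4) by (intro mult_right_mono) auto
    then show ?thesis using t(1) by (simp add: algebra_simps)
  qed
  ultimately show ?case by metis
qed

text \<open>Testing the single tape \<open>j0\<close> is enough, because all output tapes have the
  same content and head position. The first move leaves the blank behind the output.\<close>

definition rewind :: "nat \<Rightarrow> nat set \<Rightarrow> prog" where
  "rewind j0 J = (let go = \<lambda>d. Act (\<lambda>ss. map (\<lambda>j. (ss ! j, if j \<in> J then d else Stay)) [0..<k]) in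
     Seq (go Left) (Seq (While (\<lambda>ss. ss ! j0 \<noteq> 0) (go Left)) (go Right)))"

lemma exec_shift_output:
  assumes "J \<subseteq> {..<k}"
  shows "exec k (Act (\<lambda>ss. map (\<lambda>j. (ss ! j, if j \<in> J then d else Stay)) [0..<k])) (mem J con env w p) 1
    (mem J con env w (p + shift d))"
proof -
  let ?f = "\<lambda>ss. map (\<lambda>j. (ss ! j, if j \<in> J then d else Stay)) [0..<k]"
  have "act k (?f (view k (mem J con env w p))) (mem J con env w p) = mem J con env w (p + shift d)"
    using assms by (auto simp: act_def mem_def view_def fun_eq_iff)
  then show ?thesis using exec_Act[of k ?f "mem J con env w p"] by simp
qed

lemma exec_rewind:
  assumes J: "J \<subseteq> {..<k}" "j0 \<in> J" and w: "0 \<notin> set w"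
  shows "exec k (rewind j0 J) (mem J con env w (int (length w))) (2 * length w + 3) (mem J con env w 0)"
proof -
  let ?L = "Act (\<lambda>ss. map (\<lambda>j. (ss ! j, if j \<in> J then Left else Stay)) [0..<k])"
  let ?W = "While (\<lambda>ss. ss ! j0 \<noteq> 0) ?L"
  have v: "view k (mem J con env w p) ! j0 = word_tape w p" for p
    using J by (auto simp: view_def mem_def)
  have loop: "exec k ?W (mem J con env w (int n - 1)) (2 * n + 1) (mem J con env w (- 1))" if "n \<le> length w" for n
    using that
  proof (induction n)
    case 0
    have "\<not> view k (mem J con env w (- 1)) ! j0 \<noteq> 0" by (simp add: v word_tape_def)
    then show ?case using exec_WhileF[where P = "\<lambda>ss. ss ! j0 \<noteq> 0"] by simp
  next
    case (Suc n)
    have c: "view k (mem J con env w (int n)) ! j0 \<noteq> 0"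
      unfolding v word_tape_nonblank[OF w] using Suc.prems by simp
    have "exec k ?L (mem J con env w (int n)) 1 (mem J con env w (int n - 1))"
      using exec_shift_output[OF J(1), of Left con env w "int n"] by simp
    from exec_WhileT[where P = "\<lambda>ss. ss ! j0 \<noteq> 0", OF c this Suc.IH] Suc.prems
    show ?case by simp
  qed
  have "exec k ?L (mem J con env w (int (length w))) 1 (mem J con env w (int (length w) - 1))"
    using exec_shift_output[OF J(1), of Left con env w "int (length w)"] by simp
  from exec_Seq[OF this exec_Seq[OF loop[OF le_refl] exec_shift_output[OF J(1), of Right]]]
  show ?thesis by (simp add: rewind_def eval_nat_numeral)
qed

lemma set_emitted: "set (emitted J con g env) \<subseteq> gen_symbols g"
proof (induction g arbitrary: env)
  case (App g h)
  show ?case using App[of env] by auto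
next
  case (If P g h)
  show ?case using If[of env] by auto
next
  case (For i P g)
  show ?case using For by (auto simp del: fun_upd_apply)
qed auto

lemma length_emitted: "store_ok J con B (gen_vars g) \<Longrightarrow> length (emitted J con g env) \<le> poly (gen_time g) B"
proof (induction g arbitrary: env)
  case (App g h)
  then show ?case using App.IH(1)[of env] App.IH(2)[of env] by (auto simp: store_ok_def intro!: add_mono)
next
  case (If P g h)
  then show ?case using If.IH(1)[of env] If.IH(2)[of env] by (auto simp: store_ok_def le_SucI trans_le_add1 trans_le_add2)
next
  case (For i P g)
  let ?b = "poly (gen_time g) B"
  let ?vs = "takeWhile (\<lambda>v. P (gview J con (env(i := int v)))) [0..<length (con (ruler i))]"
  have ok: "store_ok J con B (gen_vars g)" "length (con (ruler i)) \<le> B"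
    using For.prems by (auto simp: store_ok_def)
  have *: "length (concat (map (\<lambda>v. emitted J con g (env(i := int v))) vs)) \<le> length vs * ?b" for vs
    by (induction vs) (use For.IH[OF ok(1)] in \<open>auto intro: add_mono\<close>)
  have "length (emitted J con (For i P g) env) \<le> length ?vs * ?b" using *[of ?vs] by simp
  also have "length ?vs \<le> B" using length_takeWhile_le[of _ "[0..<length (con (ruler i))]"] ok(2)
    by (metis diff_zero length_upt order_trans)
  then have "length ?vs * ?b \<le> B * ?b" by (rule mult_right_mono) simp
  finally show ?case by (simp add: algebra_simps)
qed auto

text \<open>A stage \<open>(js, g)\<close> writes the output of \<open>g\<close> on each of the tapes \<open>js\<close>.\<close>

type_synonym stage = "nat list \<times> gen"

definition stage_prog :: "stage \<Rightarrow> prog" where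
  "stage_prog st = Seq (compile (set (fst st)) (snd st)) (rewind (hd (fst st)) (set (fst st)))"

definition stage_store :: "stage \<Rightarrow> (nat \<Rightarrow> nat list) \<Rightarrow> nat \<Rightarrow> nat list" where
  "stage_store st con = (\<lambda>j. if j \<in> set (fst st) then emitted (set (fst st)) con (snd st) (\<lambda>_. 0) else con j)"

definition stage_time :: "stage \<Rightarrow> nat poly" where
  "stage_time st = 3 * gen_time (snd st) + 3"

definition stage_wf :: "nat \<Rightarrow> stage \<Rightarrow> bool" where
  "stage_wf s st \<longleftrightarrow> fst st \<noteq> [] \<and> set (fst st) \<subseteq> {..<k} \<and> gen_wf (snd st) \<and> gen_symbols (snd st) \<subseteq> {0<..<s}"

definition stage_ok :: "nat \<Rightarrow> (nat \<Rightarrow> nat list) \<Rightarrow> stage \<Rightarrow> bool" where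
  "stage_ok B con st \<longleftrightarrow> (\<forall>j \<in> set (fst st). con j = []) \<and> store_ok (set (fst st)) con B (gen_vars (snd st))"

definition store_mem :: "(nat \<Rightarrow> nat list) \<Rightarrow> memory" where
  "store_mem con = (\<lambda>j. word_tape (con j), \<lambda>_. 0)"

lemma exec_stage:
  assumes wf: "stage_wf s st" and ok: "stage_ok B con st"
  shows "\<exists>t \<le> poly (stage_time st) B. exec k (stage_prog st) (store_mem con) t (store_mem (stage_store st con))"
proof -
  obtain js g where st: "st = (js, g)" by fastforce
  let ?J = "set js" and ?w = "emitted (set js) con g (\<lambda>_. 0)"
  have js: "js \<noteq> []" "?J \<subseteq> {..<k}" "gen_wf g" "gen_symbols g \<subseteq> {0<..<s}"
    using wf by (auto simp: stage_wf_def st)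
  have s: "\<forall>j \<in> ?J. con j = []" "store_ok ?J con B (gen_vars g)" using ok by (auto simp: stage_ok_def st)
  obtain t where t: "t \<le> poly (gen_time g) B" "exec k (compile ?J g) (mem ?J con (\<lambda>_. 0) [] 0) t
    (mem ?J con (\<lambda>_. 0) ?w (int (length ?w)))"
    using exec_compile[OF js(2,3) s(2), of "\<lambda>_. 0" "[]"] by auto
  have "0 \<notin> set ?w" using set_emitted[of ?J con g "\<lambda>_. 0"] js(4) by auto
  then have r: "exec k (rewind (hd js) ?J) (mem ?J con (\<lambda>_. 0) ?w (int (length ?w))) (2 * length ?w + 3) (mem ?J con (\<lambda>_. 0) ?w 0)"
    by (intro exec_rewind) (use js in auto)
  have "mem ?J con (\<lambda>_. 0) [] 0 = store_mem con" using s(1) by (simp add: mem_def store_mem_def fun_eq_iff)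
  moreover have "mem ?J con (\<lambda>_. 0) ?w 0 = store_mem (stage_store st con)"
    by (simp add: mem_def store_mem_def stage_store_def st if_distrib[of word_tape] cong: if_cong)
  ultimately have "exec k (stage_prog st) (store_mem con) (t + (2 * length ?w + 3)) (store_mem (stage_store st con))"
    using exec_Seq[OF t(2)] r by (simp add: stage_prog_def st)
  moreover have "t + (2 * length ?w + 3) \<le> poly (stage_time st) B"
    using t(1) length_emitted[OF s(2), of "\<lambda>_. 0"] by (simp add: stage_time_def st)
  ultimately show ?thesis by blast
qed

fun stages_prog :: "stage list \<Rightarrow> prog" where
  "stages_prog [] = Act stay"
| "stages_prog (st # sts) = Seq (stage_prog st) (stages_prog sts)"

fun stages_ok :: "nat \<Rightarrow> (nat \<Rightarrow> nat list) \<Rightarrow> stage list \<Rightarrow> bool" where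
  "stages_ok B con [] \<longleftrightarrow> True"
| "stages_ok B con (st # sts) \<longleftrightarrow> stage_ok B con st \<and> stages_ok B (stage_store st con) sts"

definition stages_time :: "stage list \<Rightarrow> nat poly" where
  "stages_time sts = sum_list (map stage_time sts) + 1"

lemma exec_stages:
  assumes "list_all (stage_wf s) sts" "stages_ok B con sts"
  shows "\<exists>t \<le> poly (stages_time sts) B. exec k (stages_prog sts) (store_mem con) t (store_mem (fold stage_store sts con))"
  using assms
proof (induction sts arbitrary: con)
  case Nil
  show ?case using exec_Act[of k stay "store_mem con"] by (auto simp: act_stay stages_time_def)
next
  case (Cons st sts)
  obtain t where t: "t \<le> poly (stage_time st) B" "exec k (stage_prog st) (store_mem con) t (store_mem (stage_store st con))"
    using exec_stage[of s st B con] Cons.prems by auto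
  obtain t' where t': "t' \<le> poly (stages_time sts) B"
    "exec k (stages_prog sts) (store_mem (stage_store st con)) t' (store_mem (fold stage_store sts (stage_store st con)))"
    using Cons.IH[of "stage_store st con"] Cons.prems by auto
  show ?case using exec_Seq[OF t(2) t'(2)] t(1) t'(1)
    by (intro exI[of _ "t + t'"]) (simp add: stages_time_def)
qed

lemma action_wf_map:
  assumes "\<And>ss j. j < k \<Longrightarrow> length ss = k \<Longrightarrow> set ss \<subseteq> {..<s} \<Longrightarrow> fst (f ss j) < s"
  shows "action_wf k s (\<lambda>ss. map (f ss) [0..<k])"
  using assms by (auto simp: action_wf_def)

lemma action_wf_keep: "action_wf k s (\<lambda>ss. map (\<lambda>j. (ss ! j, d j)) [0..<k])"
  by (rule action_wf_map) (auto simp: subset_iff)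

lemma prog_wf_compile: "gen_symbols g \<subseteq> {0<..<s} \<Longrightarrow> prog_wf k s (compile J g)"
proof (induction g)
  case (Emit a)
  then show ?case by (auto intro!: action_wf_map simp: subset_iff)
qed (auto simp: action_wf_stay move_var_def action_wf_keep)

lemma prog_wf_stages: "list_all (stage_wf s) sts \<Longrightarrow> prog_wf k s (stages_prog sts)"
  by (induction sts)
    (auto simp: action_wf_stay stage_wf_def stage_prog_def prog_wf_compile rewind_def action_wf_keep Let_def)

end


section \<open>Writing down the instance\<close>

text \<open>Binary digits come least significant first, each preceded by \<open>True\<close>. Powers
  of two and their predecessors are thus repetitions of one block with a fixed ending, which is all
  that loops can produce.\<close>

lemma encode_nat_pow2: "encode_nat (2 ^ a) = concat (replicate a [True, False]) @ [True, True, False]"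
proof (induction a)
  case 0
  show ?case by (simp add: encode_nat.simps[of "Suc 0"] encode_nat.simps[of 0])
next
  case (Suc a)
  then show ?case by (subst encode_nat.simps) simp
qed

lemma encode_nat_pow2_pred: "encode_nat (2 ^ a - 1) = concat (replicate a [True, True]) @ [False]"
proof (induction a)
  case 0
  show ?case by (simp add: encode_nat.simps[of 0])
next
  case (Suc a)
  have "(2 ^ Suc a - 1 :: nat) div 2 = 2 ^ a - 1" "odd (2 ^ Suc a - 1 :: nat)" "(2 ^ Suc a - 1 :: nat) \<noteq> 0"
  proof -
    obtain b where "(2 :: nat) ^ a = Suc b" by (metis not0_implies_Suc power_not_zero zero_neq_numeral)
    then show "(2 ^ Suc a - 1 :: nat) div 2 = 2 ^ a - 1" "odd (2 ^ Suc a - 1 :: nat)" "(2 ^ Suc a - 1 :: nat) \<noteq> 0"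
      by auto
  qed
  then show ?case using Suc by (subst encode_nat.simps) simp
qed

lemma encode_rat_fraction:
  assumes "coprime n d" "0 < d"
  shows "encode_rat (of_nat n / of_nat d) = encode_nat n @ encode_nat d"
proof -
  have "quotient_of (of_nat n / of_nat d) = (int n, int d)"
  proof -
    have "(of_nat n / of_nat d :: rat) = Fract (int n) (int d)" by (simp add: Fract_of_int_quotient)
    then show ?thesis using assms by (simp add: quotient_of_Fract normalize_stable)
  qed
  then show ?thesis by (simp add: encode_rat_def)
qed

lemma encode_rat_inverse_pow2:
  "encode_rat (1 / 2 ^ a) = [True, True, False] @ concat (replicate a [True, False]) @ [True, True, False]"
  using encode_rat_fraction[of 1 "2 ^ a"] encode_nat_pow2[of 0] encode_nat_pow2[of a] by simp

lemma encode_rat_one_minus_inverse_pow2: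
  "encode_rat (1 - 1 / 2 ^ a) =
     concat (replicate a [True, True]) @ [False] @ concat (replicate a [True, False]) @ [True, True, False]"
proof -
  have "coprime (2 ^ a - 1) (2 ^ a :: nat)"
    using coprime_diff_one_left_nat[of "2 ^ a"] by simp
  moreover have "of_nat (2 ^ a - 1) / of_nat (2 ^ a) = (1 - 1 / 2 ^ a :: rat)"
    by (simp add: of_nat_diff field_simps)
  ultimately show ?thesis
    using encode_rat_fraction[of "2 ^ a - 1" "2 ^ a"] encode_nat_pow2[of a] encode_nat_pow2_pred[of a] by simp
qed

lemma concat_bits:
  "concat (map (\<lambda>_. map bit_symbol (concat (replicate m w))) xs) =
     map bit_symbol (concat (replicate (length xs * m) w))"
  by (induction xs) (auto simp: replicate_add)

lemma map_encode_list:
  "map bit_symbol (encode_list e as) = concat (map (\<lambda>a. 2 # map bit_symbol (e a)) as) @ [1]"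
  by (induction as) (auto simp: bit_symbol_def)

lemma concat_map_concat: "concat (map h (concat (map f xs))) = concat (map (\<lambda>x. concat (map h (f x))) xs)"
  by (induction xs) auto

text \<open>Relates the running index of the prior entries to the pair of a cell and an offset
  within that cell.\<close>

lemma concat_upt_mult:
  "concat (map g [0..<n * m]) = concat (map (\<lambda>e. concat (map (\<lambda>l. g (e * m + l)) [0..<m])) [0..<n])"
proof (induction n)
  case (Suc n)
  have "[0..<Suc n * m] = [0..<n * m] @ map (\<lambda>l. n * m + l) [0..<m]"
    using upt_add_eq_append[of 0 "n * m" m] map_add_upt[of "n * m" m] by (simp add: add.commute)
  then show ?case using Suc by (simp add: comp_def)
qed simp

lemma tape_string_string_tape [simp]: "tape_string (string_tape w) = w"
proof -
  have "(LEAST n. string_tape w (int n) \<notin> {1, 2}) = length w"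
  proof (rule Least_equality)
    fix y assume "string_tape w (int y) \<notin> {1, 2}"
    then show "length w \<le> y" by (rule contrapos_np) (auto simp: string_tape_def bit_symbol_def)
  qed (simp add: string_tape_def)
  then show ?thesis
    by (auto simp: tape_string_def string_tape_def bit_symbol_def intro!: nth_equalityI)
qed

lemma poly_nat_mono: "x \<le> y \<Longrightarrow> poly (p :: nat poly) x \<le> poly p y"
  by (induction p) (auto intro!: add_mono mult_mono)

fun gen_word :: "nat list \<Rightarrow> gen" where
  "gen_word [] = Nop"
| "gen_word (a # w) = App (Emit a) (gen_word w)"

fun gen_concat :: "gen list \<Rightarrow> gen" where
  "gen_concat [] = Nop"
| "gen_concat (g # gs) = App g (gen_concat gs)"

abbreviation gen_bits :: "bool list \<Rightarrow> gen" where
  "gen_bits u \<equiv> gen_word (map bit_symbol u)"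

abbreviation gen_for :: "nat \<Rightarrow> gen \<Rightarrow> gen" where
  "gen_for i g \<equiv> For i (\<lambda>_. True) g"

text \<open>Horner's scheme: the output has length \<open>c\<^sub>0 + n * (c\<^sub>1 + n * (c\<^sub>2 + \<dots>))\<close> if all rulers have length \<open>n\<close>.\<close>

fun gen_poly :: "nat \<Rightarrow> nat \<Rightarrow> nat list \<Rightarrow> gen" where
  "gen_poly a i [] = Nop"
| "gen_poly a i (c # cs) = App (gen_word (replicate c a)) (gen_for i (gen_poly a (Suc i) cs))"

lemma gen_word_props [simp]:
  "gen_vars (gen_word w) = {}" "gen_wf (gen_word w)" "gen_symbols (gen_word w) = set w"
  by (induction w) auto

lemma gen_concat_props [simp]:
  "gen_vars (gen_concat gs) = (\<Union>g\<in>set gs. gen_vars g)" "gen_wf (gen_concat gs) \<longleftrightarrow> (\<forall>g\<in>set gs. gen_wf g)"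
  "gen_symbols (gen_concat gs) = (\<Union>g\<in>set gs. gen_symbols g)"
  by (induction gs) auto

lemma gen_poly_props:
  "gen_vars (gen_poly a i cs) \<subseteq> {i..<i + length cs}" "gen_wf (gen_poly a i cs)" "gen_symbols (gen_poly a i cs) \<subseteq> {a}"
proof (induction cs arbitrary: i)
  case (Cons c cs)
  { case 1 then show ?case using Cons(1)[of "Suc i"] by (auto dest!: subsetD) }
  { case 2 then show ?case using Cons(1)[of "Suc i"] Cons(2)[of "Suc i"] by (auto dest!: subsetD) }
  { case 3 then show ?case using Cons(3)[of "Suc i"] by auto }
qed auto

lemma takeWhile_True [simp]: "takeWhile (\<lambda>_. True) xs = xs"
  by simp

context layout
begin

lemma emitted_gen_word [simp]: "emitted J con (gen_word w) env = w"
  by (induction w) auto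

lemma emitted_gen_concat [simp]: "emitted J con (gen_concat gs) env = concat (map (\<lambda>g. emitted J con g env) gs)"
  by (induction gs) auto

lemma emitted_gen_for [simp]:
  "emitted J con (gen_for i g) env =
     concat (map (\<lambda>v. emitted J con g (env(i := int v))) [0..<length (con (ruler i))])"
  by simp

lemma emitted_gen_poly:
  assumes "\<And>i'. i \<le> i' \<Longrightarrow> i' < i + length (coeffs f) \<Longrightarrow> length (con (ruler i')) = n"
  shows "emitted J con (gen_poly a i (coeffs f)) env = replicate (poly f n) a"
proof -
  have concat: "concat (map (\<lambda>v. replicate l a) [0..<m]) = replicate (m * l) a" for l m
    by (induction m) (auto simp: replicate_add[symmetric] add.commute)
  have "emitted J con (gen_poly a i cs) env = replicate (foldr (\<lambda>c r. c + n * r) cs 0) a"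
    if "\<And>i'. i \<le> i' \<Longrightarrow> i' < i + length cs \<Longrightarrow> length (con (ruler i')) = n" for cs
    using that
  proof (induction cs arbitrary: i env)
    case (Cons c cs)
    have "emitted J con (gen_poly a (Suc i) cs) env' = replicate (foldr (\<lambda>c r. c + n * r) cs 0) a" for env'
      using Cons.IH[of "Suc i" env'] Cons.prems by auto
    then show ?case using Cons.prems[of i] by (simp add: concat replicate_add)
  qed simp
  then show ?thesis using assms by (simp add: poly_def horner_sum_foldr)
qed

end

text \<open>Tapes: 0 input, 1 oracle, 2 to 4 rulers of variables 0 to 2, 5 marks the differences of the
  variables 0 (cell of a model) and 1 (cell of a label) at which a window meets a cell, 6 to 9 describe
  the cell given by variable 1 (input symbol, certificate allowed, has a window, lies in the first row),
  10 onwards rulers of the input length. Variable 3 scans the input.\<close>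

definition head_move :: "nat \<Rightarrow> nat \<Rightarrow> move" where
  "head_move i j = (if i = 0 then (if j \<in> {2, 5} then Right else Stay)
     else if i = 1 then (if j \<in> {3, 6, 7, 8, 9} then Right else if j = 5 then Left else Stay)
     else if i = 2 then (if j = 4 then Right else Stay)
     else if i = 3 then (if j = 0 then Right else Stay)
     else if j = i + 6 then Right else Stay)"

definition ruler_tape :: "nat \<Rightarrow> nat" where
  "ruler_tape i = (if i = 0 then 2 else if i = 1 then 3 else if i = 2 then 4 else if i = 3 then 0 else i + 6)"

section \<open>The machine, uniform in its input\<close>

locale reduction =
  fixes M :: tm and p q :: "nat poly"
  assumes M_wf: "tm_wf M"
begin

text \<open>Bounds the certificate, the input and the running time of the verifier on the longest
  certificate; the summand 2 provides \<open>2 \<le> V\<close>.\<close>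

definition height_poly :: "nat poly" where
  "height_poly = p + [:0, 1:] + pcompose q ([:0, 1:] + p) + 2"

definition row_poly :: "nat poly" where "row_poly = 3 * height_poly + 3"

definition inner_poly :: "nat poly" where "inner_poly = height_poly * (row_poly + 1)"

definition cells_poly :: "nat poly" where "cells_poly = inner_poly + row_poly + 3"

text \<open>Nested loops of Horner's scheme need distinct variables and hence a ruler each. Their
  number depends on the polynomials alone, so the number of tapes is fixed.\<close>

definition depth :: nat where
  "depth = Suc (length (coeffs p) + length (coeffs row_poly) + length (coeffs inner_poly) + length (coeffs cells_poly))"

sublocale layout "10 + depth" "4 + depth" head_move ruler_tape
  by standard (auto simp: head_move_def ruler_tape_def split: if_splits)

abbreviation "tls \<equiv> tile_list M"
abbreviation "wins \<equiv> window_csp.windows tls"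

definition density :: nat where "density = 3 * length wins + length tls + 4"

definition gen_eps :: gen where
  "gen_eps = gen_concat [gen_bits [True, True, False],
     gen_for 2 (gen_bits (concat (replicate density [True, False]))), gen_bits [True, True, False]]"

definition gen_one :: gen where
  "gen_one = gen_concat [gen_for 2 (gen_bits (concat (replicate density [True, True]))), gen_bits [False],
     gen_for 2 (gen_bits (concat (replicate density [True, False]))), gen_bits [True, True, False]]"

definition gen_row :: "bool \<Rightarrow> gen" where
  "gen_row b = gen_concat [gen_bits [True], if b then gen_eps else gen_one, gen_bits [True],
     if b then gen_one else gen_eps, gen_bits [False]]"

definition gen_labels :: "(tile window option \<Rightarrow> bool \<Rightarrow> nat list \<Rightarrow> bool) \<Rightarrow> gen" where
  "gen_labels P = gen_concat
     [gen_for 1 (gen_concat (map (\<lambda>f. gen_concat (map (\<lambda>b.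
        App (gen_bits [True]) (If (P f b) (gen_row True) (gen_row False))) [False, True])) wins)),
      gen_bits [True], gen_row False, gen_bits [False]]"

text \<open>The form of \<open>covers\<close> that a machine can evaluate: loop variables cannot be
  compared directly, but the marks 1 to 4 on tape 5 tell which cell of the window, if any, is the
  assigned one.\<close>

fun view_covers :: "tile \<Rightarrow> tile window option \<Rightarrow> nat list \<Rightarrow> bool" where
  "view_covers s None ss \<longleftrightarrow> ss ! 5 = 1"
| "view_covers s (Some (a0, a1, a2, a3)) ss \<longleftrightarrow>
     \<not> (ss ! 8 \<noteq> 0 \<and> \<not> tile_ok M (ss ! 9) (ss ! 6) (ss ! 7) (a0, a1, a2, a3)) \<or>
     ss ! 5 = 1 \<and> s \<noteq> a0 \<or> ss ! 5 = 2 \<and> s \<noteq> a1 \<or> ss ! 5 = 3 \<and> s \<noteq> a2 \<or> ss ! 5 = 4 \<and> s \<noteq> a3"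

definition gen_models :: gen where
  "gen_models = gen_concat
     [gen_bits [True], gen_labels (\<lambda>f b ss. b \<and> f \<noteq> None),
      gen_for 0 (gen_concat (map (\<lambda>s. App (gen_bits [True]) (gen_labels (\<lambda>f b ss. b \<and> view_covers s f ss))) tls)),
      gen_for 0 (gen_concat (map (\<lambda>f'. App (gen_bits [True]) (gen_labels (\<lambda>f b ss. ss ! 5 = 1 \<and> f' = f))) wins)),
      gen_bits [False]]"

text \<open>Offset \<open>l\<close> at cell \<open>e\<close> requires the exponent
  \<open>e * (length wins * 2) + l + 1\<close>. The loop over variable 0 runs until it meets
  variable 1, that is, \<open>e\<close> times. The bits \<open>[True, True, True, False]\<close> are
  a list constructor followed by the numerator 1.\<close>

definition gen_prior :: gen where
  "gen_prior = gen_concat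
     [gen_for 1 (gen_concat (map (\<lambda>l. gen_concat [gen_bits [True, True, True, False],
        For 0 (\<lambda>ss. ss ! 5 \<noteq> 1) (gen_bits (concat (replicate (length wins * 2) [True, False]))),
        gen_bits (concat (replicate (Suc l) [True, False])), gen_bits [True, True, False]]) [0..<length wins * 2])),
      gen_bits [True, True, True, False],
      gen_for 1 (gen_bits (concat (replicate (length wins * 2) [True, False]))), gen_bits [True, True, False, False]]"

definition gen_costs :: gen where
  "gen_costs = gen_concat
     [gen_bits (True # encode_rat (1 / 2)),
      gen_for 0 (gen_concat (map (\<lambda>_. gen_bits (True # encode_rat 1)) tls)),
      gen_for 0 (gen_concat (map (\<lambda>_. App (gen_bits [True]) gen_eps) wins)), gen_bits [False]]"

definition gen_tolerances :: gen where
  "gen_tolerances = gen_concat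
     [gen_for 1 (gen_bits (concat (replicate (length wins * 2) (True # encode_rat (1 / 4))))),
      gen_bits (True # encode_rat (1 / 4)), gen_bits [False]]"

definition gen_instance :: gen where
  "gen_instance = gen_concat [gen_prior, gen_models, gen_costs, gen_tolerances]"

text \<open>The rulers of the input length come first because they drive the polynomials. Symbol 5
  fills the gaps on tape 5, as a blank inside the output would stop the rewinding.\<close>

definition stages :: "stage list" where
  "stages =
     [([10..<10 + depth], gen_for 3 (Emit 1)),
      ([6], App (gen_word [3, 3]) (gen_for 3 (If (\<lambda>ss. ss ! 0 = 1) (Emit 1) (Emit 2)))),
      ([7], App (gen_word [3, 3]) (gen_poly 1 4 (coeffs p))),
      ([8], gen_poly 1 4 (coeffs inner_poly)),
      ([9], App (gen_word [1, 1, 2]) (gen_poly 1 4 (coeffs row_poly))),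
      ([5], App (gen_word [1, 2, 3]) (App (gen_poly 5 4 (coeffs row_poly)) (Emit 4))),
      ([2, 3, 4], gen_poly 1 4 (coeffs cells_poly)),
      ([1], gen_instance)]"

lemma gen_eps_one_props:
  "gen_vars gen_eps = {2}" "gen_vars gen_one = {2}" "gen_wf gen_eps" "gen_wf gen_one"
  "gen_symbols gen_eps \<subseteq> {0<..<6}" "gen_symbols gen_one \<subseteq> {0<..<6}"
  by (auto simp: gen_eps_def gen_one_def bit_symbol_def)

lemma gen_row_props: "gen_vars (gen_row b) = {2}" "gen_wf (gen_row b)" "gen_symbols (gen_row b) \<subseteq> {0<..<6}"
  using gen_eps_one_props by (auto simp: gen_row_def bit_symbol_def)

lemma gen_labels_props: "gen_vars (gen_labels P) \<subseteq> {1, 2}" "gen_wf (gen_labels P)" "gen_symbols (gen_labels P) \<subseteq> {0<..<6}"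
  using gen_row_props by (auto simp: gen_labels_def bit_symbol_def)

lemma gen_models_props: "gen_vars gen_models \<subseteq> {0, 1, 2}" "gen_wf gen_models" "gen_symbols gen_models \<subseteq> {0<..<6}"
proof -
  have v: "gen_vars (gen_labels P) \<subseteq> {0, 1, 2}" "0 \<notin> gen_vars (gen_labels P)" for P
    using gen_labels_props(1)[of P] by auto
  show "gen_vars gen_models \<subseteq> {0, 1, 2}" using v(1) by (simp add: gen_models_def UN_subset_iff)
  show "gen_wf gen_models" using v(2) by (simp add: gen_models_def gen_labels_props(2))
  show "gen_symbols gen_models \<subseteq> {0<..<6}"
    using gen_labels_props(3) by (simp add: gen_models_def UN_subset_iff bit_symbol_def)
qed

lemma gen_prior_props: "gen_vars gen_prior \<subseteq> {0, 1, 2}" "gen_wf gen_prior" "gen_symbols gen_prior \<subseteq> {0<..<6}"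
  by (auto simp: gen_prior_def bit_symbol_def)

lemma gen_costs_props: "gen_vars gen_costs \<subseteq> {0, 1, 2}" "gen_wf gen_costs" "gen_symbols gen_costs \<subseteq> {0<..<6}"
  using gen_eps_one_props(1,3,5) by (auto simp: gen_costs_def bit_symbol_def)

lemma gen_tolerances_props:
  "gen_vars gen_tolerances \<subseteq> {0, 1, 2}" "gen_wf gen_tolerances" "gen_symbols gen_tolerances \<subseteq> {0<..<6}"
  by (auto simp: gen_tolerances_def bit_symbol_def)

lemma gen_instance_props: "gen_vars gen_instance \<subseteq> {0, 1, 2}" "gen_wf gen_instance" "gen_symbols gen_instance \<subseteq> {0<..<6}"
  using gen_models_props gen_prior_props gen_costs_props gen_tolerances_props
  by (simp_all add: gen_instance_def)

lemma depth_pos: "0 < depth" by (simp add: depth_def)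

lemma stages_wf: "list_all (stage_wf 6) stages"
  using gen_instance_props
    subset_trans[OF gen_poly_props(3)[of 1 4]] subset_trans[OF gen_poly_props(3)[of 5 4]]
  by (auto simp: stages_def stage_wf_def depth_pos gen_poly_props(2))

end

text \<open>The input is fixed only here: the machine belongs to \<open>reduction\<close> and
  depends on the verifier and its two polynomials alone.\<close>

locale reduction_input = reduction +
  fixes x :: "bool list"
begin

sublocale tableau M x "poly p (length x)" "poly height_poly (length x)"
  by standard (auto simp: M_wf height_poly_def)

lemma poly_values:
  "poly row_poly (length x) = W - 1" "poly inner_poly (length x) = E" "poly cells_poly (length x) = N"
  by (simp_all add: row_poly_def inner_poly_def cells_poly_def W_def E_def N_def algebra_simps)

definition diff_word :: "nat list" where
  "diff_word = [1, 2, 3] @ replicate (W - 1) 5 @ [4]"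

lemma diff_word_nth:
  "word_tape diff_word (int c - int e) = (if c = e then 1 else if c = e + 1 then 2 else if c = e + 2 then 3
     else if c = e + W + 2 then 4 else if e < c \<and> c < e + W + 2 then 5 else 0)"
proof (cases "e \<le> c")
  case False
  then show ?thesis by (simp add: word_tape_def)
next
  case True
  define d where "d = c - e"
  have d: "int c - int e = int d" "c = e + d" using True by (auto simp: d_def)
  have "word_tape diff_word (int d) = (if d = 0 then 1 else if d = 1 then 2 else if d = 2 then 3
     else if d = W + 2 then 4 else if d < W + 2 then 5 else 0)"
  proof -
    consider "d < 3" | r where "d = 3 + r" by (metis le_add_diff_inverse not_less)
    then show ?thesis
    proof cases
      case 1
      then consider "d = 0" | "d = 1" | "d = 2" by linarith
      then show ?thesis by cases (simp_all add: diff_word_def word_tape_def)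
    next
      case 2
      obtain W' where W': "W = Suc W'" using W_gt by (cases W) auto
      have "nat (int d) = Suc (Suc (Suc r))" using 2 by simp
      then show ?thesis using 2 W'
        by (auto simp: diff_word_def word_tape_def nth_append)
    qed
  qed
  then show ?thesis unfolding d(1) by (simp add: d(2))
qed

definition final_store :: "(nat \<Rightarrow> nat list) \<Rightarrow> bool" where
  "final_store con \<longleftrightarrow> con 2 = replicate N 1 \<and> con 3 = replicate N 1 \<and> con 4 = replicate N 1 \<and>
     con 5 = diff_word \<and> con 6 = input_word \<and> con 7 = guess_word \<and> con 8 = replicate E 1 \<and> con 9 = row_word"

lemma position_heads:
  "position env 5 = env 0 - env 1" "j \<in> {6, 7, 8, 9} \<Longrightarrow> position env j = env 1"
proof -
  have *: "position env j = (\<Sum>i\<in>{0, 1}. env i * shift (head_move i j))" if "j \<in> {5, 6, 7, 8, 9}" for j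
    unfolding position_def
    by (rule sum.mono_neutral_right) (use that in \<open>auto simp: head_move_def\<close>)
  show "position env 5 = env 0 - env 1" using *[of 5] by (simp add: head_move_def)
  assume "j \<in> {6, 7, 8, 9}"
  then show "position env j = env 1" using *[of j] by (auto simp: head_move_def)
qed

context
  fixes con :: "nat \<Rightarrow> nat list"
  assumes con: "final_store con"
begin

declare One_nat_def [simp del]

lemma ruler_lengths [simp]:
  "length (con (ruler_tape 0)) = N" "length (con (ruler_tape 1)) = N" "length (con (ruler_tape 2)) = N"
  using con by (auto simp: final_store_def ruler_tape_def)

lemma view_nth:
  assumes "env 1 = int e"
  shows "env 0 = int c \<Longrightarrow> gview {1} con env ! 5 = word_tape diff_word (int c - int e)"
    "gview {1} con env ! 6 = word_tape input_word (int e)"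
    "gview {1} con env ! 7 = word_tape guess_word (int e)"
    "gview {1} con env ! 8 = (if e < E then 1 else 0)"
    "gview {1} con env ! 9 = word_tape row_word (int e)"
  using con assms by (auto simp: gview_def position_heads final_store_def word_tape_def)

lemma precision_eq: "precision = N * density"
  by (simp add: precision_def density_def)

lemma emitted_gen_eps: "emitted {1} con gen_eps env = map bit_symbol (encode_rat (1 / 2 ^ precision))"
  by (simp add: gen_eps_def encode_rat_inverse_pow2 concat_bits precision_eq)

lemma emitted_gen_one: "emitted {1} con gen_one env = map bit_symbol (encode_rat (1 - 1 / 2 ^ precision))"
  by (simp add: gen_one_def encode_rat_one_minus_inverse_pow2 concat_bits precision_eq)

lemma emitted_gen_row:
  "emitted {1} con (gen_row b) env = map bit_symbol (encode_list encode_rat (noise_row precision b))"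
  using emitted_gen_eps emitted_gen_one by (simp add: gen_row_def map_encode_list noise_row_def bit_symbol_def)

lemma emitted_choice:
  "emitted {1} con (If Q (gen_row True) (gen_row False)) env =
     map bit_symbol (encode_list encode_rat (noise_row precision (Q (gview {1} con env))))"
  by (simp add: emitted_gen_row)

text \<open>One label loop serves all three kinds of models: the condition \<open>P\<close> has to
  agree with the test only at the current values of the loop variables.\<close>

lemma emitted_gen_labels:
  assumes P: "\<And>e f b. e < N \<Longrightarrow> f \<in> set windows \<Longrightarrow> P f b (gview {1} con (env(1 := int e))) = test m (Some ((e, f), b))"
  shows "emitted {1} con (gen_labels P) env =
    map bit_symbol (encode_list (encode_list encode_rat) (map (\<lambda>l. noise_row precision (test m l)) query_labels))"
proof -
  let ?h = "\<lambda>l. 2 # map bit_symbol (encode_list encode_rat (noise_row precision (test m l)))"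
  have "emitted {1} con (gen_labels P) env = concat (map (\<lambda>e. concat (map (\<lambda>f. concat (map (\<lambda>b.
      2 # map bit_symbol (encode_list encode_rat (noise_row precision (P f b (gview {1} con (env(1 := int e)))))))
      [False, True])) wins)) [0..<N]) @ ?h None @ [1]"
    by (simp add: gen_labels_def bit_symbol_def comp_def emitted_gen_row emitted_choice del: emitted.simps(4))
  also have "\<dots> = concat (map (\<lambda>e. concat (map (\<lambda>f. concat (map ?h
      [Some ((e, f), False), Some ((e, f), True)])) windows)) [0..<N]) @ ?h None @ [1]"
    using P by (intro arg_cong2[of _ _ _ _ append] refl arg_cong[of _ _ concat] map_cong) auto
  also have "\<dots> = concat (map ?h query_labels) @ [1]"
    by (simp add: query_labels_def concat_map_concat)
  finally show ?thesis by (simp add: map_encode_list comp_def)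
qed

lemma view_covers_eq:
  assumes "env 0 = int c" "env 1 = int e"
  shows "view_covers s f (gview {1} con env) = covers c s e f"
proof (cases f)
  case None
  then show ?thesis using view_nth(1)[of env e c] assms by (simp add: diff_word_nth)
next
  case (Some w)
  obtain a0 a1 a2 a3 where "w = (a0, a1, a2, a3)" using prod_cases4 by blast
  then show ?thesis using Some view_nth(1)[of env e c] view_nth(2-5)[of env e] assms W_gt
    by (auto simp: diff_word_nth ok_def simp del: tile_ok.simps)
qed

lemma emitted_gen_models:
  "emitted {1} con gen_models (\<lambda>_. 0) = map bit_symbol (encode_list (encode_list (encode_list encode_rat))
     (map (\<lambda>m. map (\<lambda>l. noise_row precision (test m l)) query_labels) query_models))"
proof -
  let ?h = "\<lambda>m. 2 # map bit_symbol (encode_list (encode_list encode_rat) (map (\<lambda>l. noise_row precision (test m l)) query_labels))"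
  have 1: "emitted {1} con (gen_labels (\<lambda>f b ss. b \<and> f \<noteq> None)) env = tl (?h Generic)" for env
    using emitted_gen_labels[of "\<lambda>f b ss. b \<and> f \<noteq> None" env Generic] by simp
  have 2: "emitted {1} con (gen_labels (\<lambda>f b ss. b \<and> view_covers s f ss)) ((\<lambda>_. 0)(0 := int c)) = tl (?h (Assign c s))" for c s
    using emitted_gen_labels[of "\<lambda>f b ss. b \<and> view_covers s f ss" "(\<lambda>_. 0)(0 := int c)" "Assign c s"]
      view_covers_eq[of "(\<lambda>_. 0)(0 := int c, 1 := int _)" c] by simp
  have 3: "emitted {1} con (gen_labels (\<lambda>f b ss. ss ! 5 = 1 \<and> f' = f)) ((\<lambda>_. 0)(0 := int c)) = tl (?h (Ident c f'))" for c f'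
    using emitted_gen_labels[of "\<lambda>f b ss. ss ! 5 = 1 \<and> f' = f" "(\<lambda>_. 0)(0 := int c)" "Ident c f'"]
    by (simp add: view_nth(1)[of _ _ c] diff_word_nth)
  have "emitted {1} con gen_models (\<lambda>_. 0) = ?h Generic @ concat (map (\<lambda>c. concat (map (\<lambda>s. ?h (Assign c s)) tls)) [0..<N]) @
      concat (map (\<lambda>c. concat (map (\<lambda>f'. ?h (Ident c f')) wins)) [0..<N]) @ [1]"
    unfolding gen_models_def
    by (simp add: 1 2 3 comp_def bit_symbol_def del: not_None_eq)
  also have "\<dots> = concat (map ?h query_models) @ [1]"
    by (simp add: query_models_def concat_map_concat comp_def)
  finally show ?thesis by (simp add: map_encode_list comp_def)
qed

lemma emitted_gen_prior:
  "emitted {1} con gen_prior (\<lambda>_. 0) = map bit_symbol (encode_list encode_rat (geometric_prior (length query_labels)))"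
proof -
  let ?F = "length wins * 2"
  let ?h = "\<lambda>j. 2 # map bit_symbol (encode_rat (1 / 2 ^ j))"
  have tw: "takeWhile (\<lambda>v. gview {1} con (((\<lambda>_. 0)(1 := int e))(0 := int v)) ! 5 \<noteq> 1) [0..<N] = [0..<e]" if "e < N" for e
  proof -
    have "gview {1} con (((\<lambda>_. 0)(1 := int e))(0 := int v)) ! 5 \<noteq> 1 \<longleftrightarrow> v \<noteq> e" for v
      by (subst view_nth(1)[of _ e v]) (auto simp: diff_word_nth)
    moreover have "takeWhile (\<lambda>v. v \<noteq> e) [0..<N] = [0..<e]"
    proof -
      have "[0..<N] = [0..<e] @ [e..<N]" using that by (metis le_add_same_cancel1 less_imp_le_nat upt_add_eq_append le_add_diff_inverse zero_le)
      moreover have "takeWhile (\<lambda>v. v \<noteq> e) [e..<N] = []" using that by (simp add: upt_conv_Cons)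
      ultimately show ?thesis by (simp only:) (subst takeWhile_append2, auto)
    qed
    ultimately show ?thesis by simp
  qed
  have inner: "emitted {1} con (gen_concat [gen_bits [True, True, True, False],
        For 0 (\<lambda>ss. ss ! 5 \<noteq> 1) (gen_bits (concat (replicate ?F [True, False]))),
        gen_bits (concat (replicate (Suc l) [True, False])), gen_bits [True, True, False]]) ((\<lambda>_. 0)(1 := int e)) = ?h (Suc (e * ?F + l))"
    if "e < N" for e l
  proof -
    have "Suc (e * ?F + l) = e * ?F + Suc l" by simp
    then have "?h (Suc (e * ?F + l)) = map bit_symbol ([True, True, True, False] @ concat (replicate (e * ?F) [True, False]) @
        concat (replicate (Suc l) [True, False]) @ [True, True, False])"
      by (simp only: encode_rat_inverse_pow2 replicate_add) (simp add: bit_symbol_def)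
    then show ?thesis using tw[OF that] by (simp add: concat_bits del: replicate_Suc)
  qed
  have "emitted {1} con gen_prior (\<lambda>_. 0) = concat (map (\<lambda>e. concat (map (\<lambda>l. ?h (Suc (e * ?F + l))) [0..<?F])) [0..<N]) @ ?h (N * ?F) @ [1]"
  proof -
    have "concat (map (\<lambda>e. emitted {1} con (gen_concat (map (\<lambda>l. gen_concat [gen_bits [True, True, True, False],
        For 0 (\<lambda>ss. ss ! 5 \<noteq> 1) (gen_bits (concat (replicate ?F [True, False]))),
        gen_bits (concat (replicate (Suc l) [True, False])), gen_bits [True, True, False]]) [0..<?F])) ((\<lambda>_. 0)(1 := int e))) [0..<N])
      = concat (map (\<lambda>e. concat (map (\<lambda>l. ?h (Suc (e * ?F + l))) [0..<?F])) [0..<N])"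
    proof (intro arg_cong[of _ _ concat] map_cong refl)
      fix e assume "e \<in> set [0..<N]"
      then have "e < N" by simp
      from inner[OF this] show "emitted {1} con (gen_concat (map (\<lambda>l. gen_concat [gen_bits [True, True, True, False],
        For 0 (\<lambda>ss. ss ! 5 \<noteq> 1) (gen_bits (concat (replicate ?F [True, False]))),
        gen_bits (concat (replicate (Suc l) [True, False])), gen_bits [True, True, False]]) [0..<?F])) ((\<lambda>_. 0)(1 := int e))
        = concat (map (\<lambda>l. ?h (Suc (e * ?F + l))) [0..<?F])"
        unfolding emitted_gen_concat map_map comp_def by (simp only:)
    qed
    moreover have "?h (N * ?F) @ [1] = map bit_symbol ([True, True, True, False] @ concat (replicate (N * ?F) [True, False]) @ [True, True, False, False])"
      by (simp only: encode_rat_inverse_pow2) (simp add: bit_symbol_def)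
    ultimately show ?thesis
      unfolding gen_prior_def emitted_gen_concat[of _ _ "_ # _"] list.map concat.simps emitted_gen_for
        emitted_gen_word append_Nil2
      by (simp add: concat_bits bit_symbol_def del: emitted_gen_concat)
  qed
  also have "\<dots> = concat (map (\<lambda>j. ?h (Suc j)) [0..<N * ?F]) @ ?h (N * ?F) @ [1]"
    by (simp only: concat_upt_mult)
  finally show ?thesis by (simp add: geometric_prior_def length_query_labels map_encode_list comp_def del: power_Suc)
qed

lemma emitted_gen_costs:
  "emitted {1} con gen_costs (\<lambda>_. 0) = map bit_symbol (encode_list encode_rat (map cost query_models))"
  using emitted_gen_eps
  by (simp add: gen_costs_def map_encode_list query_models_def concat_map_concat comp_def bit_symbol_def)

lemma emitted_gen_tolerances:
  "emitted {1} con gen_tolerances (\<lambda>_. 0) = map bit_symbol (encode_list encode_rat (map (\<lambda>_. 1 / 4) query_labels))"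
proof -
  have rep: "concat (map (\<lambda>_. w) xs) = concat (replicate (length xs) w)" for w :: "nat list" and xs :: "'c list"
    by (induction xs) auto
  have snoc: "concat (replicate (k + 1) w) = concat (replicate k w) @ w" for k and w :: "nat list"
    by (induction k) (auto simp: One_nat_def)
  have "map bit_symbol (encode_list encode_rat (map (\<lambda>_. 1 / 4) query_labels)) =
      map bit_symbol (concat (replicate (N * (length wins * 2)) (True # encode_rat (1 / 4)))) @
      2 # map bit_symbol (encode_rat (1 / 4)) @ [1]"
    by (simp add: map_encode_list comp_def rep length_query_labels map_concat bit_symbol_def snoc)
  then show ?thesis by (simp add: gen_tolerances_def concat_bits bit_symbol_def)
qed

lemma emitted_gen_instance:
  "emitted {1} con gen_instance (\<lambda>_. 0) =
     map bit_symbol (encode_query_design (test_design query_models query_labels test cost precision))"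
  using emitted_gen_prior emitted_gen_models emitted_gen_costs emitted_gen_tolerances
  by (simp add: gen_instance_def encode_query_design_def test_design_def)

end

section \<open>The run of the machine\<close>

definition copied :: "(nat \<Rightarrow> nat list) \<Rightarrow> bool" where
  "copied con \<longleftrightarrow> (\<forall>i. 4 \<le> i \<and> i < 4 + depth \<longrightarrow> con (ruler_tape i) = replicate (length x) 1)"

lemma emitted_gen_poly_copied:
  assumes "copied con" "length (coeffs f) < depth"
  shows "emitted J con (gen_poly a 4 (coeffs f)) env = replicate (poly f (length x)) a"
  by (rule emitted_gen_poly) (use assms in \<open>auto simp: copied_def\<close>)

lemma depth_gt:
  "length (coeffs p) < depth" "length (coeffs row_poly) < depth" "length (coeffs inner_poly) < depth"
  "length (coeffs cells_poly) < depth"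
  by (auto simp: depth_def)

lemma length_x_le: "length x \<le> N"
  using len_x W_gt by (simp add: N_def)

lemma store_ok_copied:
  assumes "copied con" "J \<subseteq> {..<10}" "length (coeffs f) < depth"
  shows "store_ok J con N (gen_vars (gen_poly a 4 (coeffs f)))"
proof -
  have "4 \<le> i \<and> i < 4 + depth" if "i \<in> gen_vars (gen_poly a 4 (coeffs f))" for i
    using gen_poly_props(1)[of a 4 "coeffs f"] that assms(3) by fastforce
  moreover have "10 \<le> ruler_tape i" if "4 \<le> i" for i using that by (simp add: ruler_tape_def)
  ultimately show ?thesis
    using assms(1,2) length_x_le by (fastforce simp: store_ok_def copied_def)
qed

definition initial_store :: "nat \<Rightarrow> nat list" where
  "initial_store = (\<lambda>j. if j = 0 then map bit_symbol x else [])"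

lemma stage_store_single: "stage_store ([j], g) con = con(j := emitted {j} con g (\<lambda>_. 0))"
  by (auto simp: stage_store_def)

lemma emitted_input_copy:
  assumes "con 0 = map bit_symbol x"
  shows "emitted {6} con (App (gen_word [3, 3]) (gen_for 3 (If (\<lambda>ss. ss ! 0 = 1) (Emit 1) (Emit 2)))) (\<lambda>_. 0) = input_word"
proof -
  have r: "ruler_tape 3 = 0" by (simp add: ruler_tape_def)
  have v: "gview {6} con env ! 0 = word_tape (map bit_symbol x) (env 3)" for env
    using gview_ruler[of 3 "{6}" con env] by (simp add: r assms)
  have "emitted {6} con (If (\<lambda>ss. ss ! 0 = 1) (Emit 1) (Emit 2)) ((\<lambda>_. 0)(3 := int i)) = [bit_symbol (x ! i)]" if "i < length x" for i
    using that by (simp add: v word_tape_def bit_symbol_def)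
  then have "emitted {6} con (gen_for 3 (If (\<lambda>ss. ss ! 0 = 1) (Emit 1) (Emit 2))) (\<lambda>_. 0) =
      concat (map (\<lambda>i. [bit_symbol (x ! i)]) [0..<length x])"
    unfolding emitted_gen_for r assms length_map by (intro arg_cong[of _ _ concat] map_cong) auto
  also have "\<dots> = map bit_symbol (map (\<lambda>i. x ! i) [0..<length x])" by simp
  also have "\<dots> = map bit_symbol x" by (simp only: map_nth)
  finally show ?thesis by (simp add: input_word_def)
qed

lemma stages_run:
  "stages_ok N initial_store stages"
  "fold stage_store stages initial_store 1 =
     map bit_symbol (encode_query_design (test_design query_models query_labels test cost precision))"
proof -
  let ?st = "\<lambda>i. stages ! i"
  define c1 where "c1 = stage_store (?st 0) initial_store"
  define c2 where "c2 = c1(6 := input_word)"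
  define c3 where "c3 = c2(7 := guess_word)"
  define c4 where "c4 = c3(8 := replicate E 1)"
  define c5 where "c5 = c4(9 := row_word)"
  define c6 where "c6 = c5(5 := diff_word)"
  define c7 where "c7 = stage_store (?st 6) c6"
  have r3: "ruler_tape 3 = 0" by (simp add: ruler_tape_def)
  have c1_eq: "c1 j = (if 10 \<le> j \<and> j < 10 + depth then replicate (length x) 1 else initial_store j)" for j
  proof -
    have "map (\<lambda>v. Suc 0) [0..<m] = replicate m (Suc 0)" for m
      by (induction m) (auto simp: replicate_append_same)
    then show ?thesis by (simp add: c1_def stage_store_def stages_def r3 initial_store_def)
  qed
  have copied: "copied c1" "copied c2" "copied c3" "copied c4" "copied c5" "copied c6"
    by (auto simp: copied_def ruler_tape_def c1_eq c2_def c3_def c4_def c5_def c6_def)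
  note pol = emitted_gen_poly_copied
  have s1: "stage_store (?st 1) c1 = c2"
    using emitted_input_copy[of c1] by (simp add: stages_def stage_store_single c2_def c1_eq initial_store_def)
  have s2: "stage_store (?st 2) c2 = c3"
    using pol[OF copied(2) depth_gt(1)] by (simp add: stages_def stage_store_single c3_def guess_word_def)
  have s3: "stage_store (?st 3) c3 = c4"
    using pol[OF copied(3) depth_gt(3)] by (simp add: stages_def stage_store_single c4_def poly_values)
  have s4: "stage_store (?st 4) c4 = c5"
    using pol[OF copied(4) depth_gt(2)] by (simp add: stages_def stage_store_single c5_def poly_values row_word_def)
  have s5: "stage_store (?st 5) c5 = c6"
    using pol[OF copied(5) depth_gt(2)] by (simp add: stages_def stage_store_single c6_def poly_values diff_word_def)
  have c7_eq: "c7 j = (if j \<in> {2, 3, 4} then replicate N 1 else c6 j)" for j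
    using pol[OF copied(6) depth_gt(4)] by (simp add: c7_def stages_def stage_store_def poly_values)
  have final: "final_store c7"
    by (simp add: final_store_def c7_eq c6_def c5_def c4_def c3_def c2_def)
  have list: "stages = [?st 0, ?st 1, ?st 2, ?st 3, ?st 4, ?st 5, ?st 6, ?st 7]"
    by (simp add: stages_def)
  have "fold stage_store stages initial_store 1 = stage_store (?st 7) c7 1"
    by (subst list) (simp add: s1 s2 s3 s4 s5 c1_def[symmetric] c7_def[symmetric] del: One_nat_def)
  also have "\<dots> = emitted {1} c7 gen_instance (\<lambda>_. 0)" by (simp add: stages_def stage_store_single)
  finally show "fold stage_store stages initial_store 1 =
     map bit_symbol (encode_query_design (test_design query_models query_labels test cost precision))"
    using emitted_gen_instance[OF final] by simp
  have nz: "0 \<notin> set (map bit_symbol x)" by (auto simp: bit_symbol_def)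
  have ok0: "stage_ok N initial_store (?st 0)"
    using nz length_x_le by (auto simp: stage_ok_def stages_def store_ok_def r3 initial_store_def)
  have ok1: "stage_ok N c1 (?st 1)"
    using nz length_x_le by (auto simp: stage_ok_def stages_def store_ok_def r3 c1_eq initial_store_def)
  note blank = c2_def c3_def c4_def c5_def c6_def c1_eq initial_store_def
  have ok2: "stage_ok N c2 (?st 2)"
    using store_ok_copied[OF copied(2) _ depth_gt(1), of "{7}"] by (simp add: stage_ok_def stages_def blank)
  have ok3: "stage_ok N c3 (?st 3)"
    using store_ok_copied[OF copied(3) _ depth_gt(3), of "{8}"] by (simp add: stage_ok_def stages_def blank)
  have ok4: "stage_ok N c4 (?st 4)"
    using store_ok_copied[OF copied(4) _ depth_gt(2), of "{9}"] by (simp add: stage_ok_def stages_def blank)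
  have ok5: "stage_ok N c5 (?st 5)"
    using store_ok_copied[OF copied(5) _ depth_gt(2), of "{5}"] by (simp add: stage_ok_def stages_def blank)
  have ok6: "stage_ok N c6 (?st 6)"
    using store_ok_copied[OF copied(6) _ depth_gt(4), of "{2, 3, 4}"] by (simp add: stage_ok_def stages_def blank)
  have "store_ok {1} c7 N {0, 1, 2}"
    using final by (auto simp: store_ok_def ruler_tape_def final_store_def)
  then have "store_ok {1} c7 N (gen_vars gen_instance)"
    using gen_instance_props(1) unfolding store_ok_def by blast
  then have ok7: "stage_ok N c7 (?st 7)" by (simp add: stage_ok_def stages_def c7_eq blank)
  show "stages_ok N initial_store stages"
    by (subst list) (simp add: ok0 ok1 ok2 ok3 ok4 ok5 ok6 ok7 s1 s2 s3 s4 s5 c1_def[symmetric] c7_def[symmetric] del: One_nat_def)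
qed

lemma query_machine_decides:
  assumes tie: "\<And>S. finite S \<Longrightarrow> S \<noteq> {} \<Longrightarrow> tie S \<in> (S :: nat set)"
    and S: "solves S (query_design_problem tie)"
    and Q: "Q = query_machine (10 + depth) 6 (stages_prog stages)"
  shows "state ((otm_step Q S ^^ poly (pcompose (stages_time stages) cells_poly + 3) (length x)) (tm_init Q [x])) =
    (if \<exists>v. solution v then accept Q else reject Q)"
proof -
  let ?I = "test_design query_models query_labels test cost precision"
  interpret test_cover query_models query_labels test cost precision tie
    by (rule test_cover_csp[OF tie])
  obtain s where s: "optimal (query_design_problem tie) ?I s"
    "S (encode_query_design ?I) = encode_list encode_nat s"
    using S design_wf optimal_exists unfolding solves_def by (auto simp: query_design_problem_def)
  obtain r0 rs where r: "s = r0 # rs" "r0 = 0 \<longleftrightarrow> (\<exists>v. solution v)"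
    using optimal_plan_iff_solution[OF tie s(1)] by blast
  \<comment> \<open>The first bit opens the list. The second one is the first bit of
    \<open>encode_nat r0\<close>, which is \<open>False\<close> exactly if
    \<open>r0 = 0\<close>.\<close>
  obtain w where w: "encode_list encode_nat s = True # (r0 \<noteq> 0) # w"
    using r(1) by (cases "r0 = 0") (auto simp: encode_nat.simps[of r0] encode_nat.simps[of 0])
  obtain t where t: "t \<le> poly (stages_time stages) N"
    "exec (10 + depth) (stages_prog stages) (store_mem initial_store) t (store_mem (fold stage_store stages initial_store))"
    using exec_stages[OF stages_wf stages_run(1)] by blast
  have init: "store_mem initial_store = (tape (tm_init Q [x]), \<lambda>_. 0)"
    by (auto simp: store_mem_def initial_store_def tm_init_def string_tape_eq word_tape_def fun_eq_iff)
  have "tape_string (fst (store_mem (fold stage_store stages initial_store)) 1) = encode_query_design ?I"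
    using stages_run(2) by (simp add: store_mem_def string_tape_eq[symmetric] del: One_nat_def)
  then have "S (tape_string (fst (store_mem (fold stage_store stages initial_store)) 1)) = True # (r0 \<noteq> 0) # w"
    using s(2) w by simp
  \<comment> \<open>\<open>N\<close> bounds the rulers used by every stage, so substituting
    \<open>cells_poly\<close> turns the time bound into a polynomial in the input length.\<close>
  moreover have "t + 3 \<le> poly (pcompose (stages_time stages) cells_poly + 3) (length x)"
    using t(1) poly_values(3) by (simp add: poly_pcompose)
  ultimately have "state ((otm_step Q S ^^ poly (pcompose (stages_time stages) cells_poly + 3) (length x)) (tm_init Q [x])) =
    (if r0 \<noteq> 0 then reject Q else accept Q)"
    by (intro query_machine_run[OF _ _ _ _ Q, of x t]) (use t(2) init in auto)
  then show ?thesis using r(2) by auto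
qed

text \<open>Halting states persist and the verifier halts within \<open>V\<close> steps on every
  certificate of admissible length. Not being in the rejecting state up to time \<open>V\<close>
  therefore means acceptance.\<close>

lemma solution_iff_accepting_certificate:
  assumes halts: "\<And>u. state (run u (poly q (length x + length u))) \<in> {accept M, reject M}"
  shows "(\<exists>v. solution v) \<longleftrightarrow>
    (\<exists>u. length u \<le> poly p (length x) \<and> state (run u (poly q (length x + length u))) = accept M)"
proof -
  let ?V = "poly height_poly (length x)"
  have le: "poly q (length x + length u) \<le> ?V" if "length u \<le> poly p (length x)" for u :: "bool list"
  proof -
    have "poly q (length x + length u) \<le> poly q (length x + poly p (length x))"
      by (rule poly_nat_mono) (use that in simp)
    then show ?thesis by (simp add: height_poly_def poly_pcompose)
  qed
  have fixed: "state (run u t) = state (run u s)" if "state (run u s) \<in> {accept M, reject M}" "s \<le> t" for u s t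
  proof -
    have "tm_step M (run u s) = run u s" using that(1) by (simp add: tm_step_def)
    then show ?thesis using funpow_stable[OF refl _ that(2), of "tm_step M" "tm_init M [x, u]"] by simp
  qed
  have ne: "accept M \<noteq> reject M" using wf by (simp add: tm_wf_def)
  show ?thesis
  proof
    assume "\<exists>v. solution v"
    then obtain u where u: "length u \<le> poly p (length x)" "\<forall>t \<le> ?V. state (run u t) \<noteq> reject M"
      using solution_imp_certificate by blast
    then show "\<exists>u. length u \<le> poly p (length x) \<and> state (run u (poly q (length x + length u))) = accept M"
      using le[OF u(1)] halts[of u] by (intro exI[of _ u]) auto
  next
    assume "\<exists>u. length u \<le> poly p (length x) \<and> state (run u (poly q (length x + length u))) = accept M"
    then obtain u where u: "length u \<le> poly p (length x)" "state (run u (poly q (length x + length u))) = accept M" by blast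
    have "state (run u t) \<noteq> reject M" for t
      using fixed[where u = u and s = t and t = "poly q (length x + length u)"]
        fixed[where u = u and s = "poly q (length x + length u)" and t = t] u(2) ne
      by (metis insertI1 insertI2 nat_le_linear)
    then show "\<exists>v. solution v" using certificate_imp_solution[OF u(1)] by blast
  qed
qed

end

theorem theorem3p1:
  fixes tie :: "nat set \<Rightarrow> nat"
  assumes "\<And>S. finite S \<Longrightarrow> S \<noteq> {} \<Longrightarrow> tie S \<in> S"
  shows "NP_hard (query_design_problem tie)"
  unfolding NP_hard_def
proof
  fix A assume "A \<in> NP"
  then obtain M :: tm and p q :: "nat poly" where wf: "tm_wf M"
    and halts: "\<And>x u. state ((tm_step M ^^ poly q (length x + length u)) (tm_init M [x, u])) \<in> {accept M, reject M}"
    and A: "\<And>x. x \<in> A \<longleftrightarrow> (\<exists>u. length u \<le> poly p (length x) \<and>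
        state ((tm_step M ^^ poly q (length x + length u)) (tm_init M [x, u])) = accept M)"
    unfolding NP_def by blast
  interpret reduction M p q by standard (rule wf)
  define Q where "Q = query_machine (10 + depth) 6 (stages_prog stages)"
  have "otm_wf Q"
    unfolding Q_def by (rule query_machine_wf[OF prog_wf_stages[OF stages_wf]]) auto
  moreover have "state ((otm_step Q S ^^ poly (pcompose (stages_time stages) cells_poly + 3) (length x)) (tm_init Q [x])) =
      (if x \<in> A then accept Q else reject Q)" if "solves S (query_design_problem tie)" for S x
  proof -
    interpret reduction_input M p q x ..
    show ?thesis
      using query_machine_decides[OF assms that Q_def] solution_iff_accepting_certificate[OF halts] A by simp
  qed
  ultimately show "turing_reducible A (query_design_problem tie)"
    unfolding turing_reducible_def by blast
qed

end
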